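(* Let $(\phi_t)$ be a radial $m$-slits semigroup with associated points $a_j,b_j\in\partial\mathbb{D}$ and numbers $\sigma_j>0$, $j=1,\dots,m$, and let $G(z)=-zp(z)$ be its infinitesimal generator. Then $G$ has $m$ boundary regular null points $b_1,\dots,b_m\in\partial\mathbb{D}$, with dilations $2\sigma_1,\dots,2\sigma_m$ respectively. Also, $G$ has $m$ regular poles $a_1,\dots,a_m$, with masses $2\mu_1,\dots,2\mu_m>0$ respectively, such that $\sum_{j=1}^m\mu_j=1$. Moreover, $$p(z)=\sum_{j=1}^m\mu_j\frac{a_j+z}{a_j-z},\qquad \frac1{p(z)}=\sum_{j=1}^m\sigma_j\frac{b_j+z}{b_j-z}.\qquad( * )$$ Conversely, if $p$ is given by $( * )$ (for some distinct points $a_1,\dots,a_m\in\partial\mathbb{D}$, distinct points $b_1,\dots,b_m\in\partial\mathbb{D}$, and numbers $\mu_j,\sigma_j>0$ with $\sum_{j}\mu_j=\sum_{j}\sigma_j=1$), then the infinitesimal generator $G(z)=-zp(z)$ generates a radial $m$-slits semigroup.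
   Context: $\mathbb{D}$ is the open unit disc in $\mathbb{C}$. A semigroup $(\phi_t)_{t\ge0}$ of holomorphic self-maps of $\mathbb{D}$ is a family of holomorphic maps $\phi_t:\mathbb{D}\to\mathbb{D}$ with $\phi_0=\mathrm{id}$, $\phi_{t+s}=\phi_t\circ\phi_s$, and $t\mapsto\phi_t$ continuous for uniform convergence on compacta. Its infinitesimal generator is the unique holomorphic $G:\mathbb{D}\to\mathbb{C}$ with $\partial_t\phi_t(z)=G(\phi_t(z))$ for all $t\ge0$, $z\in\mathbb{D}$. A radial slit is a set $\Gamma=\{rT: r\in[s,+\infty)\}$ with $T\in\mathbb{C}\setminus\{0\}$, $s>0$; its tip is $sT$. A radial $m$-slit domain is $\Omega=\mathbb{C}\setminus\bigcup_{j=1}^m\Gamma_j$, where the $\Gamma_j$ are $m$ different radial slits (lying on different rays from $0$). Let $h:\mathbb{D}\to\Omega$ be the Riemann map with $h(0)=0$, $h'(0)>0$; up to dilating $\Omega$ one assumes $h'(0)=1$. The map $h$ extends continuously to $\partial\mathbb{D}$ as a map with values in $\mathbb{C}\mathbb{P}^1$. The associated radial $m$-slits semigroup is $\phi_t(z):=h^{-1}(e^{-t}h(z))$, $t\ge0$. Associated data: let $T_1$ be one of the tips with minimal real part and label the tips $T_1,\dots,T_m$ so that $T_j$ follows $T_{j-1}$ clockwise. Let $a_j\in\partial\mathbb{D}$ be the unique point with $h(a_j)=T_j$. Let $b_1,\dots,b_m\in\partial\mathbb{D}$ be the $m$ preimages of $\infty$ under $h$, labelled so that $b_j$ lies in the arc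 $[a_j,a_{j+1}]$ (from $a_j$ clockwise to $a_{j+1}$, indices mod $m$; for $m=1$ the arc is the whole circle). Let $2\pi\sigma_j$, $\sigma_j>0$, be the amplitude of the angle from the vector $T_j-0$ clockwise to the vector $T_{j+1}-0$ (indices mod $m$; $\sigma_1=1$ if $m=1$), so that $\sum_{j=1}^m\sigma_j=1$. $\angle\lim$ and $\angle\liminf$ denote non-tangential limit and lower limit, i.e. taken as $z\to x$ inside Stolz angles $\{z\in\mathbb{D}:|x-z|<R(1-|z|)\}$, $R>1$. A boundary regular null point for $G$ is a point $x\in\partial\mathbb{D}$ such that $\angle\lim_{z\to x}\frac{G(z)}{z-x}=\ell\in\mathbb{R}$ exists and is finite; $\ell$ is called the dilation of $G$ at $x$. A point $x\in\partial\mathbb{D}$ is a regular pole of $G$ of mass $C>0$ if $\angle\liminf_{z\to x}|G(z)(x-z)|=C\in(0,+\infty)$.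
   Formalization: The dilations of G at b_j are stated as 1/(2σ_j) instead of 2σ_j; the printed value is false, e.g. for m=1, p(z)=(1+z)/(1-z), b_1=-1, σ_1=1, where G(z)/(z+1) tends to 1/2, not 2. *)

theory Defs
  imports "HOL-Complex_Analysis.Complex_Analysis"
begin

text \<open>The open unit disc is \<^term>\<open>ball 0 1 :: complex set\<close>. A family \<open>(\<phi>\<^sub>t)\<close> with \<open>t \<ge> 0\<close> is a
  function of a real parameter that is only constrained for nonnegative parameters and points of
  the disc. Families of \<open>m\<close> points are indexed by \<open>0, \<dots>, m - 1\<close>.\<close>

definition holomorphic_semigroup :: "(real \<Rightarrow> complex \<Rightarrow> complex) \<Rightarrow> bool" where
  "holomorphic_semigroup \<phi> \<longleftrightarrow>
     (\<forall>t\<ge>0. \<phi> t holomorphic_on ball 0 1 \<and> \<phi> t ` ball 0 1 \<subseteq> ball 0 1) \<and>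
     (\<forall>z\<in>ball 0 1. \<phi> 0 z = z) \<and>
     (\<forall>t\<ge>0. \<forall>s\<ge>0. \<forall>z\<in>ball 0 1. \<phi> (t + s) z = \<phi> t (\<phi> s z)) \<and>
     (\<forall>K t. compact K \<and> K \<subseteq> ball 0 1 \<and> t \<ge> 0 \<longrightarrow> uniform_limit K \<phi> (\<phi> t) (at t within {0..}))"

definition infinitesimal_generator ::
    "(real \<Rightarrow> complex \<Rightarrow> complex) \<Rightarrow> (complex \<Rightarrow> complex) \<Rightarrow> bool" where
  "infinitesimal_generator \<phi> G \<longleftrightarrow>
     G holomorphic_on ball 0 1 \<and>
     (\<forall>t\<ge>0. \<forall>z\<in>ball 0 1. ((\<lambda>t. \<phi> t z) has_vector_derivative G (\<phi> t z)) (at t within {0..}))"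

definition radial_slit :: "complex \<Rightarrow> real \<Rightarrow> complex set" where
  "radial_slit T s = {of_real r * T | r. r \<ge> s}"

text \<open>The slit \<^term>\<open>radial_slit T s\<close> has tip \<open>s T\<close>. In a slit domain every slit is written
  with its tip as direction vector, so that \<open>s = 1\<close> and \<open>T j\<close> is the tip of the \<open>j\<close>-th slit.
  Two slits lie on different rays from the origin iff their tips have different \<^const>\<open>sgn\<close>.\<close>

definition radial_slit_domain :: "nat \<Rightarrow> (nat \<Rightarrow> complex) \<Rightarrow> complex set \<Rightarrow> bool" where
  "radial_slit_domain m T \<Omega> \<longleftrightarrow>
     (\<forall>j<m. T j \<noteq> 0) \<and> inj_on (\<lambda>j. sgn (T j)) {..<m} \<and>
     \<Omega> = UNIV - (\<Union>j<m. radial_slit (T j) 1)"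

definition normalized_riemann_map :: "(complex \<Rightarrow> complex) \<Rightarrow> complex set \<Rightarrow> bool" where
  "normalized_riemann_map h \<Omega> \<longleftrightarrow>
     h holomorphic_on ball 0 1 \<and> bij_betw h (ball 0 1) \<Omega> \<and> h 0 = 0 \<and> deriv h 0 = 1"

definition radial_slits_semigroup ::
    "nat \<Rightarrow> (nat \<Rightarrow> complex) \<Rightarrow> (complex \<Rightarrow> complex) \<Rightarrow> (real \<Rightarrow> complex \<Rightarrow> complex) \<Rightarrow> bool" where
  "radial_slits_semigroup m T h \<phi> \<longleftrightarrow>
     (\<exists>\<Omega>. radial_slit_domain m T \<Omega> \<and> normalized_riemann_map h \<Omega>) \<and>
     (\<forall>t\<ge>0. \<forall>z\<in>ball 0 1. \<phi> t z = inv_into (ball 0 1) h (of_real (exp (- t)) * h z))"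

text \<open>The angle in \<open>[0, 2\<pi>)\<close> through which \<open>u\<close> has to be turned clockwise to point in the
  direction of \<open>v\<close>.\<close>

definition clockwise_angle :: "complex \<Rightarrow> complex \<Rightarrow> real" where
  "clockwise_angle u v = Arg2pi (u / v)"

text \<open>The closed arc of the unit circle from \<open>u\<close> clockwise to \<open>v\<close>; it is the whole circle for
  \<open>u = v\<close>, the case that occurs for a single slit.\<close>

definition clockwise_arc :: "complex \<Rightarrow> complex \<Rightarrow> complex set" where
  "clockwise_arc u v =
     (if u = v then sphere 0 1
      else {w \<in> sphere 0 1. clockwise_angle u w \<le> clockwise_angle u v})"

text \<open>The value at a boundary point \<open>x\<close> of the continuous extension of \<open>h\<close> to the closed disc, with
  values in the Riemann sphere, is the limit of \<open>h\<close> at \<open>x\<close> from within the disc; it is \<open>\<infinity>\<close> iff \<open>h\<close>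
  tends to infinity there.\<close>

definition associated_data ::
    "nat \<Rightarrow> (nat \<Rightarrow> complex) \<Rightarrow> (complex \<Rightarrow> complex) \<Rightarrow>
     (nat \<Rightarrow> complex) \<Rightarrow> (nat \<Rightarrow> complex) \<Rightarrow> (nat \<Rightarrow> real) \<Rightarrow> bool" where
  "associated_data m T h a b \<sigma> \<longleftrightarrow>
     (\<forall>j<m. Re (T 0) \<le> Re (T j)) \<and>
     strict_mono_on {..<m} (\<lambda>j. clockwise_angle (T 0) (T j)) \<and>
     (\<forall>j<m. a j \<in> sphere 0 1 \<and> (h \<longlongrightarrow> T j) (at (a j) within ball 0 1)) \<and>
     bij_betw b {..<m} {x \<in> sphere 0 1. filterlim h at_infinity (at x within ball 0 1)} \<and>
     (\<forall>j<m. b j \<in> clockwise_arc (a j) (a (Suc j mod m))) \<and>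
     (\<forall>j<m. 2 * pi * \<sigma> j =
        (if m = 1 then 2 * pi else clockwise_angle (T j) (T (Suc j mod m))))"

definition stolz_angle :: "complex \<Rightarrow> real \<Rightarrow> complex set" where
  "stolz_angle x R = {z \<in> ball 0 1. cmod (x - z) < R * (1 - cmod z)}"

definition nontangential_limit :: "(complex \<Rightarrow> complex) \<Rightarrow> complex \<Rightarrow> complex \<Rightarrow> bool" where
  "nontangential_limit f x l \<longleftrightarrow> (\<forall>R>1. (f \<longlongrightarrow> l) (at x within stolz_angle x R))"

definition nontangential_liminf :: "(complex \<Rightarrow> real) \<Rightarrow> complex \<Rightarrow> real \<Rightarrow> bool" where
  "nontangential_liminf f x c \<longleftrightarrow>
     (\<forall>R>1. Liminf (at x within stolz_angle x R) (\<lambda>z. ereal (f z)) = ereal c)"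

text \<open>The last argument of the next two predicates is the dilation and the mass, respectively.
  For a simple pole \<open>1 / p(z) = 2 \<sigma> b / (b - z) + O(1)\<close> at \<open>b\<close>, the function \<open>G(z) = - z p(z)\<close>
  satisfies \<open>G(z) / (z - b) \<rightarrow> 1 / (2 \<sigma>)\<close>, so its dilation at \<open>b\<close> is \<open>1 / (2 \<sigma>)\<close>.\<close>

definition boundary_regular_null_point :: "(complex \<Rightarrow> complex) \<Rightarrow> complex \<Rightarrow> real \<Rightarrow> bool" where
  "boundary_regular_null_point G x l \<longleftrightarrow>
     x \<in> sphere 0 1 \<and> nontangential_limit (\<lambda>z. G z / (z - x)) x (of_real l)"

definition regular_pole :: "(complex \<Rightarrow> complex) \<Rightarrow> complex \<Rightarrow> real \<Rightarrow> bool" where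
  "regular_pole G x C \<longleftrightarrow>
     x \<in> sphere 0 1 \<and> C > 0 \<and> nontangential_liminf (\<lambda>z. cmod (G z * (x - z))) x C"

end

(*
  Let q = z h'/h, so that G = -z/q and p = 1/q.  By the Schwarz lemma for the semigroup, Re q >= 0,
  so q(r z) is the Herglotz integral of the probability measures Re q(r e^{it}) dt / (2 pi), whose
  distribution functions are (up to 2 pi and a rotation) the arguments of h on the circle of radius r.
  Along a sequence r -> 1 these measures converge weakly.  If the limiting argument at some t were
  not the direction of a slit, then h would tend to infinity uniformly on an arc of the circles, which
  contradicts that log |h(z)/z| has mean zero.  Hence the limiting distribution function has finitely
  many values, the measure is discrete, and
    q(z) = sum_b s_b (b + z)/(b - z),   h(z) = z exp(-2 sum_b s_b Log(1 - z/b)).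
  For these explicit maps the direction of h on the unit circle jumps by 2 pi s_b at b and is constant
  in between; this gives s_b = sigma_j at b = b_j.  At a tip |h| has a minimum along the circle, so
  q(a_j) = 0, and partial fractions yield the formula for p, the imaginary constant being excluded by
  p(0) = 1.

  Conversely, Re q > 0 makes log h injective in the variable log z, hence h is injective, and the image
  of the circle is closed and invariant under multiplication by r >= 1, with one direction for each b.
  So it is a union of slits, whose complement is connected and contains the disc's image as an open
  and closed subset.
*)
theory Submission
  imports Defs "HOL-Probability.Probability" "HOL-Real_Asymp.Real_Asymp"
begin

text \<open>The boundary behaviour of the unknown Riemann map is never studied directly. Only
  circles of radius r < 1 are used until \<open>h\<close> is known explicitly; after that every
  boundary question is a computation with finitely many Herglotz kernels. Two points shape the limit
  r -> 1. The distribution functions record only increments of the argument, so the starting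
  direction must converge along the subsequence as well. And what the escape argument delivers is a
  finite set of cumulative values, from which a finite support has to be extracted. The weights and
  the zeros are then fixed by counting. The \<open>b j\<close> enumerate the points where
  \<open>h\<close> becomes infinite, so there are m atoms; the arc containing \<open>b j\<close>
  gives an inequality between weight and angle, and the equal totals turn it into an equality. The m
  distinct points \<open>a j\<close> give as many zeros of \<open>q\<close> as it has poles, which
  is what makes the partial fraction expansion of 1/q complete.\<close>

section \<open>Geometry of 1 - w, the Herglotz kernel, and boundary values of injective maps\<close>

lemma Re_one_minus_pos:
  assumes "cmod w \<le> 1" "w \<noteq> 1"
  shows "Re (1 - w) > 0"
proof (rule ccontr)
  assume "\<not> Re (1 - w) > 0"
  then have "Re w \<ge> 1" by simp
  with assms(1) have "Re w = 1" using complex_Re_le_cmod[of w] by linarith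
  moreover have "(Re w)\<^sup>2 + (Im w)\<^sup>2 \<le> 1"
    using assms(1) by (metis cmod_power2 norm_ge_zero power_le_one)
  ultimately have "Im w = 0" by simp
  with \<open>Re w = 1\<close> assms(2) show False by (simp add: complex_eq_iff)
qed

lemma Re_Herglotz_kernel:
  assumes "cmod b = 1"
  shows "Re ((b + z) / (b - z)) = (1 - (cmod z)\<^sup>2) / (cmod (b - z))\<^sup>2"
proof -
  have b: "(Re b)\<^sup>2 + (Im b)\<^sup>2 = 1" using assms by (metis cmod_power2 one_power2)
  have "Re (b + z) * Re (b - z) + Im (b + z) * Im (b - z) = 1 - (cmod z)\<^sup>2"
    using b unfolding cmod_power2 by (simp add: algebra_simps power2_eq_square)
  then show ?thesis
    by (simp add: Re_divide cmod_power2 add_divide_distrib[symmetric])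
qed

text \<open>The chord identity 1 - exp(i t) = 2 sin(t/2) exp(i (t - pi)/2) gives it: for 0 < t < 2
  pi the sine is positive and (t - pi)/2 lies in the range of the principal logarithm. The jump of
  \<open>Arg2pi\<close> at 1 later becomes the jump of direction of \<open>h\<close> along the
  circle.\<close>

lemma Im_Ln_one_minus:
  assumes "cmod w = 1" "w \<noteq> 1"
  shows "Im (Ln (1 - w)) = (Arg2pi w - pi) / 2"
proof -
  define t where "t = Arg2pi w"
  have w: "w = cis t"
    using complex_norm_eq_1_exp[of w] assms(1) by (simp add: t_def cis_conv_exp)
  have t0: "0 \<le> t" "t < 2 * pi" using Arg2pi[of w] by (auto simp: t_def)
  have "t \<noteq> 0" using w assms(2) by auto
  with t0 have s: "sin (t / 2) > 0" by (intro sin_gt_zero) auto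
  have "exp (Complex (ln (2 * sin (t / 2))) ((t - pi) / 2)) = of_real (2 * sin (t / 2)) * cis (t / 2 - pi / 2)"
    using s by (simp add: exp_eq_polar diff_divide_distrib)
  also have "\<dots> = 1 - cis t"
  proof -
    have "cis (t / 2 - pi / 2) = Complex (sin (t / 2)) (- cos (t / 2))"
      by (simp add: complex_eq_iff cos_diff sin_diff)
    moreover have "cos t = 1 - 2 * (sin (t / 2))\<^sup>2" using cos_double_sin[of "t / 2"] by simp
    moreover have "sin t = 2 * sin (t / 2) * cos (t / 2)" using sin_double[of "t / 2"] by simp
    ultimately show ?thesis by (simp add: complex_eq_iff power2_eq_square)
  qed
  finally have "Ln (1 - cis t) = Complex (ln (2 * sin (t / 2))) ((t - pi) / 2)"
    using t0 by (intro Ln_unique) auto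
  then show ?thesis by (simp add: w[symmetric]) (simp add: t_def)
qed

lemma sgn_exp_complex: "sgn (exp w) = cis (Im w)" for w :: complex
  by (simp add: sgn_div_norm exp_eq_polar norm_mult scaleR_conv_of_real)

text \<open>Suppose w = f z. A smaller disc around 0 containing z has an open image around w, so
  disc points near x are mapped into that image; injectivity then places these points in the smaller
  disc, away from the circle.\<close>

lemma boundary_value_notin_image:
  assumes hol: "f holomorphic_on ball 0 1" and inj: "inj_on f (ball 0 1)"
    and x: "cmod x = 1" and lim: "(f \<longlongrightarrow> w) (at x within ball 0 1)"
  shows "w \<notin> f ` ball 0 1"
proof
  assume "w \<in> f ` ball 0 1"
  then obtain z where z: "cmod z < 1" "w = f z" by auto
  then obtain r where r: "cmod z < r" "r < 1" using dense by blast
  have sub: "ball 0 r \<subseteq> ball (0::complex) 1" using r by auto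
  have "open (f ` ball 0 r)"
    using hol inj sub
    by (intro open_mapping_thm3) (auto intro: holomorphic_on_subset inj_on_subset)
  moreover have "w \<in> f ` ball 0 r" using z r by auto
  ultimately have "eventually (\<lambda>y. f y \<in> f ` ball 0 r) (at x within ball 0 1)"
    using lim by (simp add: tendsto_def)
  then obtain d where d: "d > 0" "\<And>y. y \<in> ball 0 1 \<Longrightarrow> y \<noteq> x \<Longrightarrow> dist y x < d \<Longrightarrow> f y \<in> f ` ball 0 r"
    unfolding eventually_at by blast
  \<comment> \<open>Here t \<ge> r keeps y outside the smaller disc, while 1 - t \<le> d/2 keeps y
    within d of x.\<close>
  define t where "t = max r (1 - d / 2)"
  have t: "r \<le> t" "t < 1" "0 < t" "1 - t < d"
    using r d(1) order.strict_trans1[OF norm_ge_zero r(1)] unfolding t_def by linarith+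
  define y where "y = of_real t * x"
  have y: "cmod y = t" using t x by (simp add: y_def norm_mult)
  have "dist y x = 1 - t"
  proof -
    have "y - x = of_real (t - 1) * x" by (simp add: y_def algebra_simps)
    then show ?thesis using t x unfolding dist_norm by (simp only: norm_mult norm_of_real) simp
  qed
  with y t have "f y \<in> f ` ball 0 r" using x by (intro d(2)) auto
  then obtain u where u: "u \<in> ball 0 r" "f y = f u" by auto
  with inj y t sub have "y = u" by (auto dest!: inj_onD)
  with u y t show False by auto
qed

section \<open>Explicit maps given by finitely many point masses on the circle\<close>

locale slit_map =
  fixes B :: "complex set" and s :: "complex \<Rightarrow> real"
  assumes finite_B: "finite B"
    and B_circle: "B \<subseteq> sphere 0 1"
    and s_pos: "b \<in> B \<Longrightarrow> s b > 0"
    and s_sum: "(\<Sum>b\<in>B. s b) = 1"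
begin

text \<open>This is \<open>h z / z\<close> with the removable singularity filled in. Since Re(1 -
  z/b) > 0 on the closed disc off \<open>B\<close>, the principal logarithms stay holomorphic across
  the circle there; at points of \<open>B\<close> the formula has only a default value, so boundary
  statements exclude \<open>B\<close> or take limits.\<close>

definition E :: "complex \<Rightarrow> complex" where
  "E z = exp (- 2 * (\<Sum>b\<in>B. of_real (s b) * Ln (1 - z / b)))"

definition h :: "complex \<Rightarrow> complex" where
  "h z = z * E z"

definition q :: "complex \<Rightarrow> complex" where
  "q z = (\<Sum>b\<in>B. of_real (s b) * ((b + z) / (b - z)))"

lemma norm_B: "b \<in> B \<Longrightarrow> cmod b = 1"
  using B_circle by auto

lemma nonzero_B: "b \<in> B \<Longrightarrow> b \<noteq> 0"
  using norm_B by fastforce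

lemma B_nonempty: "B \<noteq> {}"
  using s_sum by auto

lemma notin_B: "cmod z < 1 \<Longrightarrow> z \<notin> B"
  using norm_B by fastforce

lemma E_nonzero: "E z \<noteq> 0"
  by (simp add: E_def)

lemma h_0: "h 0 = 0"
  by (simp add: h_def)

lemma h_eq_0_iff: "h z = 0 \<longleftrightarrow> z = 0"
  by (simp add: h_def E_nonzero)

lemma q_0: "q 0 = 1"
proof -
  have "q 0 = (\<Sum>b\<in>B. of_real (s b))"
    unfolding q_def using nonzero_B by (intro sum.cong) auto
  then show ?thesis using s_sum by (simp flip: of_real_sum)
qed

lemma branch:
  assumes "cmod z \<le> 1" "z \<notin> B" "b \<in> B"
  shows "1 - z / b \<notin> \<real>\<^sub>\<le>\<^sub>0"
proof -
  have "Re (1 - z / b) > 0"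
    using assms norm_B[of b] nonzero_B[of b] by (intro Re_one_minus_pos) (auto simp: norm_divide)
  then show ?thesis by (auto simp: complex_nonpos_Reals_iff)
qed

text \<open>Each kernel is 1 + 2 z/(b - z), and since the weights sum to 1 the constant terms
  produce the 1 contributed by the factor z. The derivative is the full one also at circle points
  off \<open>B\<close>, so that \<open>h\<close> can be differentiated along the circle.\<close>

lemma has_field_derivative_h:
  assumes "cmod z \<le> 1" "z \<notin> B"
  shows "(h has_field_derivative E z * q z) (at z)"
proof -
  have nz: "b - z \<noteq> 0" if "b \<in> B" for b using that assms by auto
  have "(E has_field_derivative E z * (-2 * (\<Sum>b\<in>B. of_real (s b) * (- (1 / b) / (1 - z / b))))) (at z)"
    unfolding E_def using branch[OF assms] nonzero_B
    by (auto intro!: derivative_eq_intros sum.cong simp: divide_simps)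
  then have "(h has_field_derivative E z + z * (E z * (-2 * (\<Sum>b\<in>B. of_real (s b) * (- (1 / b) / (1 - z / b)))))) (at z)"
    unfolding h_def by (auto intro!: derivative_eq_intros)
  moreover have "E z + z * (E z * (-2 * (\<Sum>b\<in>B. of_real (s b) * (- (1 / b) / (1 - z / b))))) = E z * q z"
  proof -
    have "z * (- 2 * (\<Sum>b\<in>B. of_real (s b) * (- (1 / b) / (1 - z / b)))) = (\<Sum>b\<in>B. of_real (s b) * (2 * z / (b - z)))"
      unfolding sum_distrib_left using nonzero_B nz
      by (intro sum.cong) (auto simp: divide_simps)
    moreover have "(\<Sum>b\<in>B. complex_of_real (s b)) = 1" using s_sum by (simp flip: of_real_sum)
    moreover have "q z = (\<Sum>b\<in>B. of_real (s b)) + (\<Sum>b\<in>B. of_real (s b) * (2 * z / (b - z)))"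
      unfolding q_def sum.distrib[symmetric]
    proof (rule sum.cong)
      fix b assume "b \<in> B"
      from nz[OF this] have "(b + z) / (b - z) = 1 + 2 * z / (b - z)" by (simp add: divide_simps)
      then show "of_real (s b) * ((b + z) / (b - z)) = of_real (s b) + of_real (s b) * (2 * z / (b - z))"
        by (simp add: algebra_simps)
    qed simp
    ultimately have "q z = 1 + z * (-2 * (\<Sum>b\<in>B. of_real (s b) * (- (1 / b) / (1 - z / b))))"
      by (simp only:)
    moreover have "E z + z * (E z * x) = E z * (1 + z * x)" for x by (simp add: algebra_simps)
    ultimately show ?thesis by (simp only:)
  qed
  ultimately show ?thesis by simp
qed

lemma continuous_on_h: "continuous_on (cball 0 1 - B) h"
  by (intro continuous_at_imp_continuous_on ballI DERIV_isCont[OF has_field_derivative_h]) auto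

lemma holomorphic_on_h: "h holomorphic_on ball 0 1"
  unfolding holomorphic_on_def field_differentiable_def
  using has_field_derivative_h notin_B
  by (metis has_field_derivative_at_within less_imp_le mem_ball_0)

lemma deriv_h: "cmod z < 1 \<Longrightarrow> deriv h z = E z * q z"
  using has_field_derivative_h notin_B by (intro DERIV_imp_deriv) auto

lemma E_0: "E 0 = 1"
  by (simp add: E_def)

lemma continuous_on_q: "continuous_on (- B) q"
  unfolding q_def by (intro continuous_intros) auto

lemma holomorphic_on_q: "q holomorphic_on - B"
  unfolding q_def by (intro holomorphic_intros) auto

lemma Re_q: "Re (q z) = (1 - (cmod z)\<^sup>2) * (\<Sum>b\<in>B. s b / (cmod (b - z))\<^sup>2)"
  unfolding q_def Re_sum sum_distrib_left
proof (rule sum.cong)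
  fix b assume "b \<in> B"
  then have "Re ((b + z) / (b - z)) = (1 - (cmod z)\<^sup>2) / (cmod (b - z))\<^sup>2"
    using norm_B by (intro Re_Herglotz_kernel)
  then show "Re (of_real (s b) * ((b + z) / (b - z))) = (1 - (cmod z)\<^sup>2) * (s b / (cmod (b - z))\<^sup>2)"
    unfolding scaleR_conv_of_real[symmetric] by simp
qed simp

lemma Re_q_pos:
  assumes "cmod z < 1"
  shows "Re (q z) > 0"
proof -
  have "(\<Sum>b\<in>B. s b / (cmod (b - z))\<^sup>2) > 0"
    using finite_B B_nonempty s_pos notin_B[OF assms] by (intro sum_pos) (auto simp: zero_less_divide_iff)
  moreover have "(cmod z)\<^sup>2 < 1" using assms by (simp add: power_less_one_iff)
  ultimately show ?thesis unfolding Re_q by simp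
qed

lemma Re_q_circle: "cmod z = 1 \<Longrightarrow> Re (q z) = 0"
  unfolding Re_q by simp

lemma norm_h:
  assumes "z \<notin> B"
  shows "cmod (h z) = cmod z * exp (\<Sum>b\<in>B. - 2 * s b * ln (cmod (1 - z / b)))"
proof -
  have "Re (- 2 * (\<Sum>b\<in>B. of_real (s b) * Ln (1 - z / b))) = (\<Sum>b\<in>B. - 2 * s b * ln (cmod (1 - z / b)))"
    unfolding sum_distrib_left Re_sum
  proof (rule sum.cong)
    fix b assume b: "b \<in> B"
    have "1 - z / b \<noteq> 0" using assms b nonzero_B[of b] by auto
    then show "Re (- 2 * (of_real (s b) * Ln (1 - z / b))) = - 2 * s b * ln (cmod (1 - z / b))" by simp
  qed simp
  then show ?thesis unfolding h_def E_def norm_mult norm_exp_eq_Re by simp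
qed

text \<open>In log |h| the term of \<open>b\<close> tends to +infinity and the remaining terms
  converge. The approach to \<open>b\<close> is unrestricted because limits along the circle are
  needed as well as limits from inside the disc.\<close>

lemma filterlim_h_at_infinity:
  assumes "b \<in> B"
  shows "filterlim h at_infinity (at b)"
proof -
  have b: "b \<noteq> 0" "cmod b = 1" using assms nonzero_B norm_B by auto
  have "eventually (\<lambda>z. z \<in> - (B - {b})) (at b)"
    using finite_B by (intro eventually_at_in_open' open_Compl finite_imp_closed) auto
  then have ev: "eventually (\<lambda>z. z \<notin> B) (at b)"
    using eventually_neq_at_within[of b b UNIV] by eventually_elim auto
  have "filterlim (\<lambda>z. 1 - z / b) (at 0) (at b)"
  proof -
    have "((\<lambda>z. 1 - z / b) \<longlongrightarrow> 1 - b / b) (at b)" using b by (intro tendsto_intros)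
    moreover have "eventually (\<lambda>z. 1 - z / b \<noteq> 0) (at b)"
      using eventually_neq_at_within[of b b UNIV] by eventually_elim (use b in auto)
    ultimately show ?thesis using b by (simp add: filterlim_at)
  qed
  then have "filterlim (\<lambda>z. cmod (1 - z / b)) (at_right 0) (at b)"
    by (simp add: filterlim_at tendsto_norm_zero_iff)
  then have "filterlim (\<lambda>z. ln (cmod (1 - z / b))) at_bot (at b)"
    by (rule filterlim_compose[OF ln_at_0])
  then have "filterlim (\<lambda>z. - ln (cmod (1 - z / b))) at_top (at b)"
    by (rule filterlim_compose[OF filterlim_uminus_at_top_at_bot])
  from filterlim_tendsto_pos_mult_at_top[OF tendsto_const[of "2 * s b"] _ this]
  have "filterlim (\<lambda>z. (- 2 * s b) * ln (cmod (1 - z / b))) at_top (at b)"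
    using s_pos[OF assms] by simp
  moreover have "((\<lambda>z. \<Sum>c\<in>B-{b}. - 2 * s c * ln (cmod (1 - z / c))) \<longlongrightarrow>
      (\<Sum>c\<in>B-{b}. - 2 * s c * ln (cmod (1 - b / c)))) (at b)"
    using nonzero_B by (intro tendsto_intros) auto
  ultimately have "filterlim (\<lambda>z. (\<Sum>c\<in>B-{b}. - 2 * s c * ln (cmod (1 - z / c))) + (- 2 * s b) * ln (cmod (1 - z / b))) at_top (at b)"
    by (rule filterlim_tendsto_add_at_top[rotated])
  then have "filterlim (\<lambda>z. \<Sum>c\<in>B. - 2 * s c * ln (cmod (1 - z / c))) at_top (at b)"
    unfolding sum.remove[OF finite_B assms] by (simp only: add.commute)
  then have "filterlim (\<lambda>z. exp (\<Sum>c\<in>B. - 2 * s c * ln (cmod (1 - z / c)))) at_top (at b)"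
    by (rule filterlim_compose[OF exp_at_top])
  from filterlim_tendsto_pos_mult_at_top[OF tendsto_norm[OF tendsto_ident_at[of b UNIV]] _ this]
  have "filterlim (\<lambda>z. cmod z * exp (\<Sum>c\<in>B. - 2 * s c * ln (cmod (1 - z / c)))) at_top (at b)"
    using b by simp
  moreover have "eventually (\<lambda>z. cmod (h z) = cmod z * exp (\<Sum>c\<in>B. - 2 * s c * ln (cmod (1 - z / c)))) (at b)"
    using ev by eventually_elim (rule norm_h)
  ultimately have "filterlim (\<lambda>z. cmod (h z)) at_top (at b)"
    by (simp only: filterlim_cong[OF refl refl])
  then show ?thesis by (simp add: filterlim_at_infinity_conv_norm_at_top)
qed

text \<open>In the variable w = log z the map becomes \<open>L\<close>, a branch of log h(exp w) on
  the left half plane with derivative \<open>q (exp w)\<close>. The half plane is convex and the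
  derivative has positive real part, so \<open>L\<close> is injective (the Noshiro-Warschawski
  argument); \<open>Lper\<close> absorbs the ambiguity of the logarithms.\<close>

lemma inj_on_h: "inj_on h (ball 0 1)"
proof -
  define F where "F z = - 2 * (\<Sum>b\<in>B. of_real (s b) * Ln (1 - z / b))" for z
  define L where "L w = w + F (exp w)" for w
  have EF: "E z = exp (F z)" for z by (simp add: E_def F_def)
  have hL: "h (exp w) = exp (L w)" for w by (simp add: h_def EF L_def exp_add)
  have Lper: "L (w + of_int (2 * k) * (of_real pi * \<i>)) = L w + of_int (2 * k) * (of_real pi * \<i>)" for w k
    using exp_eq[of "w + of_int (2 * k) * (of_real pi * \<i>)" w] by (auto simp: L_def)
  have LD: "(L has_field_derivative q (exp w)) (at w)" if "Re w < 0" for w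
  proof -
    have n: "cmod (exp w) < 1" using that by simp
    have "F field_differentiable at (exp w)"
      unfolding F_def using branch[of "exp w"] n notin_B[OF n] nonzero_B
      by (intro derivative_intros field_differentiable_compose[OF _ field_differentiable_at_Ln, unfolded o_def])
         (auto intro!: derivative_intros)
    \<comment> \<open>The derivative of \<open>F\<close> is not computed: differentiating
      \<open>h (exp w) = exp (L w)\<close> in two ways identifies 1 + D exp w with
      \<open>q (exp w)\<close>.\<close>
    then obtain D where D: "(F has_field_derivative D) (at (exp w))"
      by (auto simp: field_differentiable_def)
    have L1: "(L has_field_derivative 1 + D * exp w) (at w)"
      unfolding L_def by (rule DERIV_add[OF DERIV_ident DERIV_chain2[of F, OF D DERIV_exp]])
    have "((\<lambda>w. h (exp w)) has_field_derivative exp (L w) * (1 + D * exp w)) (at w)"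
      unfolding hL by (auto intro!: derivative_eq_intros L1)
    moreover have "((\<lambda>w. h (exp w)) has_field_derivative E (exp w) * q (exp w) * exp w) (at w)"
      using has_field_derivative_h[of "exp w"] n notin_B[OF n]
      by (intro DERIV_chain2[of h _ exp, OF _ DERIV_exp]) auto
    ultimately have "exp (L w) * (1 + D * exp w) = E (exp w) * q (exp w) * exp w"
      by (rule DERIV_unique)
    also have "\<dots> = exp (L w) * q (exp w)" using hL[of w] by (simp add: h_def ac_simps)
    finally show ?thesis using L1 by simp
  qed
  have Linj: "w = v" if "Re w < 0" "Re v < 0" "L w = L v" for w v
  proof (rule ccontr)
    assume ne: "w \<noteq> v"
    \<comment> \<open>The component of \<open>L\<close> in the direction v - w along the segment
      from w to v. Its derivative |v - w|^2 Re q is positive, which is incompatible with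
      \<open>L w = L v\<close>.\<close>
    define g where "g t = Re (cnj (v - w) * L (w + of_real t * (v - w)))" for t :: real
    have re: "Re (w + of_real t * (v - w)) < 0" if "0 \<le> t" "t \<le> 1" for t
    proof -
      have "Re (w + of_real t * (v - w)) = (1 - t) * Re w + t * Re v" by (simp add: algebra_simps)
      also have "\<dots> < 0"
        using that \<open>Re w < 0\<close> \<open>Re v < 0\<close>
        by (cases "t = 0") (auto intro!: add_nonpos_neg mult_pos_neg mult_nonneg_nonpos)
      finally show ?thesis .
    qed
    have "(g has_real_derivative (cmod (v - w))\<^sup>2 * Re (q (exp (w + of_real t * (v - w))))) (at t)"
      if "0 \<le> t" "t \<le> 1" for t
    proof -
      let ?c = "w + of_real t * (v - w)"
      have "((\<lambda>z. w + z * (v - w)) has_field_derivative v - w) (at (of_real t))"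
        by (auto intro!: derivative_eq_intros)
      then have "((\<lambda>z. L (w + z * (v - w))) has_field_derivative q (exp ?c) * (v - w)) (at (of_real t))"
        by (rule DERIV_chain2[where f = L and g = "\<lambda>z. w + z * (v - w)", OF LD[OF re[OF that]]])
      then have "((\<lambda>z. cnj (v - w) * L (w + z * (v - w))) has_field_derivative
          cnj (v - w) * (q (exp ?c) * (v - w))) (at (of_real t))"
        by (rule DERIV_cmult)
      then have "((\<lambda>t. cnj (v - w) * L (w + of_real t * (v - w))) has_vector_derivative
          cnj (v - w) * (q (exp ?c) * (v - w))) (at t)"
        by (rule has_vector_derivative_real_field)
      then have "(g has_vector_derivative Re (cnj (v - w) * (q (exp ?c) * (v - w)))) (at t)"
        unfolding g_def by (rule bounded_linear.has_vector_derivative[OF bounded_linear_Re])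
      moreover have "cnj (v - w) * (q (exp ?c) * (v - w)) = of_real ((cmod (v - w))\<^sup>2) * q (exp ?c)"
        unfolding complex_norm_square by (simp add: ac_simps)
      moreover have "Re (of_real x * y) = x * Re y" for x and y :: complex by simp
      ultimately show ?thesis
        by (simp only: has_real_derivative_iff_has_vector_derivative)
    qed
    moreover have "(cmod (v - w))\<^sup>2 * Re (q (exp (w + of_real t * (v - w)))) > 0" if "0 \<le> t" "t \<le> 1" for t
      using ne re[OF that] by (intro mult_pos_pos Re_q_pos) auto
    ultimately have "\<exists>y. (g has_real_derivative y) (at t) \<and> y > 0" if "0 \<le> t" "t \<le> 1" for t
      using that by blast
    then have "g 0 < g 1"
      by (intro DERIV_pos_imp_increasing[of 0 1 g, OF zero_less_one])
    moreover have "g 0 = g 1" unfolding g_def using that(3) by simp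
    ultimately show False by simp
  qed
  show ?thesis
  proof (rule inj_onI)
    fix z y :: complex assume zy: "z \<in> ball 0 1" "y \<in> ball 0 1" "h z = h y"
    show "z = y"
    proof (cases "z = 0 \<or> y = 0")
      case True
      then have "h z = 0 \<or> h y = 0" by (simp only: h_eq_0_iff)
      with zy(3) have "h z = 0" "h y = 0" by simp_all
      then show ?thesis by (simp only: h_eq_0_iff)
    next
      case False
      define w v where "w = Ln z" and "v = Ln y"
      have e: "exp w = z" "exp v = y" using False by (auto simp: w_def v_def)
      have re: "Re w < 0" "Re v < 0" using False zy by (auto simp: w_def v_def)
      have "exp (L w) = exp (L v)" by (simp only: hL[symmetric] e zy(3))
      then obtain k where k: "L w = L v + of_int (2 * k) * (of_real pi * \<i>)"
        unfolding exp_eq by (auto simp: mult_ac)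
      then have "L w = L (v + of_int (2 * k) * (of_real pi * \<i>))" by (simp only: Lper)
      then have "w = v + of_int (2 * k) * (of_real pi * \<i>)"
        by (rule Linj[rotated -1]) (use re in simp_all)
      then have "exp w = exp v" unfolding exp_eq by (intro exI[of _ k]) (simp add: mult_ac)
      then show ?thesis by (simp only: e)
    qed
  qed
qed

lemma h_circle_notin_image:
  assumes "cmod x = 1" "x \<notin> B"
  shows "h x \<notin> h ` ball 0 1"
proof -
  have "isCont h x" using assms by (intro DERIV_isCont[OF has_field_derivative_h]) auto
  then have "(h \<longlongrightarrow> h x) (at x within ball 0 1)"
    by (metis continuous_at_imp_continuous_at_within continuous_within)
  then show ?thesis
    using holomorphic_on_h inj_on_h assms by (intro boundary_value_notin_image)
qed

lemma sgn_h:
  assumes "cmod x = 1" "x \<notin> B"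
  shows "sgn (h x) = x * cis (\<Sum>b\<in>B. s b * (pi - Arg2pi (x / b)))"
proof -
  have "Im (- 2 * (\<Sum>b\<in>B. of_real (s b) * Ln (1 - x / b))) = (\<Sum>b\<in>B. s b * (pi - Arg2pi (x / b)))"
    unfolding sum_distrib_left Im_sum
  proof (rule sum.cong)
    fix b assume b: "b \<in> B"
    have "Im (Ln (1 - x / b)) = (Arg2pi (x / b) - pi) / 2"
      using assms b norm_B nonzero_B by (intro Im_Ln_one_minus) (auto simp: norm_divide)
    moreover have "Im (- 2 * (of_real (s b) * w)) = - 2 * s b * Im w" for w by simp
    ultimately show "Im (- 2 * (of_real (s b) * Ln (1 - x / b))) = s b * (pi - Arg2pi (x / b))"
      by (simp only:) (simp add: field_simps)
  qed simp
  moreover have "sgn x = x" using assms by (simp add: sgn_div_norm)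
  ultimately show ?thesis by (simp only: h_def E_def sgn_mult sgn_exp_complex)
qed

text \<open>Turning clockwise from u to v by the angle f lowers each \<open>Arg2pi (x / b)\<close>
  by f, except that 2 pi is gained when b is passed. The weights sum to 1, so the total contribution
  f cancels the rotation of the factor x itself and only the jumps remain.\<close>

lemma sgn_h_clockwise:
  assumes u: "cmod u = 1" "u \<notin> B" and v: "cmod v = 1" "v \<notin> B"
  shows "sgn (h v) = sgn (h u) *
    cis (- 2 * pi * (\<Sum>b | b \<in> B \<and> clockwise_angle u b \<le> clockwise_angle u v. s b))"
proof -
  define f where "f = Arg2pi (u / v)"
  have nz: "u \<noteq> 0" "v \<noteq> 0" using u v by auto
  have ca: "w = cis (Arg2pi w)" if "cmod w = 1" for w
    using complex_norm_eq_1_exp[of w] that by (simp add: cis_conv_exp)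
  have f: "u = v * cis f" "0 \<le> f" "f < 2 * pi"
    using ca[of "u / v"] u v nz Arg2pi[of "u / v"] by (auto simp: f_def norm_divide field_simps)
  have "v = u * cis (- f)" using f by (simp add: cis_mult)
  have arg: "pi - Arg2pi (v / b) = (pi - Arg2pi (u / b)) + f - 2 * pi * (if Arg2pi (u / b) \<le> f then 1 else 0)"
    if b: "b \<in> B" for b
  proof -
    define g where "g = Arg2pi (u / b)"
    have bn: "cmod b = 1" "b \<noteq> 0" using b norm_B nonzero_B by auto
    have g: "u = b * cis g" "0 \<le> g" "g < 2 * pi"
      using ca[of "u / b"] u bn Arg2pi[of "u / b"] by (auto simp: g_def norm_divide field_simps)
    have "g \<noteq> f" using g(1) f(1) b v(2) by auto
    have "v = b * cis (g - f)" using \<open>v = u * cis (- f)\<close> g(1) by (simp add: cis_mult)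
    then have vb: "v / b = cis (g - f)" using bn by simp
    have "Arg2pi (v / b) = (if g \<le> f then g - f + 2 * pi else g - f)"
    proof (rule Arg2pi_unique[where r = 1])
      have "cis (g - f + 2 * pi) = cis (g - f)" by (simp add: complex_eq_iff)
      then show "complex_of_real 1 * exp (\<i> * complex_of_real (if g \<le> f then g - f + 2 * pi else g - f)) = v / b"
        unfolding vb by (simp add: cis_conv_exp[symmetric])
    qed (use f g \<open>g \<noteq> f\<close> in auto)
    then show ?thesis by (auto simp: g_def)
  qed
  have "(\<Sum>b\<in>B. s b * (pi - Arg2pi (v / b))) =
      (\<Sum>b\<in>B. s b * (pi - Arg2pi (u / b)) + s b * f - 2 * pi * (if Arg2pi (u / b) \<le> f then s b else 0))"
  proof (rule sum.cong)
    fix b assume "b \<in> B"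
    show "s b * (pi - Arg2pi (v / b)) =
        s b * (pi - Arg2pi (u / b)) + s b * f - 2 * pi * (if Arg2pi (u / b) \<le> f then s b else 0)"
      unfolding arg[OF \<open>b \<in> B\<close>] by (simp add: algebra_simps)
  qed simp
  also have "\<dots> = (\<Sum>b\<in>B. s b * (pi - Arg2pi (u / b))) + f
      - 2 * pi * (\<Sum>b | b \<in> B \<and> Arg2pi (u / b) \<le> f. s b)"
    using s_sum finite_B
    by (simp add: sum.distrib sum_subtractf flip: sum_distrib_left sum_distrib_right)
       (simp add: sum.If_cases Int_def flip: sum.inter_filter)
  finally have "sgn (h v) = u * cis (- f) * cis (\<dots>)"
    using sgn_h[OF v] \<open>v = u * cis (- f)\<close> by simp
  also have "\<dots> = u * cis ((\<Sum>b\<in>B. s b * (pi - Arg2pi (u / b))))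
      * cis (- 2 * pi * (\<Sum>b | b \<in> B \<and> Arg2pi (u / b) \<le> f. s b))"
    by (simp add: cis_mult mult.assoc)
  finally show ?thesis
    using sgn_h[OF u] by (simp add: clockwise_angle_def f_def)
qed

end

subsection \<open>Distributions with finitely many cumulative values\<close>

text \<open>Removing the countably many rational intervals on which the distribution function is
  constant costs only a null set. At a remaining point c the function exceeds all its earlier
  values, so it is injective on what remains, and its values lie in the finite set
  \<open>V\<close>.\<close>

lemma (in real_distribution) AE_finite_support:
  assumes fin: "finite V" and V: "\<And>x. cdf M x \<in> V"
  obtains C where "finite C" "AE x in M. x \<in> C"
proof
  let ?F = "cdf M"
  define I where "I = {(a, b) | a b. a \<in> \<rat> \<and> b \<in> \<rat> \<and> a < b \<and> ?F a = ?F b}"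
  define C where "C = - (\<Union>(a, b)\<in>I. {a<..b})"
  have "countable I"
    by (rule countable_subset[of _ "\<rat> \<times> \<rat>"]) (auto simp: I_def countable_rat)
  moreover have "{a<..b} \<in> null_sets M" if "(a, b) \<in> I" for a b
  proof -
    have "measure M {a<..b} = 0" using that cdf_diff_eq[of a b] by (auto simp: I_def)
    then show ?thesis by (auto simp: null_sets_def emeasure_eq_measure)
  qed
  ultimately have "(\<Union>(a, b)\<in>I. {a<..b}) \<in> null_sets M"
    by (intro null_sets_UN') auto
  then show "AE x in M. x \<in> C"
    by (rule AE_I') (auto simp: C_def)
  have less: "?F a < ?F c" if cC: "c \<in> C" and ac: "a < c" for a c
  proof (rule ccontr)
    assume "\<not> ?F a < ?F c"
    then have Fac: "?F a = ?F c" using cdf_nondecreasing[of a c] ac by simp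
    have "(?F \<longlongrightarrow> ?F c) (at_right c)"
      using cdf_is_right_cont[of c] by (simp add: continuous_within)
    \<comment> \<open>As \<open>V\<close> is finite, deleting its other values leaves a
      neighbourhood of \<open>?F c\<close>; right continuity then makes \<open>?F\<close> constant
      just to the right of c.\<close>
    moreover have "open (- (V - {?F c}))"
      using fin by (intro open_Compl finite_imp_closed) auto
    ultimately have "eventually (\<lambda>x. ?F x \<in> - (V - {?F c})) (at_right c)"
      by (auto simp: tendsto_def)
    then have "eventually (\<lambda>x. ?F x = ?F c) (at_right c)"
      by eventually_elim (use V in auto)
    then obtain d where d: "d > c" "\<And>y. c < y \<Longrightarrow> y < d \<Longrightarrow> ?F y = ?F c"
      unfolding eventually_at_right_field by blast
    obtain b where b: "b \<in> \<rat>" "c < b" "b < d" using Rats_dense_in_real[OF d(1)] by blast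
    obtain a' where a': "a' \<in> \<rat>" "a < a'" "a' < c" using Rats_dense_in_real[OF ac] by blast
    have "?F a' = ?F c"
      using cdf_nondecreasing[of a a'] cdf_nondecreasing[of a' c] a' Fac by simp
    then have "(a', b) \<in> I" using a' b d(2)[of b] by (auto simp: I_def)
    then have "c \<notin> C" using a' b by (force simp: C_def)
    then show False using cC by simp
  qed
  have "inj_on ?F C"
    by (rule linorder_inj_onI) (use less in force)+
  moreover have "?F ` C \<subseteq> V" using V by auto
  ultimately show "finite C" using fin by (metis finite_imageD finite_subset)
qed

lemma (in real_distribution) integral_finite_support:
  fixes g :: "real \<Rightarrow> complex"
  assumes fin: "finite C" and C: "AE x in M. x \<in> C" and g [measurable]: "g \<in> borel_measurable borel"
  shows "(\<integral>x. g x \<partial>M) = (\<Sum>c\<in>C. of_real (measure M {c}) * g c)"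
proof -
  have "(\<integral>x. g x \<partial>M) = (\<integral>x. (\<Sum>c\<in>C. indicator {c} x *\<^sub>R g c) \<partial>M)"
  proof (rule integral_cong_AE)
    show "AE x in M. g x = (\<Sum>c\<in>C. indicator {c} x *\<^sub>R g c)"
      using C
    proof eventually_elim
      case (elim x)
      then show ?case
        using fin by (simp add: sum.remove[of C x] indicator_def)
    qed
  qed (use g in measurable)
  also have "\<dots> = (\<Sum>c\<in>C. \<integral>x. indicator {c} x *\<^sub>R g c \<partial>M)"
    by (rule Bochner_Integration.integral_sum)
       (auto intro!: integrable_scaleR_left integrable_real_indicator simp: emeasure_eq_measure)
  also have "\<dots> = (\<Sum>c\<in>C. of_real (measure M {c}) * g c)"
    by (auto intro!: sum.cong simp: scaleR_conv_of_real)
  finally show ?thesis .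
qed

subsection \<open>The Herglotz formula on circles\<close>

lemma Cauchy_integral_cis:
  fixes g :: "complex \<Rightarrow> complex"
  assumes "continuous_on (cball 0 1) g" "g holomorphic_on ball 0 1" "cmod w < 1"
  shows "((\<lambda>t. g (cis t) * (cis t / (cis t - w))) has_integral 2 * pi * g w) {0..2*pi}"
proof -
  have "((\<lambda>u. g u / (u - w)) has_contour_integral 2 * of_real pi * \<i> * g w) (part_circlepath 0 1 0 (2 * pi))"
    using Cauchy_integral_circlepath[of 0 1 g w] assms by (simp add: circlepath_def)
  then have "((\<lambda>t. g (0 + 1 * cis t) / (0 + 1 * cis t - w) * 1 * \<i> * cis t) has_integral 2 * of_real pi * \<i> * g w) {0..2*pi}"
    by (subst (asm) has_contour_integral_part_circlepath_iff) auto
  from has_integral_mult_right[OF this, of "- \<i>"] show ?thesis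
    by (simp add: algebra_simps)
qed

lemma mean_value_cis:
  fixes g :: "complex \<Rightarrow> complex"
  assumes "continuous_on (cball 0 1) g" "g holomorphic_on ball 0 1"
  shows "((\<lambda>t. g (cis t)) has_integral 2 * pi * g 0) {0..2*pi}"
  using Cauchy_integral_cis[OF assms, of 0] by simp

text \<open>Write Re g as half the sum of g and its conjugate. Up to the factor 2 pi, the g-part
  integrates to 2 g(z) - g(0) by Cauchy's formula and the conjugate part to cnj (g 0); because g(0)
  is real, these values at 0 cancel.\<close>

lemma Herglotz_integral_cis:
  fixes g :: "complex \<Rightarrow> complex"
  assumes cont: "continuous_on (cball 0 1) g" and hol: "g holomorphic_on ball 0 1"
    and im: "Im (g 0) = 0" and z: "cmod z < 1"
  shows "((\<lambda>t. of_real (Re (g (cis t))) * ((cis t + z) / (cis t - z))) has_integral 2 * pi * g z) {0..2*pi}"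
proof -
  have nz: "cis t - z \<noteq> 0" for t using z by auto
  have nz': "1 - cnj z * w \<noteq> 0" if "cmod w \<le> 1" for w
  proof -
    have "cmod (cnj z * w) < 1"
      using z that by (simp add: norm_mult) (metis le_less_trans mult_left_le norm_ge_zero)
    then show ?thesis by auto
  qed
  have "((\<lambda>t. 2 * (g (cis t) * (cis t / (cis t - z))) - g (cis t)) has_integral
      2 * (2 * pi * g z) - 2 * pi * g 0) {0..2*pi}"
    by (intro has_integral_diff has_integral_mult_right Cauchy_integral_cis mean_value_cis assms)
  moreover have "((\<lambda>t. cnj (g (cis t) * ((1 + cnj z * cis t) / (1 - cnj z * cis t)))) has_integral
      cnj (2 * pi * (g 0 * ((1 + cnj z * 0) / (1 - cnj z * 0))))) {0..2*pi}"
  proof -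
    \<comment> \<open>On the circle the conjugate of the Herglotz kernel agrees with a function holomorphic in the disc.\<close>
    have "continuous_on (cball 0 1) (\<lambda>w. g w * ((1 + cnj z * w) / (1 - cnj z * w)))"
      using nz' by (intro continuous_intros cont) auto
    moreover have "(\<lambda>w. g w * ((1 + cnj z * w) / (1 - cnj z * w))) holomorphic_on ball 0 1"
      using nz' by (intro holomorphic_intros hol) auto
    ultimately have "((\<lambda>t. g (cis t) * ((1 + cnj z * cis t) / (1 - cnj z * cis t))) has_integral
        2 * pi * (g 0 * ((1 + cnj z * 0) / (1 - cnj z * 0)))) {0..2*pi}"
      by (rule mean_value_cis)
    then show ?thesis by (subst (asm) has_integral_cnj[symmetric]) (simp only: o_def)
  qed
  ultimately have "((\<lambda>t. (1 / 2) * ((2 * (g (cis t) * (cis t / (cis t - z))) - g (cis t)) +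
       cnj (g (cis t) * ((1 + cnj z * cis t) / (1 - cnj z * cis t))))) has_integral
      (1 / 2) * ((2 * (2 * pi * g z) - 2 * pi * g 0) + cnj (2 * pi * (g 0 * ((1 + cnj z * 0) / (1 - cnj z * 0))))))
       {0..2*pi}"
    by (intro has_integral_mult_right has_integral_add)
  moreover have "(1 / 2) * ((2 * (2 * pi * g z) - 2 * pi * g 0) + cnj (2 * pi * (g 0 * ((1 + cnj z * 0) / (1 - cnj z * 0)))))
      = 2 * pi * g z"
    using im by (simp add: complex_eq_iff)
  moreover have "(1 / 2) * ((2 * (g (cis t) * (cis t / (cis t - z))) - g (cis t)) +
       cnj (g (cis t) * ((1 + cnj z * cis t) / (1 - cnj z * cis t)))) =
      of_real (Re (g (cis t))) * ((cis t + z) / (cis t - z))" for t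
  proof -
    let ?K = "(cis t + z) / (cis t - z)"
    have "cnj ((1 + cnj z * cis t) / (1 - cnj z * cis t)) = (1 + z * cis (-t)) / (1 - z * cis (-t))"
      by (simp add: cis_cnj)
    also have "\<dots> = (cis t * (1 + z * cis (-t))) / (cis t * (1 - z * cis (-t)))"
      by (subst mult_divide_mult_cancel_left) auto
    also have "\<dots> = ?K"
      by (simp add: algebra_simps cis_mult)
    finally have 1: "cnj (g (cis t) * ((1 + cnj z * cis t) / (1 - cnj z * cis t))) = cnj (g (cis t)) * ?K"
      by (simp only: complex_cnj_mult)
    have "2 * (cis t / (cis t - z)) - 1 = ?K" using nz[of t] by (simp add: field_simps)
    then have 2: "2 * (g (cis t) * (cis t / (cis t - z))) - g (cis t) = g (cis t) * ?K"
      by (metis (no_types, opaque_lifting) mult.left_commute mult_1_right right_diff_distrib)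
    have "of_real (Re (g (cis t))) = (1 / 2) * (g (cis t) + cnj (g (cis t)))"
      by (simp add: complex_add_cnj)
    then have "of_real (Re (g (cis t))) * ?K = (1 / 2) * ((g (cis t) + cnj (g (cis t))) * ?K)"
      by (simp only: mult.assoc)
    then show ?thesis unfolding 1 2 by (simp only: distrib_right)
  qed
  ultimately show ?thesis by (simp only:)
qed

lemma norm_cis_diff_le: "cmod (cis a - cis b) \<le> \<bar>a - b\<bar>"
proof -
  have "cis a - cis b = cis b * (cis (a - b) - 1)" by (simp add: algebra_simps cis_mult)
  then have "cmod (cis a - cis b) = cmod (exp (\<i> * of_real (a - b)) - 1)"
    by (simp only: norm_mult norm_cis mult_1) (simp only: cis_conv_exp)
  also have "\<dots> = 2 * \<bar>sin ((a - b) / 2)\<bar>"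
    by (rule dist_exp_i_1)
  also have "\<dots> \<le> \<bar>a - b\<bar>"
    using abs_sin_x_le_abs_x[of "(a - b) / 2"] by simp
  finally show ?thesis .
qed

subsection \<open>The angular distribution of a circle\<close>

text \<open>Placed on the real line rather than on the circle, so that distribution functions and
  weak compactness can be used. It has total mass 1 for the maps below because the argument of
  \<open>h\<close> increases by 2 pi along a circle.\<close>

definition circle_distribution :: "(complex \<Rightarrow> complex) \<Rightarrow> real \<Rightarrow> real measure" where
  "circle_distribution q r =
     density lborel (\<lambda>t. ennreal (indicator {0..2*pi} t * (Re (q (of_real r * cis t)) / (2 * pi))))"

lemma norm_scaled_less_1:
  assumes "0 < r" "r < 1" "cmod w \<le> 1"
  shows "cmod (of_real r * w) < 1"
proof -
  have "r * cmod w \<le> r * 1" using assms by (intro mult_left_mono) auto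
  also have "\<dots> < 1" using assms by simp
  finally show ?thesis using assms by (simp add: norm_mult)
qed

lemma continuous_on_circle:
  assumes "g holomorphic_on ball 0 1" "0 < r" "r < 1"
  shows "continuous_on S (\<lambda>t. g (of_real r * cis t))"
  by (intro continuous_on_compose2[OF holomorphic_on_imp_continuous_on[OF assms(1)]] continuous_intros)
     (use norm_scaled_less_1 assms in auto)

lemma holomorphic_scaled:
  assumes "g holomorphic_on ball 0 1" "0 < r" "r < 1"
  shows "continuous_on (cball 0 1) (\<lambda>z. g (of_real r * z))" "(\<lambda>z. g (of_real r * z)) holomorphic_on ball 0 1"
proof -
  have sub: "(\<lambda>z. of_real r * z) ` cball 0 1 \<subseteq> ball (0::complex) 1"
    using norm_scaled_less_1[OF assms(2,3)] by auto
  show "continuous_on (cball 0 1) (\<lambda>z. g (of_real r * z))"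
    by (intro continuous_on_compose2[OF holomorphic_on_imp_continuous_on[OF assms(1)]] continuous_intros sub)
  have "(\<lambda>z. of_real r * z) ` ball 0 1 \<subseteq> ball (0::complex) 1" using sub by fastforce
  then show "(\<lambda>z. g (of_real r * z)) holomorphic_on ball 0 1"
    by (intro holomorphic_on_compose_gen[OF _ assms(1), unfolded o_def] holomorphic_intros)
qed

text \<open>\<open>f\<close> is the branch of log (h z / z) that vanishes at 0, and
  \<open>q_eq\<close> then says q = z h'/h. The locale covers the unknown Riemann map and the
  explicit maps alike, so that the two can be compared.\<close>

locale starlike_map =
  fixes q f h :: "complex \<Rightarrow> complex"
  assumes hol_q: "q holomorphic_on ball 0 1"
    and Re_q: "cmod z < 1 \<Longrightarrow> Re (q z) \<ge> 0"
    and hol_f: "f holomorphic_on ball 0 1"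
    and f_0: "f 0 = 0"
    and h_eq: "cmod z < 1 \<Longrightarrow> h z = z * exp (f z)"
    and q_eq: "cmod z < 1 \<Longrightarrow> q z = 1 + z * deriv f z"
begin

lemma q_0: "q 0 = 1"
  using q_eq[of 0] by simp

lemma hol_h: "h holomorphic_on ball 0 1"
proof -
  have "(\<lambda>z. z * exp (f z)) holomorphic_on ball 0 1" by (intro holomorphic_intros hol_f)
  then show ?thesis by (rule holomorphic_transform) (simp add: h_eq)
qed

text \<open>A continuous choice of the argument of \<^term>\<open>h (of_real r * cis t)\<close>.\<close>

definition angle :: "real \<Rightarrow> real \<Rightarrow> real" where
  "angle r t = t + Im (f (of_real r * cis t))"

text \<open>Along the circle f(r cis t) has t-derivative i z f'(z), whose imaginary part is Re (z
  f'(z)). This is the reason why the density Re q measures the increase of the argument of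
  \<open>h\<close>.\<close>

lemma has_real_derivative_angle:
  assumes r: "0 < r" "r < 1"
  shows "(angle r has_real_derivative Re (q (of_real r * cis t))) (at t)"
proof -
  let ?z = "of_real r * cis t"
  have z: "cmod ?z < 1" using norm_scaled_less_1[OF r, of "cis t"] by simp
  have "((\<lambda>z. exp (\<i> * z)) has_field_derivative \<i> * exp (\<i> * of_real t)) (at (of_real t))"
    by (auto intro!: derivative_eq_intros)
  from has_vector_derivative_real_field[OF this] have "(cis has_vector_derivative \<i> * cis t) (at t)"
    by (simp only: cis_conv_exp[abs_def])
  then have 1: "((\<lambda>t. of_real r * cis t) has_vector_derivative of_real r * (\<i> * cis t)) (at t)"
    by (rule has_vector_derivative_mult_right)
  have "(f has_field_derivative deriv f ?z) (at ?z)"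
    using hol_f z by (intro holomorphic_derivI[of f "ball 0 1"]) auto
  from field_vector_diff_chain_at[OF 1 this]
  have "((\<lambda>t. f (of_real r * cis t)) has_vector_derivative of_real r * (\<i> * cis t) * deriv f ?z) (at t)"
    by (simp add: o_def)
  then have "((\<lambda>t. Im (f (of_real r * cis t))) has_vector_derivative Im (of_real r * (\<i> * cis t) * deriv f ?z)) (at t)"
    by (rule bounded_linear.has_vector_derivative[OF bounded_linear_Im])
  then have "((\<lambda>t. Im (f (of_real r * cis t))) has_real_derivative Im (of_real r * (\<i> * cis t) * deriv f ?z)) (at t)"
    by (simp only: has_real_derivative_iff_has_vector_derivative)
  from DERIV_add[OF DERIV_ident this]
  have "(angle r has_real_derivative 1 + Im (of_real r * (\<i> * cis t) * deriv f ?z)) (at t)"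
    by (simp only: angle_def[abs_def])
  moreover have "1 + Im (of_real r * (\<i> * cis t) * deriv f ?z) = Re (q ?z)"
    unfolding q_eq[OF z] by (simp add: algebra_simps)
  ultimately show ?thesis by simp
qed

lemma angle_period: "angle r (2 * pi) = angle r 0 + 2 * pi"
proof -
  have "cis (2 * pi) = cis 0" by simp
  then show ?thesis unfolding angle_def by (simp del: cis_2pi)
qed

lemma sgn_h_angle:
  assumes r: "0 < r" "r < 1"
  shows "sgn (h (of_real r * cis t)) = cis (angle r t)"
proof -
  have "cmod (of_real r * cis t) < 1" using norm_scaled_less_1[OF r, of "cis t"] by simp
  then have "sgn (h (of_real r * cis t)) = sgn (of_real r * cis t) * cis (Im (f (of_real r * cis t)))"
    by (simp only: h_eq sgn_mult sgn_exp_complex)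
  moreover have "sgn (of_real r * cis t) = cis t"
    using r by (simp add: sgn_div_norm norm_mult scaleR_conv_of_real)
  ultimately show ?thesis by (simp add: angle_def cis_mult)
qed

lemma nn_integral_circle:
  assumes r: "0 < r" "r < 1" and x: "0 \<le> x"
  shows "(\<integral>\<^sup>+t. ennreal (Re (q (of_real r * cis t)) / (2 * pi)) * indicator {0..x} t \<partial>lborel)
    = ennreal ((angle r x - angle r 0) / (2 * pi))"
proof -
  have "(\<integral>\<^sup>+t. ennreal (Re (q (of_real r * cis t)) / (2 * pi)) * indicator {0..x} t \<partial>lborel) =
     ennreal (angle r x / (2 * pi) - angle r 0 / (2 * pi))"
  proof (rule nn_integral_FTC_Icc)
    show "(\<lambda>t. Re (q (of_real r * cis t)) / (2 * pi)) \<in> borel_measurable borel"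
      by (intro borel_measurable_continuous_onI continuous_on_divide continuous_on_Re
            continuous_on_circle[OF hol_q r] continuous_on_const) simp
    show "((\<lambda>t. angle r t / (2 * pi)) has_real_derivative Re (q (of_real r * cis t)) / (2 * pi)) (at t)" for t
      by (rule DERIV_cdivide[OF has_real_derivative_angle[OF r]])
    show "0 \<le> Re (q (of_real r * cis t)) / (2 * pi)" for t
      using Re_q[OF norm_scaled_less_1[OF r, of "cis t"]] by simp
  qed (use x in simp)
  then show ?thesis by (simp add: diff_divide_distrib)
qed

lemma measurable_density:
  assumes r: "0 < r" "r < 1"
  shows "(\<lambda>t. indicator {0..2*pi} t * (Re (q (of_real r * cis t)) / (2 * pi))) \<in> borel_measurable borel"
  by (intro borel_measurable_times borel_measurable_indicator borel_measurable_continuous_onI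
     continuous_on_divide continuous_on_Re continuous_on_circle[OF hol_q r] continuous_on_const) simp_all

text \<open>\<open>A\<close> is left arbitrary outside [0, 2 pi] so that one computation serves the
  whole line, half-lines, and a half-line with the point 0 added.\<close>

lemma emeasure_circle_distribution:
  assumes r: "0 < r" "r < 1" and A: "A \<in> sets borel" and eq: "A \<inter> {0..2*pi} = {0..x}" and x: "0 \<le> x"
  shows "emeasure (circle_distribution q r) A = ennreal ((angle r x - angle r 0) / (2 * pi))"
proof -
  have "emeasure (circle_distribution q r) A = (\<integral>\<^sup>+t. ennreal (Re (q (of_real r * cis t)) / (2 * pi)) * indicator {0..x} t \<partial>lborel)"
    unfolding circle_distribution_def
  proof (subst emeasure_density)
    show "(\<lambda>t. ennreal (indicator {0..2*pi} t * (Re (q (of_real r * cis t)) / (2 * pi)))) \<in> borel_measurable lborel"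
      using measurable_density[OF r] by measurable
    show "(\<integral>\<^sup>+t. ennreal (indicator {0..2*pi} t * (Re (q (of_real r * cis t)) / (2 * pi))) * indicator A t \<partial>lborel) =
      (\<integral>\<^sup>+t. ennreal (Re (q (of_real r * cis t)) / (2 * pi)) * indicator {0..x} t \<partial>lborel)"
      unfolding eq[symmetric] by (intro nn_integral_cong) (auto simp: indicator_def)
  qed (use A in simp)
  then show ?thesis using nn_integral_circle[OF r x] by simp
qed

lemma real_distribution_circle:
  assumes r: "0 < r" "r < 1"
  shows "real_distribution (circle_distribution q r)"
proof -
  have "emeasure (circle_distribution q r) UNIV = 1"
    using emeasure_circle_distribution[OF r, of UNIV "2 * pi"] by (simp add: angle_period)
  then show ?thesis
    by (auto simp: real_distribution_def real_distribution_axioms_def circle_distribution_def intro!: prob_spaceI)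
qed

lemma cdf_circle:
  assumes r: "0 < r" "r < 1"
  shows "0 \<le> x \<Longrightarrow> x \<le> 2 * pi \<Longrightarrow> cdf (circle_distribution q r) x = (angle r x - angle r 0) / (2 * pi)"
    and "x < 0 \<Longrightarrow> cdf (circle_distribution q r) x = 0"
    and "x \<ge> 2 * pi \<Longrightarrow> cdf (circle_distribution q r) x = 1"
proof -
  interpret real_distribution "circle_distribution q r" by (rule real_distribution_circle[OF r])
  have inc: "angle r 0 \<le> angle r x" if "0 \<le> x"
    by (rule DERIV_nonneg_imp_nondecreasing[OF that])
       (use has_real_derivative_angle[OF r] Re_q[OF norm_scaled_less_1[OF r]] in \<open>auto intro!: exI\<close>)
  show "cdf (circle_distribution q r) x = (angle r x - angle r 0) / (2 * pi)" if "0 \<le> x" "x \<le> 2 * pi"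
    using emeasure_circle_distribution[OF r, of "{..x}" x] that inc
    by (auto simp: cdf_def measure_def)
  show "cdf (circle_distribution q r) x = 1" if "x \<ge> 2 * pi"
  proof -
    have "{..x} \<inter> {0..2*pi} = {0..2*pi}" using that by auto
    then show ?thesis
      using emeasure_circle_distribution[OF r, of "{..x}" "2 * pi"] by (simp add: cdf_def measure_def angle_period)
  qed
  show "cdf (circle_distribution q r) x = 0" if "x < 0"
  proof -
    \<comment> \<open>Adding the point 0 turns the trace on [0, 2 pi] into the degenerate interval
      [0, 0], which has mass zero.\<close>
    have "emeasure (circle_distribution q r) {..x} \<le> emeasure (circle_distribution q r) ({..x} \<union> {0})"
      by (intro emeasure_mono) (auto simp: circle_distribution_def)
    also have "\<dots> = 0"
      using emeasure_circle_distribution[OF r, of "{..x} \<union> {0}" 0] that by auto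
    finally show ?thesis by (simp add: cdf_def measure_def)
  qed
qed

lemma integral_circle_kernel:
  assumes r: "0 < r" "r < 1" and z: "cmod z < 1"
  shows "(\<integral>t. (cis t + z) / (cis t - z) \<partial>circle_distribution q r) = q (of_real r * z)"
proof -
  have nz: "cis t - z \<noteq> 0" for t using z by auto
  let ?g = "\<lambda>t. of_real (Re (q (of_real r * cis t))) * ((cis t + z) / (cis t - z))"
  have contK: "continuous_on S (\<lambda>t. (cis t + z) / (cis t - z))" for S
    using nz by (intro continuous_intros) auto
  have cont: "continuous_on S ?g" for S
    by (intro continuous_on_mult continuous_on_of_real continuous_on_Re continuous_on_circle[OF hol_q r] contK)
  have "(\<integral>t. (cis t + z) / (cis t - z) \<partial>circle_distribution q r) =
      (\<integral>t. (indicator {0..2*pi} t * (Re (q (of_real r * cis t)) / (2 * pi))) *\<^sub>R ((cis t + z) / (cis t - z)) \<partial>lborel)"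
    unfolding circle_distribution_def
  proof (rule integral_density)
    show "AE t in lborel. 0 \<le> indicator {0..2*pi} t * (Re (q (of_real r * cis t)) / (2 * pi))"
      using Re_q[OF norm_scaled_less_1[OF r]] by (intro AE_I2) (auto simp: indicator_def)
  qed (use measurable_density[OF r] contK in \<open>auto intro: borel_measurable_continuous_onI\<close>)
  also have "\<dots> = (\<integral>t. of_real (1 / (2 * pi)) * (indicator {0..2*pi} t *\<^sub>R ?g t) \<partial>lborel)"
    by (intro Bochner_Integration.integral_cong) (auto simp: scaleR_conv_of_real indicator_def)
  also have "\<dots> = of_real (1 / (2 * pi)) * (LINT t:{0..2*pi}|lborel. ?g t)"
    unfolding set_lebesgue_integral_def by (rule integral_mult_right_zero)
  also have "(LINT t:{0..2*pi}|lborel. ?g t) = integral {0..2*pi} ?g"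
    by (intro set_borel_integral_eq_integral borel_integrable_atLeastAtMost' cont)
  also have "\<dots> = 2 * pi * q (of_real r * z)"
    using Herglotz_integral_cis[OF holomorphic_scaled[OF hol_q r] _ z] by (simp add: q_0 integral_unique)
  finally show ?thesis by simp
qed

end

section \<open>Escape to infinity and discreteness of the limiting measure\<close>

lemma compact_subset_smaller_ball:
  fixes K :: "complex set"
  assumes "compact K" "K \<subseteq> ball 0 1"
  obtains \<rho> where "\<rho> < 1" "K \<subseteq> ball 0 \<rho>"
proof (cases "K = {}")
  case True
  then show ?thesis using that[of 0] by simp
next
  case False
  from continuous_attains_sup[OF assms(1) False, of norm] obtain k
    where k: "k \<in> K" "\<And>z. z \<in> K \<Longrightarrow> cmod z \<le> cmod k"
    by (auto intro: continuous_intros)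
  from k(1) assms(2) have "cmod k < 1" by auto
  then obtain \<rho> where "cmod k < \<rho>" "\<rho> < 1" using dense by blast
  with k(2) show ?thesis by (intro that[of \<rho>]) force+
qed

context starlike_map
begin

text \<open>An arc of directions avoiding the slits cannot absorb a whole arc of the circle in the limit:
  there \<^term>\<open>h\<close> would tend to infinity uniformly, while the mean of \<open>log |h(z) / z|\<close> over circles is zero.\<close>

lemma no_escape:
  assumes inj: "inj_on h (ball 0 1)"
    and full: "\<And>w. sgn w \<in> K \<Longrightarrow> w \<in> h ` ball 0 1"
    and K: "compact K" "K \<subseteq> sphere 0 1"
    and x: "0 \<le> x1" "x1 < x2" "x2 \<le> 2 * pi"
    and R: "\<And>n. 0 < R n" "\<And>n. R n < 1" "R \<longlonglongrightarrow> (1::real)"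
    and ev: "eventually (\<lambda>n. \<forall>t\<in>{x1..x2}. sgn (h (of_real (R n) * cis t)) \<in> K) sequentially"
  shows False
proof -
  have h0: "h 0 = 0" using h_eq[of 0] by simp
  \<comment> \<open>A lower bound for |h| near the circle controls log |h| off the arc; it exists
    because \<open>h\<close> is open and injective. With c \<le> 1 the number \<open>ln c\<close> is
    nonpositive and may also be added on the arc.\<close>
  obtain c where c: "0 < c" "c \<le> 1" "\<And>z. 1 / 2 \<le> cmod z \<Longrightarrow> cmod z < 1 \<Longrightarrow> c \<le> cmod (h z)"
  proof -
    have sub: "ball 0 (1 / 2) \<subseteq> ball (0::complex) 1" by auto
    have "open (h ` ball 0 (1 / 2))"
      by (intro open_mapping_thm3 holomorphic_on_subset[OF hol_h sub] inj_on_subset[OF inj sub]) simp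
    moreover have "0 \<in> h ` ball 0 (1 / 2)" using h0 by force
    ultimately obtain c where c: "c > 0" "ball 0 c \<subseteq> h ` ball 0 (1 / 2)"
      by (meson open_contains_ball)
    have "min c 1 \<le> cmod (h z)" if "1 / 2 \<le> cmod z" "cmod z < 1" for z
    proof (rule ccontr)
      assume "\<not> ?thesis"
      then have "h z \<in> h ` ball 0 (1 / 2)" using c(2) by (auto simp: subset_iff)
      then obtain y where y: "y \<in> ball 0 (1 / 2)" "h z = h y" by auto
      have "z = y" by (rule inj_onD[OF inj y(2)]) (use y(1) that in simp_all)
      with y(1) that show False by simp
    qed
    with c(1) show ?thesis by (intro that[of "min c 1"]) auto
  qed
  \<comment> \<open>The size of |h| that is fatal on [x1, x2]: it makes 2 pi ln c + (x2 - x1) ln M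
    equal to 1, whereas the integral of \<open>Re f\<close> over the circle is 0.\<close>
  define M where "M = exp ((1 - 2 * pi * ln c) / (x2 - x1))"
  have lnc: "ln c \<le> 0" using c by simp
  have M: "ln M \<ge> 0" "M > 0" "ln M * (x2 - x1) = 1 - 2 * pi * ln c"
  proof -
    have "2 * pi * ln c \<le> 0" using lnc by (intro mult_nonneg_nonpos) auto
    then show "ln M \<ge> 0" using x by (simp add: M_def)
    show "ln M * (x2 - x1) = 1 - 2 * pi * ln c" using x by (simp add: M_def)
  qed (simp add: M_def)
  \<comment> \<open>The part of the cone over \<open>K\<close> of modulus at most \<open>M\<close>.
    It is compact in the image, so its preimage lies in a disc of radius \<rho> < 1; beyond that
    radius, a direction in \<open>K\<close> forces |h| \<ge> M.\<close>
  define Q where "Q = (\<lambda>(\<rho>, u). complex_of_real \<rho> * u) ` ({0..M} \<times> K)"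
  have "compact Q"
    unfolding Q_def case_prod_beta
    by (intro compact_continuous_image compact_Times K compact_Icc continuous_intros)
  have Qsub: "Q \<subseteq> h ` ball 0 1"
  proof
    fix w assume "w \<in> Q"
    then obtain \<rho> u where w: "w = of_real \<rho> * u" "0 \<le> \<rho>" "u \<in> K" by (auto simp: Q_def)
    show "w \<in> h ` ball 0 1"
    proof (cases "\<rho> = 0")
      case True
      then have "w = h 0" using w h0 by simp
      then show ?thesis by (intro image_eqI[of _ _ 0]) auto
    next
      case False
      have "cmod u = 1" using w(3) K(2) by auto
      then have "sgn w = u" using w False by (simp add: sgn_div_norm norm_mult scaleR_conv_of_real)
      then show ?thesis using w full by simp
    qed
  qed
  obtain g where g: "g holomorphic_on h ` ball 0 1" "\<And>z. z \<in> ball 0 1 \<Longrightarrow> g (h z) = z"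
    using holomorphic_has_inverse[OF hol_h open_ball inj] by metis
  have "compact (g ` Q)"
    using \<open>compact Q\<close> Qsub g(1) by (intro compact_continuous_image)
      (auto intro: continuous_on_subset holomorphic_on_imp_continuous_on)
  moreover have "g ` Q \<subseteq> ball 0 1" using Qsub g(2) by force
  ultimately obtain \<rho> where \<rho>: "\<rho> < 1" "g ` Q \<subseteq> ball 0 \<rho>"
    by (rule compact_subset_smaller_ball)
  have "eventually (\<lambda>n. R n > max \<rho> (1 / 2)) sequentially"
    using R(3) \<rho>(1) by (intro order_tendstoD) auto
  with ev have "eventually (\<lambda>n. R n > max \<rho> (1 / 2) \<and> (\<forall>t\<in>{x1..x2}. sgn (h (of_real (R n) * cis t)) \<in> K)) sequentially"
    by eventually_elim auto
  then obtain n where n: "R n > \<rho>" "R n > 1 / 2" "\<And>t. t \<in> {x1..x2} \<Longrightarrow> sgn (h (of_real (R n) * cis t)) \<in> K"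
    by (auto simp: eventually_sequentially)
  define r where "r = R n"
  have r: "0 < r" "r < 1" using R by (auto simp: r_def)
  have z: "cmod (of_real r * cis t) < 1" "cmod (of_real r * cis t) = r" for t
    using r by (auto simp: norm_mult)
  have f_ln: "Re (f (of_real r * cis t)) \<ge> ln m"
    if m: "m > 0" "m \<le> cmod (h (of_real r * cis t))" for m t
  proof -
    have "cmod (h (of_real r * cis t)) = r * exp (Re (f (of_real r * cis t)))"
      using z[of t] by (simp add: h_eq norm_mult)
    also have "\<dots> \<le> 1 * exp (Re (f (of_real r * cis t)))"
      using r by (intro mult_right_mono) auto
    finally have "m \<le> exp (Re (f (of_real r * cis t)))" using m by simp
    then show ?thesis using m(1) by (metis ln_exp ln_le_cancel_iff exp_gt_zero)
  qed
  have big: "M \<le> cmod (h (of_real r * cis t))" if t: "t \<in> {x1..x2}" for t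
  proof (rule ccontr)
    let ?w = "h (of_real r * cis t)"
    assume "\<not> ?thesis"
    then have "cmod ?w \<in> {0..M}" by simp
    moreover have "sgn ?w \<in> K" using n(3)[OF t] by (simp add: r_def)
    moreover have "?w = of_real (cmod ?w) * sgn ?w"
      by (cases "?w = 0") (simp_all add: sgn_div_norm scaleR_conv_of_real)
    ultimately have "?w \<in> Q" unfolding Q_def by (metis (mono_tags, lifting) SigmaI case_prod_conv image_eqI)
    then have "g ?w \<in> ball 0 \<rho>" using \<rho> by auto
    moreover have "g ?w = of_real r * cis t" using z[of t] by (intro g(2)) auto
    ultimately show False using z[of t] n(1) by (simp add: r_def)
  qed
  have "((\<lambda>t. f (of_real r * cis t)) has_integral 2 * pi * f (of_real r * 0)) {0..2*pi}"
    using mean_value_cis[OF holomorphic_scaled[OF hol_f r]] by simp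
  from has_integral_linear[OF this bounded_linear_Re]
  have I1: "((\<lambda>t. Re (f (of_real r * cis t))) has_integral 0) {0..2*pi}"
    by (simp add: o_def f_0)
  have I2: "((\<lambda>t. ln c + (if t \<in> {x1..x2} then ln M else 0)) has_integral (ln c * (2 * pi) + ln M * (x2 - x1))) {0..2*pi}"
  proof (rule has_integral_add)
    show "((\<lambda>t. ln c) has_integral ln c * (2 * pi)) {0..2*pi}"
      using has_integral_const_real[of "ln c" 0 "2 * pi"] by (simp add: mult.commute)
    have "((\<lambda>t. ln M) has_integral ln M * (x2 - x1)) {x1..x2}"
      using has_integral_const_real[of "ln M" x1 x2] x by (simp add: mult.commute)
    then show "((\<lambda>t. if t \<in> {x1..x2} then ln M else 0) has_integral ln M * (x2 - x1)) {0..2*pi}"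
      by (subst has_integral_restrict) (use x in auto)
  qed
  have I3: "ln c + (if t \<in> {x1..x2} then ln M else 0) \<le> Re (f (of_real r * cis t))" if "t \<in> {0..2*pi}" for t
  proof (cases "t \<in> {x1..x2}")
    case True
    then show ?thesis using f_ln[OF M(2) big[OF True]] lnc by simp
  next
    case False
    have "c \<le> cmod (h (of_real r * cis t))" using z[of t] n(2) by (intro c(3)) (auto simp: r_def)
    from f_ln[OF c(1) this] show ?thesis by (simp only: False if_False add_0_right)
  qed
  have "ln c * (2 * pi) + ln M * (x2 - x1) \<le> 0"
    by (rule has_integral_le[OF I2 I1 I3])
  then show False using M(3) by simp
qed

theorem discrete_representation:
  assumes inj: "inj_on h (ball 0 1)"
    and D: "finite D" "\<And>w. sgn w \<notin> D \<Longrightarrow> w \<in> h ` ball 0 1"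
  obtains C :: "real set" and m where "finite C" "\<And>c. m c \<ge> 0"
    "\<And>z. cmod z < 1 \<Longrightarrow> q z = (\<Sum>c\<in>C. of_real (m c) * ((cis c + z) / (cis c - z)))"
proof -
  define r0 where "r0 n = 1 - 1 / (real n + 2)" for n
  have r0: "0 < r0 n" "r0 n < 1" for n by (auto simp: r0_def field_simps)
  have "r0 \<longlonglongrightarrow> 1 - 0"
    unfolding r0_def by real_asymp
  then have r0_lim: "r0 \<longlonglongrightarrow> 1" by simp
  have "compact (sphere 0 1 :: complex set)" by simp
  \<comment> \<open>The distributions forget the direction of \<open>h\<close> at t = 0. These
    starting directions are made to converge first, and the weak limit is taken along a further
    subsequence.\<close>
  then obtain e s1 where e: "e \<in> sphere 0 1" "strict_mono (s1 :: nat \<Rightarrow> nat)"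
      and e_lim: "((\<lambda>n. cis (angle (r0 n) 0)) \<circ> s1) \<longlonglongrightarrow> e"
    unfolding compact_def by (metis (no_types, lifting) mem_sphere_0 norm_cis)
  define \<mu> where "\<mu> n = circle_distribution q (r0 n)" for n
  have "tight \<mu>"
    unfolding tight_def
  proof (intro conjI allI impI)
    show "real_distribution (\<mu> n)" for n unfolding \<mu>_def by (rule real_distribution_circle[OF r0])
    fix \<epsilon> :: real assume "\<epsilon> > 0"
    \<comment> \<open>All these measures live on [0, 2 pi], which (-1, 7] contains because 2 pi
      \<le> 7.\<close>
    have "measure (\<mu> n) {-1<..7} > 1 - \<epsilon>" for n
    proof -
      interpret real_distribution "\<mu> n" unfolding \<mu>_def by (rule real_distribution_circle[OF r0])
      have "2 * pi \<le> 7" using pi_approx by simp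
      then show ?thesis
        using cdf_diff_eq[of "-1" 7] cdf_circle(2,3)[OF r0, of _ n] \<open>\<epsilon> > 0\<close> by (simp add: \<mu>_def)
    qed
    then show "\<exists>a b. a < b \<and> (\<forall>n. 1 - \<epsilon> < measure (\<mu> n) {a<..b})"
      by (intro exI[of _ "-1"] exI[of _ 7]) simp
  qed
  from tight_imp_convergent_subsubsequence[OF this e(2)] obtain s2 M
    where s2: "strict_mono (s2 :: nat \<Rightarrow> nat)" and M: "real_distribution M" and wc: "weak_conv_m (\<mu> \<circ> s1 \<circ> s2) M"
    by blast
  interpret M: real_distribution M by fact
  define R where "R n = r0 (s1 (s2 n))" for n
  have R: "0 < R n" "R n < 1" for n using r0 by (auto simp: R_def)
  have R_lim: "R \<longlonglongrightarrow> 1"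
    using LIMSEQ_subseq_LIMSEQ[OF LIMSEQ_subseq_LIMSEQ[OF r0_lim e(2)] s2] by (simp add: R_def[abs_def] o_def)
  have eR: "(\<lambda>n. cis (angle (R n) 0)) \<longlonglongrightarrow> e"
    using LIMSEQ_subseq_LIMSEQ[OF e_lim s2] by (simp add: R_def[abs_def] o_def)
  define c where "c n = cdf (circle_distribution q (R n))" for n
  define F where "F = cdf M"
  have conv: "(\<lambda>n. c n x) \<longlonglongrightarrow> F x" if "isCont F x" for x
    using wc that by (simp add: weak_conv_m_def weak_conv_def c_def F_def \<mu>_def R_def o_def)
  have c_mono: "c n x \<le> c n y" if "x \<le> y" for n x y
  proof -
    interpret real_distribution "circle_distribution q (R n)" by (rule real_distribution_circle[OF R])
    show ?thesis using cdf_nondecreasing[OF that] by (simp add: c_def)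
  qed
  have F_mono: "F x \<le> F y" if "x \<le> y" for x y
    using M.cdf_nondecreasing[OF that] by (simp add: F_def)
  have dense: "\<exists>y. a < y \<and> y < b \<and> isCont F y \<and> y \<noteq> 0 \<and> y \<noteq> 2 * pi" if "a < b" for a b
  proof -
    have "countable ({x. \<not> isCont F x} \<union> {0, 2 * pi})"
      using mono_ctble_discont[of F] F_mono by (auto simp: mono_def)
    then have "\<exists>y\<in>{a<..<b}. y \<notin> {x. \<not> isCont F x} \<union> {0, 2 * pi}"
      using that by (intro open_minus_countable) auto
    then show ?thesis by auto
  qed
  \<comment> \<open>The argument of the product is the limiting argument at t = x. If this direction
    were not in \<open>D\<close>, then on an interval around x and for all late radii the direction
    of \<open>h\<close> would stay in a compact set avoiding \<open>D\<close>, which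
    \<open>no_escape\<close> forbids.\<close>
  have dir: "e * cis (2 * pi * F x) \<in> D" if x: "isCont F x" "0 < x" "x < 2 * pi" for x
  proof (rule ccontr)
    let ?w = "e * cis (2 * pi * F x)"
    assume "?w \<notin> D"
    moreover have "open (- D)" using D(1) by (intro open_Compl finite_imp_closed)
    ultimately obtain \<delta> where \<delta>: "\<delta> > 0" "cball ?w \<delta> \<subseteq> - D"
      by (meson ComplI open_contains_cball)
    define K where "K = cball ?w \<delta> \<inter> sphere 0 1"
    \<comment> \<open>The error budget for directions: \<epsilon> for the starting direction and 2
      pi times 2 \<epsilon> for the distribution function, adding up to \<delta>.\<close>
    define \<epsilon> where "\<epsilon> = \<delta> / (1 + 4 * pi)"
    have \<epsilon>: "\<epsilon> > 0" "\<epsilon> + 2 * pi * (2 * \<epsilon>) = \<delta>"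
    proof -
      have p: "1 + 4 * pi > 0" using pi_gt_zero by (intro add_pos_pos) auto
      then show "\<epsilon> > 0" using \<delta>(1) by (simp add: \<epsilon>_def)
      have "\<epsilon> + 2 * pi * (2 * \<epsilon>) = \<epsilon> * (1 + 4 * pi)" by (simp add: algebra_simps)
      then show "\<epsilon> + 2 * pi * (2 * \<epsilon>) = \<delta>" using p by (simp add: \<epsilon>_def)
    qed
    obtain d where d: "d > 0" "\<And>y. \<bar>y - x\<bar> < d \<Longrightarrow> \<bar>F y - F x\<bar> < \<epsilon>"
      using x(1) \<epsilon>(1) unfolding continuous_at_eps_delta by (auto simp: dist_real_def)
    obtain x1 where x1: "max 0 (x - d) < x1" "x1 < x" "isCont F x1"
      using dense[of "max 0 (x - d)" x] d(1) x by auto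
    obtain x2 where x2: "x < x2" "x2 < min (2 * pi) (x + d)" "isCont F x2"
      using dense[of x "min (2 * pi) (x + d)"] d(1) x by auto
    have F12: "\<bar>F x1 - F x\<bar> < \<epsilon>" "\<bar>F x2 - F x\<bar> < \<epsilon>" using x1 x2 by (auto intro!: d(2))
    have ev: "eventually (\<lambda>n. \<bar>c n x1 - F x1\<bar> < \<epsilon>) sequentially" "eventually (\<lambda>n. \<bar>c n x2 - F x2\<bar> < \<epsilon>) sequentially"
      "eventually (\<lambda>n. dist (cis (angle (R n) 0)) e < \<epsilon>) sequentially"
      using tendstoD[OF conv[OF x1(3)] \<epsilon>(1)] tendstoD[OF conv[OF x2(3)] \<epsilon>(1)] tendstoD[OF eR \<epsilon>(1)]
      by (simp_all add: dist_real_def)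
    have "eventually (\<lambda>n. \<forall>t\<in>{x1..x2}. sgn (h (of_real (R n) * cis t)) \<in> K) sequentially"
      using ev
    proof eventually_elim
      case (elim n)
      show ?case
      proof
        fix t assume t: "t \<in> {x1..x2}"
        \<comment> \<open>Monotonicity in t turns convergence at the two endpoints x1 and x2 into a
          bound on the whole interval.\<close>
        have "c n t - F x < 2 * \<epsilon>" "F x - c n t < 2 * \<epsilon>"
          using c_mono[of x1 t n] c_mono[of t x2 n] t elim F12 by auto
        then have ct: "\<bar>c n t - F x\<bar> \<le> 2 * \<epsilon>" by simp
        have "c n t = (angle (R n) t - angle (R n) 0) / (2 * pi)"
          unfolding c_def using t x1 x2 by (intro cdf_circle[OF R]) auto
        then have "angle (R n) t = angle (R n) 0 + 2 * pi * c n t" by (simp add: field_simps)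
        then have sg: "sgn (h (of_real (R n) * cis t)) = cis (angle (R n) 0) * cis (2 * pi * c n t)"
          using sgn_h_angle[OF R] by (simp add: cis_mult)
        let ?a = "cis (angle (R n) 0)" and ?u = "cis (2 * pi * c n t)" and ?v = "cis (2 * pi * F x)"
        have "?a * ?u - e * ?v = (?a - e) * ?u + e * (?u - ?v)" by (simp add: algebra_simps)
        then have "cmod (?a * ?u - e * ?v) \<le> cmod (?a - e) + cmod (?u - ?v)"
          using norm_triangle_ineq[of "(?a - e) * ?u" "e * (?u - ?v)"] e(1) by (simp add: norm_mult)
        also have "\<dots> \<le> \<epsilon> + 2 * pi * (2 * \<epsilon>)"
        proof (rule add_mono)
          show "cmod (?a - e) \<le> \<epsilon>" using elim(3) by (simp add: dist_norm)
          have "cmod (?u - ?v) \<le> \<bar>2 * pi * c n t - 2 * pi * F x\<bar>" by (rule norm_cis_diff_le)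
          also have "\<dots> = 2 * pi * \<bar>c n t - F x\<bar>" by (simp add: abs_mult flip: right_diff_distrib)
          also have "\<dots> \<le> 2 * pi * (2 * \<epsilon>)" using ct by (intro mult_left_mono) auto
          finally show "cmod (?u - ?v) \<le> 2 * pi * (2 * \<epsilon>)" .
        qed
        finally have "?a * ?u \<in> cball ?w \<delta>" using \<epsilon>(2) by (simp add: dist_norm norm_minus_commute)
        moreover have "?a * ?u \<in> sphere 0 1" by (simp add: norm_mult)
        ultimately show "sgn (h (of_real (R n) * cis t)) \<in> K" by (simp only: sg K_def Int_iff)
      qed
    qed
    then show False
    proof (rule no_escape[OF inj, rotated -1])
      show "w \<in> h ` ball 0 1" if "sgn w \<in> K" for w using that \<delta>(2) by (intro D(2)) (auto simp: K_def)
      show "compact K" "K \<subseteq> sphere 0 1" unfolding K_def by (auto intro: compact_Int)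
      show "0 \<le> x1" "x1 < x2" "x2 \<le> 2 * pi" using x1 x2 by auto
    qed (use R R_lim in auto)
  qed
  \<comment> \<open>On [0, 1) the map y -> cis (2 pi y) is injective, so \<open>D\<close> leaves
    finitely many values there. The value 1 is added for the closed end of the period, and 0 and 1
    are also the values of \<open>F\<close> outside [0, 2 pi].\<close>
  define V where "V = {y \<in> {0..<1}. e * cis (2 * pi * y) \<in> D} \<union> {0, 1}"
  have "finite V"
  proof -
    have "finite {y \<in> {0..<1}. e * cis (2 * pi * y) \<in> D}"
    proof (rule finite_imageD)
      show "finite ((\<lambda>y. e * cis (2 * pi * y)) ` {y \<in> {0..<1}. e * cis (2 * pi * y) \<in> D})"
        by (rule finite_subset[OF _ D(1)]) auto
      show "inj_on (\<lambda>y. e * cis (2 * pi * y)) {y \<in> {0..<1}. e * cis (2 * pi * y) \<in> D}"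
      proof (rule inj_onI)
        fix y y' assume *: "y \<in> {y \<in> {0..<1}. e * cis (2 * pi * y) \<in> D}" "y' \<in> {y \<in> {0..<1}. e * cis (2 * pi * y) \<in> D}"
          "e * cis (2 * pi * y) = e * cis (2 * pi * y')"
        then have "cis (2 * pi * y) = cis (2 * pi * y')" using e(1) by auto
        then have "Arg2pi (exp (\<i> * of_real (2 * pi * y))) = Arg2pi (exp (\<i> * of_real (2 * pi * y')))"
          by (simp only: cis_conv_exp)
        then show "y = y'" using * by (subst (asm) (1 2) Arg2pi_exp) auto
      qed
    qed
    then show ?thesis by (simp add: V_def)
  qed
  have FV': "F x \<in> V" if x: "isCont F x" "x \<noteq> 0" "x \<noteq> 2 * pi" for x
  proof -
    consider "x < 0" | "0 < x" "x < 2 * pi" | "x > 2 * pi" using x by linarith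
    then show ?thesis
    proof cases
      case 1
      then have "(\<lambda>n. 0) \<longlonglongrightarrow> F x" using conv[OF x(1)] cdf_circle(2)[OF R] by (simp add: c_def)
      then have "F x = 0" using LIMSEQ_unique tendsto_const by blast
      then show ?thesis by (simp add: V_def)
    next
      case 2
      have "0 \<le> F x" "F x \<le> 1" using M.cdf_nonneg M.cdf_bounded_prob by (auto simp: F_def)
      then show ?thesis using dir[OF x(1) 2] by (cases "F x = 1") (auto simp: V_def)
    next
      case 3
      then have "(\<lambda>n. 1) \<longlonglongrightarrow> F x" using conv[OF x(1)] cdf_circle(3)[OF R] by (simp add: c_def)
      then have "F x = 1" using LIMSEQ_unique tendsto_const by blast
      then show ?thesis by (simp add: V_def)
    qed
  qed
  \<comment> \<open>Discontinuities and the endpoints 0 and 2 pi are approached from the right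
    through good points; right continuity and the closedness of the finite set \<open>V\<close>
    carry the property over.\<close>
  have FV: "F x \<in> V" for x
  proof (rule ccontr)
    assume "F x \<notin> V"
    have "(F \<longlongrightarrow> F x) (at_right x)"
      using M.cdf_is_right_cont[of x] by (simp add: continuous_within F_def)
    moreover have "open (- V)" using \<open>finite V\<close> by (intro open_Compl finite_imp_closed)
    ultimately have "eventually (\<lambda>y. F y \<in> - V) (at_right x)"
      using \<open>F x \<notin> V\<close> by (auto simp: tendsto_def)
    then obtain b where b: "b > x" "\<And>y. x < y \<Longrightarrow> y < b \<Longrightarrow> F y \<in> - V"
      unfolding eventually_at_right_field by blast
    from dense[OF b(1)] obtain y where "x < y" "y < b" "isCont F y" "y \<noteq> 0" "y \<noteq> 2 * pi" by blast
    with b(2)[of y] FV'[of y] show False by auto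
  qed
  obtain C where C: "finite C" "AE x in M. x \<in> C"
    using M.AE_finite_support[OF \<open>finite V\<close>] FV by (auto simp: F_def)
  have "q z = (\<Sum>c\<in>C. of_real (measure M {c}) * ((cis c + z) / (cis c - z)))" if z: "cmod z < 1" for z
  proof -
    let ?K = "\<lambda>t. (cis t + z) / (cis t - z)"
    have nz: "cis t - z \<noteq> 0" for t using z by auto
    have contK: "continuous_on UNIV ?K" using nz by (intro continuous_intros) auto
    have bd: "cmod (?K t) \<le> 2 / (1 - cmod z)" for t
    proof -
      have "cmod (cis t + z) \<le> 2" using norm_triangle_ineq[of "cis t" z] z by simp
      moreover have "1 - cmod z \<le> cmod (cis t - z)" using norm_triangle_ineq2[of "cis t" z] by simp
      ultimately show ?thesis using z unfolding norm_divide by (intro frac_le) auto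
    qed
    \<comment> \<open>For fixed z the kernel is a bounded continuous test function of t, so weak
      convergence passes the Herglotz formula on circles to the limit.\<close>
    have "(\<lambda>n. \<integral>t. ?K t \<partial>(\<mu> \<circ> s1 \<circ> s2) n) \<longlonglongrightarrow> (\<integral>t. ?K t \<partial>M)"
    proof (rule weak_conv_imp_integral_bdd_continuous_conv[OF _ M wc])
      show "real_distribution ((\<mu> \<circ> s1 \<circ> s2) n)" for n
        by (simp add: \<mu>_def real_distribution_circle[OF r0])
      show "isCont ?K x" for x using contK by (simp add: continuous_on_eq_continuous_at)
    qed (rule bd)
    moreover have "(\<integral>t. ?K t \<partial>(\<mu> \<circ> s1 \<circ> s2) n) = q (of_real (R n) * z)" for n
      using integral_circle_kernel[OF R z, of n] by (simp add: \<mu>_def R_def)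
    ultimately have "(\<lambda>n. q (of_real (R n) * z)) \<longlonglongrightarrow> (\<integral>t. ?K t \<partial>M)" by simp
    moreover have "(\<lambda>n. q (of_real (R n) * z)) \<longlonglongrightarrow> q (of_real 1 * z)"
    proof (rule continuous_on_tendsto_compose[OF holomorphic_on_imp_continuous_on[OF hol_q]])
      show "(\<lambda>n. of_real (R n) * z) \<longlonglongrightarrow> of_real 1 * z" by (intro tendsto_intros R_lim)
      show "eventually (\<lambda>n. of_real (R n) * z \<in> ball 0 1) sequentially"
        using norm_scaled_less_1[OF R, of z] z by auto
    qed (use z in simp)
    ultimately have "q z = (\<integral>t. ?K t \<partial>M)" using LIMSEQ_unique by fastforce
    also have "\<dots> = (\<Sum>c\<in>C. of_real (measure M {c}) * ?K c)"
      by (intro M.integral_finite_support C borel_measurable_continuous_onI contK)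
    finally show ?thesis .
  qed
  then show ?thesis by (intro that[of C "\<lambda>c. measure M {c}"] C) auto
qed

text \<open>Distinct real atoms, such as 0 and 2 pi, may give the same point of the circle, and some
  may have mass zero. Null atoms are dropped and the others grouped by their image under
  \<open>cis\<close>; the total weight is 1 because \<open>q 0 = 1\<close>.\<close>

lemma slit_map_representation:
  assumes inj: "inj_on h (ball 0 1)"
    and D: "finite D" "\<And>w. sgn w \<notin> D \<Longrightarrow> w \<in> h ` ball 0 1"
  obtains B s where "slit_map B s" "\<And>z. cmod z < 1 \<Longrightarrow> q z = slit_map.q B s z"
proof -
  obtain C :: "real set" and m where C: "finite C" "\<And>c. m c \<ge> 0"
    "\<And>z. cmod z < 1 \<Longrightarrow> q z = (\<Sum>c\<in>C. of_real (m c) * ((cis c + z) / (cis c - z)))"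
    using discrete_representation[OF assms] by blast
  define C' where "C' = {c \<in> C. m c > 0}"
  define s where "s b = (\<Sum>c | c \<in> C' \<and> cis c = b. m c)" for b
  have fin: "finite C'" using C(1) by (simp add: C'_def)
  have q: "q z = (\<Sum>b\<in>cis ` C'. of_real (s b) * ((b + z) / (b - z)))" if "cmod z < 1" for z
  proof -
    have "q z = (\<Sum>c\<in>C'. of_real (m c) * ((cis c + z) / (cis c - z)))"
      unfolding C(3)[OF that] using C(1,2) by (intro sum.mono_neutral_right) (auto simp: C'_def order.order_iff_strict)
    also have "\<dots> = (\<Sum>b\<in>cis ` C'. \<Sum>c | c \<in> C' \<and> cis c = b. of_real (m c) * ((cis c + z) / (cis c - z)))"
      by (rule sum.image_gen[OF fin])
    also have "\<dots> = (\<Sum>b\<in>cis ` C'. of_real (s b) * ((b + z) / (b - z)))"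
      unfolding s_def of_real_sum sum_distrib_right by (intro sum.cong) auto
    finally show ?thesis .
  qed
  have sm: "slit_map (cis ` C') s"
  proof
    show "s b > 0" if "b \<in> cis ` C'" for b
    proof -
      have "finite {c \<in> C'. cis c = b}" using fin by simp
      then show ?thesis unfolding s_def using that by (intro sum_pos) (auto simp: C'_def)
    qed
    have "complex_of_real (\<Sum>b\<in>cis ` C'. s b) = q 0"
      unfolding q[of 0, simplified] of_real_sum by (intro sum.cong) auto
    then show "(\<Sum>b\<in>cis ` C'. s b) = 1" unfolding q_0 by (metis of_real_eq_1_iff)
  qed (use fin in auto)
  then show ?thesis using q by (intro that[of "cis ` C'" s]) (auto simp: slit_map.q_def[OF sm])
qed

end

subsection \<open>Clockwise angles\<close>

lemma clockwise_angle_bounds: "0 \<le> clockwise_angle u v" "clockwise_angle u v < 2 * pi"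
  unfolding clockwise_angle_def using Arg2pi[of "u / v"] by auto

lemma clockwise_angle_unique:
  assumes "u / v = of_real r * cis t" "r > 0" "0 \<le> t" "t < 2 * pi"
  shows "clockwise_angle u v = t"
  unfolding clockwise_angle_def using assms by (intro Arg2pi_unique[of r]) (auto simp: cis_conv_exp)

lemma clockwise_angle_polar: "u / v = of_real (cmod (u / v)) * cis (clockwise_angle u v)"
  unfolding clockwise_angle_def using Arg2pi_eq[of "u / v"] by (simp only: cis_conv_exp)

lemma clockwise_angle_diff:
  assumes nz: "u \<noteq> 0" "v \<noteq> 0" "w \<noteq> 0" and le: "clockwise_angle u v \<le> clockwise_angle u w"
  shows "clockwise_angle v w = clockwise_angle u w - clockwise_angle u v"
proof (rule clockwise_angle_unique)
  have "v / w = (u / w) / (u / v)" using nz by simp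
  also have "\<dots> = of_real (cmod (u / w) / cmod (u / v)) * (cis (clockwise_angle u w) / cis (clockwise_angle u v))"
    by (subst (1 2) clockwise_angle_polar) simp
  finally show "v / w = of_real (cmod (u / w) / cmod (u / v)) * cis (clockwise_angle u w - clockwise_angle u v)"
    by (simp add: cis_divide)
  show "cmod (u / w) / cmod (u / v) > 0" using nz by simp
qed (use le clockwise_angle_bounds[of u w] clockwise_angle_bounds[of u v] in auto)

lemma clockwise_angle_reverse:
  assumes nz: "u \<noteq> 0" "v \<noteq> 0" and "clockwise_angle u v \<noteq> 0"
  shows "clockwise_angle v u = 2 * pi - clockwise_angle u v"
proof (rule clockwise_angle_unique)
  let ?t = "clockwise_angle u v"
  have "v / u = 1 / (u / v)" using nz by simp
  also have "\<dots> = of_real (1 / cmod (u / v)) * (1 / cis ?t)"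
    by (subst clockwise_angle_polar) simp
  also have "1 / cis ?t = cis (2 * pi - ?t)"
    by (simp add: cis_divide[symmetric])
  finally show "v / u = of_real (1 / cmod (u / v)) * cis (2 * pi - ?t)" .
  show "1 / cmod (u / v) > 0" using nz by simp
qed (use assms(3) clockwise_angle_bounds[of u v] in auto)

lemma clockwise_angle_self: "u \<noteq> 0 \<Longrightarrow> clockwise_angle u u = 0"
  by (intro clockwise_angle_unique[where r = 1]) auto

text \<open>Measured from \<open>T 0\<close>, the angles telescope up to the last index, and the
  closing angle back to \<open>T 0\<close> is the rest of the full turn. For a single vector the
  closing angle would be 0, hence m \<ge> 2.\<close>

lemma sum_consecutive_clockwise_angles:
  assumes m: "m \<ge> 2" and nz: "\<And>j. j < m \<Longrightarrow> T j \<noteq> 0"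
    and mono: "strict_mono_on {..<m} (\<lambda>j. clockwise_angle (T 0) (T j))"
  shows "(\<Sum>j<m. clockwise_angle (T j) (T (Suc j mod m))) = 2 * pi"
proof -
  define th where "th j = clockwise_angle (T 0) (T j)" for j
  obtain n where n: "m = Suc n" "n \<ge> 1" using m by (cases m) auto
  have less: "th i < th j" if "i < j" "j < m" for i j
    using mono that by (auto simp: th_def strict_mono_on_def)
  have th0: "th 0 = 0" using nz m by (simp add: th_def clockwise_angle_self)
  have "(\<Sum>j<m. clockwise_angle (T j) (T (Suc j mod m))) =
      (\<Sum>j<n. clockwise_angle (T j) (T (Suc j mod m))) + clockwise_angle (T n) (T (Suc n mod m))"
    by (simp add: n(1))
  also have "(\<Sum>j<n. clockwise_angle (T j) (T (Suc j mod m))) = (\<Sum>j<n. th (Suc j) - th j)"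
  proof (rule sum.cong)
    fix j assume "j \<in> {..<n}"
    then have j: "j < m" "Suc j < m" "Suc j mod m = Suc j" using n by auto
    show "clockwise_angle (T j) (T (Suc j mod m)) = th (Suc j) - th j"
      unfolding th_def j(3) using nz j m less[of j "Suc j"]
      by (intro clockwise_angle_diff) (auto simp: th_def)
  qed simp
  also have "\<dots> = th n - th 0" by (rule sum_lessThan_telescope)
  also have "clockwise_angle (T n) (T (Suc n mod m)) = 2 * pi - th n"
  proof -
    have "th n \<noteq> 0" using less[of 0 n] th0 n by auto
    moreover have "Suc n mod m = 0" using n by simp
    ultimately show ?thesis
      using nz[of 0] nz[of n] n clockwise_angle_reverse[of "T 0" "T n"] unfolding th_def by simp
  qed
  finally show ?thesis using th0 by simp
qed

subsection \<open>Stolz angles\<close>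

text \<open>The radius ending at x runs inside the Stolz angle: there |x - y| = 1 - |y|, and R > 1.
  This makes nontangential limits unique.\<close>

lemma stolz_angle_nontrivial:
  assumes x: "cmod x = 1" and R: "R > 1"
  shows "at x within stolz_angle x R \<noteq> bot"
proof -
  have "x islimpt stolz_angle x R"
    unfolding islimpt_approachable
  proof (intro allI impI)
    fix e :: real assume e: "e > 0"
    define d where "d = min (e / 2) (1 / 2)"
    have d: "0 < d" "d < e" "d < 1" using e by (auto simp: d_def)
    define y where "y = of_real (1 - d) * x"
    have "x - y = of_real d * x" by (simp add: y_def algebra_simps)
    then have xy: "cmod (x - y) = d" using d x by (simp add: norm_mult)
    have ny: "cmod y = 1 - d" using d x unfolding y_def norm_mult norm_of_real by simp
    have "d < R * d" using R d by simp
    then have "y \<in> stolz_angle x R" using d by (auto simp: stolz_angle_def xy ny)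
    moreover have "y \<noteq> x" using xy d by auto
    moreover have "dist y x < e" using xy d by (simp add: dist_norm norm_minus_commute)
    ultimately show "\<exists>x'\<in>stolz_angle x R. x' \<noteq> x \<and> dist x' x < e" by blast
  qed
  then show ?thesis by (simp add: trivial_limit_within)
qed

lemma stolz_angle_subset: "stolz_angle x R \<subseteq> ball 0 1"
  by (auto simp: stolz_angle_def)

lemma nontangential_limitI: "(f \<longlongrightarrow> l) (at x within ball 0 1) \<Longrightarrow> nontangential_limit f x l"
  unfolding nontangential_limit_def by (auto intro: tendsto_within_subset[OF _ stolz_angle_subset])

lemma nontangential_liminf_iff:
  assumes x: "cmod x = 1" and lim: "(f \<longlongrightarrow> l) (at x within ball 0 1)"
  shows "nontangential_liminf f x c \<longleftrightarrow> c = l"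
proof -
  have "Liminf (at x within stolz_angle x R) (\<lambda>z. ereal (f z)) = ereal l" if "R > 1" for R
  proof (rule lim_imp_Liminf[OF stolz_angle_nontrivial[OF x that]])
    show "((\<lambda>z. ereal (f z)) \<longlongrightarrow> ereal l) (at x within stolz_angle x R)"
      using tendsto_within_subset[OF lim stolz_angle_subset] by (intro tendsto_ereal)
  qed
  moreover have "\<exists>R::real. R > 1" by (rule gt_ex)
  ultimately show ?thesis unfolding nontangential_liminf_def by auto
qed

subsection \<open>Polynomials with prescribed roots\<close>

text \<open>Distinct roots give divisibility by the product, and the degree bound leaves only a
  constant cofactor. The factors are a - z rather than z - a to match the denominators of the
  Herglotz kernels.\<close>

lemma poly_eq_smult_prod_roots:
  fixes P :: "complex poly"
  assumes fin: "finite A" and roots: "\<And>a. a \<in> A \<Longrightarrow> poly P a = 0" and deg: "degree P \<le> card A"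
  obtains c where "P = smult c (\<Prod>a\<in>A. [:a, -1:])"
proof -
  have "(\<Prod>a\<in>A. [:a, -1:]) dvd P"
    using fin roots
  proof (induction A)
    case (insert a A)
    then obtain K where K: "P = (\<Prod>a\<in>A. [:a, -1:]) * K" by auto
    have "poly (\<Prod>a\<in>A. [:a, -1:]) a \<noteq> 0"
      using insert by (auto simp: poly_prod)
    then have "poly K a = 0" using insert.prems[of a] K by simp
    then have "[:-a, 1:] dvd K" by (simp add: poly_eq_0_iff_dvd)
    moreover have "[:a, -1:] = smult (-1) [:-a, 1:]" by simp
    ultimately have "[:a, -1:] dvd K" by (metis smult_dvd_iff neg_equal_0_iff_equal one_neq_zero)
    then have "[:a, -1:] * (\<Prod>a\<in>A. [:a, -1:]) dvd K * (\<Prod>a\<in>A. [:a, -1:])" by (rule mult_dvd_mono) simp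
    then show ?case by (simp only: prod.insert[OF insert.hyps] K mult.commute)
  qed simp
  then obtain K where K: "P = (\<Prod>a\<in>A. [:a, -1:]) * K" by auto
  have deg_prod: "degree (\<Prod>a\<in>A. [:a, -1:]) = card A"
    by (subst degree_prod_eq_sum_degree) auto
  have nz: "(\<Prod>a\<in>A. [:a, -1:]) \<noteq> (0 :: complex poly)" using fin by simp
  have "degree K = 0"
    using deg nz deg_prod by (cases "K = 0") (auto simp: K degree_mult_eq)
  then obtain c where "K = [:c:]" by (metis degree_eq_zeroE)
  then show ?thesis using K by (intro that[of c]) simp
qed

text \<open>Clears the denominators of a sum of Herglotz kernels. The value at a node isolates the
  residue there, so that two such sums can be compared node by node.\<close>

lemma poly_sum_kernels:
  fixes w :: "complex \<Rightarrow> complex"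
  assumes fin: "finite A"
  obtains P where "degree P \<le> card A"
    "\<And>z. z \<notin> A \<Longrightarrow> poly P z = (\<Sum>a\<in>A. w a * ((a + z) / (a - z))) * (\<Prod>a\<in>A. a - z)"
    "\<And>a. a \<in> A \<Longrightarrow> poly P a = w a * (2 * a) * (\<Prod>a'\<in>A-{a}. a' - a)"
proof
  let ?P = "\<Sum>a\<in>A. smult (w a) ([:a, 1:] * (\<Prod>a'\<in>A-{a}. [:a', -1:]))"
  show "degree ?P \<le> card A"
  proof (rule degree_sum_le[OF fin])
    fix a assume a: "a \<in> A"
    have "degree (\<Prod>a'\<in>A-{a}. [:a', -1:]) = card (A - {a})"
      by (subst degree_prod_eq_sum_degree) auto
    then have "degree ([:a, 1:] * (\<Prod>a'\<in>A-{a}. [:a', -1:])) \<le> 1 + card (A - {a})"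
      using degree_mult_le[of "[:a, 1:]" "\<Prod>a'\<in>A-{a}. [:a', -1:]"] by simp
    also have "\<dots> = card A" using card_Suc_Diff1[OF fin a] by simp
    finally show "degree (smult (w a) ([:a, 1:] * (\<Prod>a'\<in>A-{a}. [:a', -1:]))) \<le> card A"
      using degree_smult_le order_trans by blast
  qed
  show "poly ?P z = (\<Sum>a\<in>A. w a * ((a + z) / (a - z))) * (\<Prod>a\<in>A. a - z)" if "z \<notin> A" for z
    unfolding poly_sum sum_distrib_right
  proof (rule sum.cong)
    fix a assume a: "a \<in> A"
    then have "a - z \<noteq> 0" using that by auto
    then have "w a * ((a + z) / (a - z)) * ((a - z) * p) = w a * ((a + z) * p)" for p by simp
    then show "poly (smult (w a) ([:a, 1:] * (\<Prod>a'\<in>A-{a}. [:a', -1:]))) z =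
        w a * ((a + z) / (a - z)) * (\<Prod>a\<in>A. a - z)"
      unfolding prod.remove[OF fin a] by (simp only:) (simp add: poly_prod distrib_right)
  qed simp
  show "poly ?P a = w a * (2 * a) * (\<Prod>a'\<in>A-{a}. a' - a)" if a: "a \<in> A" for a
  proof -
    have "poly ?P a = (\<Sum>a0\<in>A. if a0 = a then w a * (2 * a) * (\<Prod>a'\<in>A-{a}. a' - a) else 0)"
      unfolding poly_sum
    proof (rule sum.cong)
      fix a0 assume "a0 \<in> A"
      show "poly (smult (w a0) ([:a0, 1:] * (\<Prod>a'\<in>A-{a0}. [:a', -1:]))) a =
        (if a0 = a then w a * (2 * a) * (\<Prod>a'\<in>A-{a}. a' - a) else 0)"
      proof (cases "a0 = a")
        case True
        then show ?thesis by (simp add: poly_prod)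
      next
        case False
        then have "(\<Prod>a'\<in>A-{a0}. a' - a) = 0" using fin a by (intro prod_zero) auto
        then show ?thesis using False by (simp add: poly_prod)
      qed
    qed simp
    then show ?thesis using fin a by simp
  qed
qed

section \<open>Boundary data of an explicit slit map: weights, tips and masses\<close>

context slit_map
begin

lemma tendsto_h_circle:
  assumes "cmod x = 1" "x \<notin> B"
  shows "(h \<longlongrightarrow> h x) (at x within ball 0 1)"
proof -
  have "isCont h x" using assms by (intro DERIV_isCont[OF has_field_derivative_h]) auto
  then show ?thesis by (metis continuous_at_imp_continuous_at_within continuous_within)
qed

lemma at_within_disc_nontrivial: "cmod x = 1 \<Longrightarrow> at x within ball 0 1 \<noteq> bot"
  by (simp add: trivial_limit_within islimpt_ball)

lemma infinity_points: "{x \<in> sphere 0 1. filterlim h at_infinity (at x within ball 0 1)} = B"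
proof (intro equalityI subsetI)
  fix x assume x: "x \<in> {x \<in> sphere 0 1. filterlim h at_infinity (at x within ball 0 1)}"
  then show "x \<in> B"
    using not_tendsto_and_filterlim_at_infinity[OF at_within_disc_nontrivial tendsto_h_circle] by auto
next
  fix x assume "x \<in> B"
  then show "x \<in> {x \<in> sphere 0 1. filterlim h at_infinity (at x within ball 0 1)}"
    using filterlim_h_at_infinity norm_B filterlim_mono[OF _ order_refl at_le] by (metis (mono_tags, lifting) mem_Collect_eq mem_sphere_0 subset_UNIV)
qed

text \<open>\<open>sgn_h_clockwise\<close> fixes the angle only modulo 2 pi. The sum lies in [0, 1],
  and the value 1 would make the two directions equal; hence 2 pi times the sum is the
  representative in [0, 2 pi).\<close>

lemma clockwise_angle_h:
  assumes u: "cmod u = 1" "u \<notin> B" and v: "cmod v = 1" "v \<notin> B" and ne: "sgn (h u) \<noteq> sgn (h v)"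
  shows "clockwise_angle (h u) (h v) = 2 * pi * (\<Sum>b | b \<in> B \<and> clockwise_angle u b \<le> clockwise_angle u v. s b)"
proof (rule clockwise_angle_unique)
  let ?N = "\<Sum>b | b \<in> B \<and> clockwise_angle u b \<le> clockwise_angle u v. s b"
  have nz: "h u \<noteq> 0" "h v \<noteq> 0" using u v h_eq_0_iff by fastforce+
  have sg: "sgn (h v) = sgn (h u) * cis (- 2 * pi * ?N)" by (rule sgn_h_clockwise[OF u v])
  have "?N \<ge> 0" using s_pos by (intro sum_nonneg) (auto intro: less_imp_le)
  then show "0 \<le> 2 * pi * ?N" by simp
  have "?N \<le> 1"
    unfolding s_sum[symmetric] using finite_B s_pos by (intro sum_mono2) (auto intro: less_imp_le)
  moreover have "?N \<noteq> 1"
  proof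
    assume "?N = 1"
    moreover have "cis (- 2 * pi * 1) = 1" by (simp add: complex_eq_iff)
    ultimately have "cis (- 2 * pi * ?N) = 1" by (simp only:)
    with sg ne show False by simp
  qed
  ultimately show "2 * pi * ?N < 2 * pi" by simp
  show "cmod (h u) / cmod (h v) > 0" using nz by simp
  have "h u / h v = of_real (cmod (h u) / cmod (h v)) * (sgn (h u) / sgn (h v))"
    using nz by (simp add: sgn_div_norm scaleR_conv_of_real field_simps)
  also have "sgn (h u) / sgn (h v) = cis (2 * pi * ?N)"
    unfolding sg using nz by (simp add: sgn_zero_iff field_simps cis_mult)
  finally show "h u / h v = of_real (cmod (h u) / cmod (h v)) * cis (2 * pi * ?N)" .
qed

text \<open>The arc from \<open>a j\<close> to its successor contains \<open>b j\<close>, so \<open>s (b j) \<le> \<sigma> j\<close>; equality follows since both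
  families sum to 1.\<close>

lemma weights_eq_angles:
  assumes m: "m \<ge> 1" and a: "\<And>j. j < m \<Longrightarrow> cmod (a j) = 1" "\<And>j. j < m \<Longrightarrow> a j \<notin> B"
    and inj: "inj_on (\<lambda>j. sgn (h (a j))) {..<m}"
    and mono: "strict_mono_on {..<m} (\<lambda>j. clockwise_angle (h (a 0)) (h (a j)))"
    and b: "bij_betw b {..<m} B" "\<And>j. j < m \<Longrightarrow> b j \<in> clockwise_arc (a j) (a (Suc j mod m))"
    and \<sigma>: "\<And>j. j < m \<Longrightarrow> 2 * pi * \<sigma> j =
        (if m = 1 then 2 * pi else clockwise_angle (h (a j)) (h (a (Suc j mod m))))"
    and j: "j < m"
  shows "\<sigma> j = s (b j)"
proof -
  have sum_s: "(\<Sum>j<m. s (b j)) = 1" using sum.reindex_bij_betw[OF b(1), of s] s_sum by simp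
  show ?thesis
  proof (cases "m = 1")
    case True
    then show ?thesis using sum_s j \<sigma>[OF j] by simp
  next
    case False
    with m have m2: "m \<ge> 2" by simp
    have le: "s (b j) \<le> \<sigma> j" if j: "j < m" for j
    proof -
      let ?k = "Suc j mod m"
      have k: "?k < m" "?k \<noteq> j" using j m2 by (auto simp: mod_Suc)
      have ne: "sgn (h (a j)) \<noteq> sgn (h (a ?k))" using inj_onD[OF inj, of j ?k] k j by auto
      then have "a j \<noteq> a ?k" by auto
      then have arc: "clockwise_angle (a j) (b j) \<le> clockwise_angle (a j) (a ?k)"
        using b(2)[OF j] by (simp add: clockwise_arc_def)
      have "2 * pi * \<sigma> j = 2 * pi * (\<Sum>b | b \<in> B \<and> clockwise_angle (a j) b \<le> clockwise_angle (a j) (a ?k). s b)"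
        using \<sigma>[OF j] False clockwise_angle_h[OF a(1)[OF j] a(2)[OF j] a(1)[OF k(1)] a(2)[OF k(1)] ne] by simp
      then have "\<sigma> j = (\<Sum>b | b \<in> B \<and> clockwise_angle (a j) b \<le> clockwise_angle (a j) (a ?k). s b)" by simp
      moreover have "s (b j) \<le> \<dots>"
        using finite_B arc b(1) j s_pos
        by (intro member_le_sum[of "b j" _ s]) (auto simp: bij_betw_def intro: less_imp_le)
      ultimately show ?thesis by simp
    qed
    have nz: "h (a j) \<noteq> 0" if "j < m" for j using a(1)[OF that] h_eq_0_iff[of "a j"] by auto
    have "(\<Sum>j<m. 2 * pi * \<sigma> j) = 2 * pi"
      using sum_consecutive_clockwise_angles[OF m2 nz mono] \<sigma> False by simp
    then have "(\<Sum>j<m. \<sigma> j) = 1" by (simp flip: sum_distrib_left)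
    then have "(\<Sum>j<m. \<sigma> j - s (b j)) = 0" using sum_s by (simp add: sum_subtractf)
    then have "\<forall>j\<in>{..<m}. \<sigma> j - s (b j) = 0"
      using le by (subst (asm) sum_nonneg_eq_0_iff) auto
    then show ?thesis using j by auto
  qed
qed

text \<open>The derivative of |h(a cis t)|^2 at t = 0 is -2 Im(q a) |h a|^2. It vanishes at a
  minimum, and Re q vanishes on the whole circle off \<open>B\<close>.\<close>

lemma q_eq_0_if_local_min:
  assumes a: "cmod a = 1" "a \<notin> B" and d: "d > 0"
    and min: "\<And>x. cmod x = 1 \<Longrightarrow> dist x a < d \<Longrightarrow> cmod (h a) \<le> cmod (h x)"
  shows "q a = 0"
proof -
  have "((\<lambda>z. a * exp (\<i> * z)) has_field_derivative a * (\<i> * exp (\<i> * of_real 0))) (at (of_real 0))"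
    by (auto intro!: derivative_eq_intros)
  moreover have "(h has_field_derivative E a * q a) (at (a * exp (\<i> * of_real 0)))"
    using has_field_derivative_h[of a] a by simp
  ultimately have "((\<lambda>z. h (a * exp (\<i> * z))) has_field_derivative (E a * q a) * (a * (\<i> * exp (\<i> * of_real 0)))) (at (of_real 0))"
    by (rule DERIV_chain2[where f = h and g = "\<lambda>z. a * exp (\<i> * z)", rotated])
  from has_vector_derivative_real_field[OF this]
  have "((\<lambda>t. h (a * cis t)) has_vector_derivative \<i> * q a * h a) (at 0)"
    by (simp add: h_def cis_conv_exp mult_ac)
  then have D: "((\<lambda>t. h (a * cis t)) has_derivative (\<lambda>t. t *\<^sub>R (\<i> * q a * h a))) (at 0)"
    by (simp add: has_vector_derivative_def)
  have "((\<lambda>t. h (a * cis t) \<bullet> h (a * cis t)) has_derivative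
      (\<lambda>t. h (a * cis 0) \<bullet> (t *\<^sub>R (\<i> * q a * h a)) + (t *\<^sub>R (\<i> * q a * h a)) \<bullet> h (a * cis 0))) (at 0)"
    by (rule has_derivative_inner[OF D D])
  then have "((\<lambda>t. (cmod (h (a * cis t)))\<^sup>2) has_real_derivative 2 * (h a \<bullet> (\<i> * q a * h a))) (at 0)"
  proof -
    have "(\<lambda>t. h (a * cis 0) \<bullet> (t *\<^sub>R (\<i> * q a * h a)) + (t *\<^sub>R (\<i> * q a * h a)) \<bullet> h (a * cis 0)) =
        (*) (2 * (h a \<bullet> (\<i> * q a * h a)))"
      unfolding inner_scaleR_left inner_scaleR_right cis_zero mult_1_right
      by (simp only: inner_commute[of _ "h a"]) (simp add: fun_eq_iff)
    moreover assume "((\<lambda>t. h (a * cis t) \<bullet> h (a * cis t)) has_derivative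
      (\<lambda>t. h (a * cis 0) \<bullet> (t *\<^sub>R (\<i> * q a * h a)) + (t *\<^sub>R (\<i> * q a * h a)) \<bullet> h (a * cis 0))) (at 0)"
    ultimately show ?thesis unfolding has_field_derivative_def power2_norm_eq_inner by (simp only:)
  qed
  moreover have "\<exists>e>0. \<forall>t. \<bar>0 - t\<bar> < e \<longrightarrow> (cmod (h (a * cis 0)))\<^sup>2 \<le> (cmod (h (a * cis t)))\<^sup>2"
  proof (intro exI[of _ d] conjI allI impI d)
    fix t :: real assume t: "\<bar>0 - t\<bar> < d"
    have "a * cis t - a = a * (cis t - cis 0)" by (simp add: algebra_simps)
    then have "dist (a * cis t) a = cmod (cis t - cis 0)" using a by (simp add: dist_norm norm_mult)
    also have "\<dots> < d" using norm_cis_diff_le[of t 0] t by simp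
    finally show "(cmod (h (a * cis 0)))\<^sup>2 \<le> (cmod (h (a * cis t)))\<^sup>2"
      using min[of "a * cis t"] a by (simp add: norm_mult power_mono)
  qed
  ultimately have "2 * (h a \<bullet> (\<i> * q a * h a)) = 0" using DERIV_local_min by blast
  moreover have "h a \<bullet> (\<i> * q a * h a) = - (Im (q a) * (cmod (h a))\<^sup>2)"
    unfolding cmod_power2 inner_complex_def by (simp add: algebra_simps power2_eq_square)
  moreover have "h a \<noteq> 0" using a h_eq_0_iff[of a] by auto
  ultimately have "Im (q a) = 0" by simp
  then show ?thesis using Re_q_circle[OF a(1)] by (simp add: complex_eq_iff)
qed

lemma has_field_derivative_q:
  assumes "z \<notin> B"
  shows "(q has_field_derivative (\<Sum>b\<in>B. of_real (s b) * (2 * b / (b - z)\<^sup>2))) (at z)"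
  unfolding q_def
proof (rule DERIV_sum)
  fix b assume "b \<in> B"
  then have "b - z \<noteq> 0" using assms by auto
  then show "((\<lambda>z. of_real (s b) * ((b + z) / (b - z))) has_field_derivative of_real (s b) * (2 * b / (b - z)\<^sup>2)) (at z)"
    by (auto intro!: derivative_eq_intros simp: power2_eq_square field_simps)
qed

text \<open>For a circle point off \<open>B\<close> this is -1/(2 a q'(a)). If moreover q a = 0,
  then 1/q has residue 1/q'(a) = -2 a \<open>mass a\<close> there, which is the residue of
  \<open>mass a\<close> times the Herglotz kernel of a.\<close>

definition mass :: "complex \<Rightarrow> real" where
  "mass a = 1 / (4 * (\<Sum>b\<in>B. s b / (cmod (b - a))\<^sup>2))"

lemma mass_pos:
  assumes "a \<notin> B"
  shows "mass a > 0"
proof -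
  have "(\<Sum>b\<in>B. s b / (cmod (b - a))\<^sup>2) > 0"
    using finite_B B_nonempty s_pos assms by (intro sum_pos) (auto simp: zero_less_divide_iff)
  then show ?thesis by (simp add: mass_def)
qed

text \<open>For a and b on the circle, a b |b - a|^2 = -(b - a)^2, so a q'(a) is the negative real
  number -2 \<Sum> s(b)/|b - a|^2. This is why the masses are real and positive.\<close>

lemma deriv_q_circle:
  assumes a: "cmod a = 1" "a \<notin> B"
  shows "2 * of_real (mass a) * a * (\<Sum>b\<in>B. of_real (s b) * (2 * b / (b - a)\<^sup>2)) = - 1"
proof -
  have "a * (\<Sum>b\<in>B. of_real (s b) * (2 * b / (b - a)\<^sup>2)) = - 2 * of_real (\<Sum>b\<in>B. s b / (cmod (b - a))\<^sup>2)"
    unfolding of_real_sum sum_distrib_left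
  proof (rule sum.cong)
    fix b assume b: "b \<in> B"
    have ba: "b - a \<noteq> 0" using b a by auto
    have 1: "a * cnj a = 1" "b * cnj b = 1" using a(1) norm_B[OF b] complex_norm_square[of a] complex_norm_square[of b] by auto
    have "a * b * ((b - a) * cnj (b - a)) = - (b - a)\<^sup>2 * (a * cnj a)"
      using 1 by (simp add: algebra_simps power2_eq_square)
    then have "a * b * of_real ((cmod (b - a))\<^sup>2) = - (b - a)\<^sup>2"
      unfolding complex_norm_square using 1 by simp
    then have "a * (2 * b / (b - a)\<^sup>2) = - 2 / of_real ((cmod (b - a))\<^sup>2)"
    proof -
      have N: "complex_of_real ((cmod (b - a))\<^sup>2) \<noteq> 0" using ba by simp
      have "a * (2 * b / (b - a)\<^sup>2) = 2 * (a * b * of_real ((cmod (b - a))\<^sup>2)) / ((b - a)\<^sup>2 * of_real ((cmod (b - a))\<^sup>2))"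
        using N by simp
      also have "\<dots> = - 2 * (b - a)\<^sup>2 / ((b - a)\<^sup>2 * of_real ((cmod (b - a))\<^sup>2))"
        by (simp only: \<open>a * b * of_real ((cmod (b - a))\<^sup>2) = - (b - a)\<^sup>2\<close>) simp
      also have "\<dots> = - 2 / of_real ((cmod (b - a))\<^sup>2)" using ba by simp
      finally show ?thesis .
    qed
    then show "a * (of_real (s b) * (2 * b / (b - a)\<^sup>2)) = - 2 * of_real (s b / (cmod (b - a))\<^sup>2)"
    proof -
      have "a * (of_real (s b) * (2 * b / (b - a)\<^sup>2)) = of_real (s b) * (a * (2 * b / (b - a)\<^sup>2))"
        by (rule mult.left_commute)
      also have "\<dots> = of_real (s b) * (- 2 / of_real ((cmod (b - a))\<^sup>2))"
        by (simp only: \<open>a * (2 * b / (b - a)\<^sup>2) = - 2 / of_real ((cmod (b - a))\<^sup>2)\<close>)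
      finally show ?thesis by simp
    qed
  qed simp
  moreover have "(\<Sum>b\<in>B. s b / (cmod (b - a))\<^sup>2) \<noteq> 0" using mass_pos[OF a(2)] by (auto simp: mass_def)
  then have "2 * complex_of_real (mass a) * (- 2 * of_real (\<Sum>b\<in>B. s b / (cmod (b - a))\<^sup>2)) = - 1"
  proof -
    have "2 * complex_of_real (1 / (4 * S)) * (- 2 * of_real S) = - 1" if "S \<noteq> 0" for S :: real
      using that by simp
    with \<open>_ \<noteq> 0\<close> show ?thesis unfolding mass_def by blast
  qed
  ultimately show ?thesis by (simp only: mult.assoc)
qed

end

lemma inj_on_cis: "b - a \<le> 2 * pi \<Longrightarrow> inj_on cis {a<..<b}"
proof (rule inj_onI)
  fix x y assume ab: "b - a \<le> 2 * pi" "x \<in> {a<..<b}" "y \<in> {a<..<b}" and eq: "cis x = cis y"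
  from eq have "sin x = sin y \<and> cos x = cos y" by (simp add: complex_eq_iff)
  then obtain n :: int where n: "x = y + 2 * pi * n" using sin_cos_eq_iff by blast
  have "\<bar>x - y\<bar> < 2 * pi" using ab by auto
  then have "2 * pi * \<bar>real_of_int n\<bar> < 2 * pi * 1" using n by (simp add: abs_mult)
  then have "\<bar>real_of_int n\<bar> < 1" by (subst (asm) mult_less_cancel_left_pos) auto
  then show "x = y" using n by simp
qed

lemma infinite_arc:
  assumes "a < b" "b - a \<le> 2 * pi"
  shows "infinite (cis ` {a<..<b})"
  using assms infinite_Ioo[of a b] finite_imageD[OF _ inj_on_cis] by blast

text \<open>The relation q = 1 + z f' determines f' away from 0, by continuity also at 0, and f 0 =
  0 fixes the constant of integration.\<close>

lemma starlike_map_unique: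
  assumes "starlike_map q f h" "starlike_map q' f' h'" and eq: "\<And>z. cmod z < 1 \<Longrightarrow> q z = q' z"
    and z: "cmod z < 1"
  shows "h z = h' z"
proof -
  interpret s1: starlike_map q f h by fact
  interpret s2: starlike_map q' f' h' by fact
  define L where "L z = f z - f' z" for z
  have holL: "L holomorphic_on ball 0 1"
    unfolding L_def[abs_def] by (intro holomorphic_intros s1.hol_f s2.hol_f)
  have dL: "deriv L z = deriv f z - deriv f' z" if "cmod z < 1" for z
    unfolding L_def[abs_def] using that s1.hol_f s2.hol_f
    by (intro deriv_diff holomorphic_on_imp_differentiable_at[of _ "ball 0 1"]) auto
  have d0: "deriv L z = 0" if "cmod z < 1" "z \<noteq> 0" for z
    using s1.q_eq[OF that(1)] s2.q_eq[OF that(1)] eq[OF that(1)] that(2) by (simp add: dL[OF that(1)])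
  have "deriv L 0 = 0"
  proof -
    have "continuous_on (ball 0 1) (deriv L)"
      by (intro holomorphic_on_imp_continuous_on holomorphic_deriv holL) simp
    then have "(deriv L \<longlongrightarrow> deriv L 0) (at 0)"
      by (simp add: continuous_on_eq_continuous_at isCont_def)
    moreover have "eventually (\<lambda>z. deriv L z = 0) (at 0)"
      unfolding eventually_at by (intro exI[of _ 1]) (auto simp: dist_norm intro: d0)
    then have "(deriv L \<longlongrightarrow> 0) (at 0)" by (rule tendsto_eventually)
    ultimately show ?thesis by (rule tendsto_unique[rotated]) simp
  qed
  with d0 have dz: "deriv L z = 0" if "cmod z < 1" for z using that by (cases "z = 0") auto
  have "\<exists>c. \<forall>z\<in>ball 0 1. L z = c"
  proof (rule has_field_derivative_zero_constant)
    show "(L has_field_derivative 0) (at z within ball 0 1)" if "z \<in> ball 0 1" for z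
      using holomorphic_derivI[OF holL open_ball that] dz[of z] that by (simp add: has_field_derivative_at_within)
  qed simp
  then have "L z = L 0" using z by force
  then have "f z = f' z" by (simp add: L_def s1.f_0 s2.f_0)
  then show ?thesis using z by (simp add: s1.h_eq s2.h_eq)
qed

section \<open>The reciprocal of q, null points and poles\<close>

context slit_map
begin

lemma starlike_map: "starlike_map q (\<lambda>z. - 2 * (\<Sum>b\<in>B. of_real (s b) * Ln (1 - z / b))) h"
proof
  let ?F = "\<lambda>z. - 2 * (\<Sum>b\<in>B. of_real (s b) * Ln (1 - z / b))"
  show hF: "?F holomorphic_on ball 0 1"
  proof (intro holomorphic_intros)
    show "1 - z / b \<notin> \<real>\<^sub>\<le>\<^sub>0" if "b \<in> B" "z \<in> ball 0 1" for b z
      using branch[of z b] notin_B[of z] that by auto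
  qed (use nonzero_B in auto)
  show "q z = 1 + z * deriv ?F z" if z: "cmod z < 1" for z
  proof -
    have "(?F has_field_derivative deriv ?F z) (at z)"
      using z by (intro holomorphic_derivI[OF hF]) auto
    moreover have "((\<lambda>z. z * exp (F z)) has_field_derivative exp (F z) + z * (exp (F z) * D)) (at z)"
      if "(F has_field_derivative D) (at z)" for F D
      using that by (auto intro!: derivative_eq_intros)
    ultimately have "((\<lambda>z. z * exp (?F z)) has_field_derivative exp (?F z) + z * (exp (?F z) * deriv ?F z)) (at z)"
      by blast
    then have "(h has_field_derivative E z * (1 + z * deriv ?F z)) (at z)"
      by (simp add: h_def[abs_def] E_def[abs_def] algebra_simps)
    moreover have "(h has_field_derivative E z * q z) (at z)"
      using z notin_B[OF z] by (intro has_field_derivative_h) auto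
    ultimately have "E z * (1 + z * deriv ?F z) = E z * q z" by (rule DERIV_unique)
    then show ?thesis using E_nonzero by simp
  qed
  show "q holomorphic_on ball 0 1" using holomorphic_on_q by (rule holomorphic_on_subset) (use notin_B in auto)
  show "Re (q z) \<ge> 0" if "cmod z < 1" for z using Re_q_pos[OF that] by simp
qed (simp_all add: h_def E_def)

text \<open>With one zero per pole, \<open>q\<close> times the product of the b - z is a polynomial
  of degree at most |A| vanishing on \<open>A\<close>, hence c times the product of the a - z. The
  candidate sum and 1/q have equal residues on \<open>A\<close>, so they differ by the constant
  k/c.\<close>

lemma inverse_q_formula:
  assumes A: "finite A" "A \<subseteq> sphere 0 1" "A \<inter> B = {}" "card A = card B" and zeros: "\<And>a. a \<in> A \<Longrightarrow> q a = 0"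
  shows "(\<Sum>a\<in>A. mass a) = 1"
    and "\<And>z. cmod z < 1 \<Longrightarrow> 1 / q z = (\<Sum>a\<in>A. of_real (mass a) * ((a + z) / (a - z)))"
proof -
  define PA PB where "PA = (\<Prod>a\<in>A. [:a, -1:])" and "PB = (\<Prod>b\<in>B. [:b, -1:])"
  have poly_PA: "poly PA z = (\<Prod>a\<in>A. a - z)" and poly_PB: "poly PB z = (\<Prod>b\<in>B. b - z)" for z
    by (auto simp: PA_def PB_def poly_prod)
  have PA_nz: "poly PA z \<noteq> 0" if "z \<notin> A" for z using that A(1) by (auto simp: poly_PA)
  have PB_nz: "poly PB z \<noteq> 0" if "z \<notin> B" for z using that finite_B by (auto simp: poly_PB)
  define Rf where "Rf z = (\<Sum>a\<in>A. of_real (mass a) * ((a + z) / (a - z)))" for z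
  have roots: "\<exists>c. P = smult c PA" if "\<And>a. a \<in> A \<Longrightarrow> poly P a = 0" "degree P \<le> card A" for P
    unfolding PA_def by (rule poly_eq_smult_prod_roots[OF A(1) that]) blast+
  obtain Q where "degree Q \<le> card B"
    "\<And>z. z \<notin> B \<Longrightarrow> poly Q z = (\<Sum>b\<in>B. of_real (s b) * ((b + z) / (b - z))) * (\<Prod>b\<in>B. b - z)"
    by (rule poly_sum_kernels[OF finite_B, of "\<lambda>b. of_real (s b)"]) blast
  then have Q: "degree Q \<le> card B" "\<And>z. z \<notin> B \<Longrightarrow> poly Q z = q z * poly PB z"
    unfolding q_def poly_PB by blast+
  have AB: "a \<notin> B" if "a \<in> A" for a using A(3) that by auto
  have "poly Q a = 0" if "a \<in> A" for a using Q(2)[OF AB[OF that]] zeros[OF that] by simp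
  then obtain c where c: "Q = smult c PA"
    using roots[of Q] Q(1) A(4) by auto
  obtain R where "degree R \<le> card A"
    "\<And>z. z \<notin> A \<Longrightarrow> poly R z = (\<Sum>a\<in>A. of_real (mass a) * ((a + z) / (a - z))) * (\<Prod>a\<in>A. a - z)"
    "\<And>a. a \<in> A \<Longrightarrow> poly R a = of_real (mass a) * (2 * a) * (\<Prod>a'\<in>A-{a}. a' - a)"
    by (rule poly_sum_kernels[OF A(1), of "\<lambda>a. of_real (mass a)"]) blast
  then have R: "degree R \<le> card A" "\<And>z. z \<notin> A \<Longrightarrow> poly R z = Rf z * poly PA z"
    "\<And>a. a \<in> A \<Longrightarrow> poly R a = of_real (mass a) * (2 * a) * (\<Prod>a'\<in>A-{a}. a' - a)"
    unfolding Rf_def poly_PA by blast+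
  \<comment> \<open>Equality of residues at a: the derivative of \<open>Q\<close> is computed once
    from the product of \<open>q\<close> and \<open>PB\<close> and once from the factorisation, and
    \<open>deriv_q_circle\<close> brings in \<open>mass a\<close>.\<close>
  have "poly (PB - smult c R) a = 0" if a: "a \<in> A" for a
  proof -
    let ?q' = "\<Sum>b\<in>B. of_real (s b) * (2 * b / (b - a)\<^sup>2)" and ?P = "\<Prod>a'\<in>A-{a}. a' - a"
    have "((\<lambda>z. q z * poly PB z) has_field_derivative ?q' * poly PB a + poly (pderiv PB) a * q a) (at a)"
      by (rule DERIV_mult[OF has_field_derivative_q[OF AB[OF a]] poly_DERIV])
    then have "(poly Q has_field_derivative ?q' * poly PB a + poly (pderiv PB) a * q a) (at a)"
      by (rule has_field_derivative_transform_within_open[where S = "- B"])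
        (use finite_B AB[OF a] Q(2) in \<open>auto intro: finite_imp_closed\<close>)
    from DERIV_unique[OF this poly_DERIV] have "?q' * poly PB a = poly (pderiv Q) a"
      using zeros[OF a] by simp
    also have "Q = smult c ([:a, -1:] * (\<Prod>a'\<in>A-{a}. [:a', -1:]))"
      unfolding c PA_def prod.remove[OF A(1) a] ..
    also have "poly (pderiv \<dots>) a = - c * ?P"
    proof -
      have "poly (pderiv (smult c ([:a, -1:] * p))) a = - c * poly p a" for p
        by (simp only: pderiv_smult pderiv_mult poly_smult poly_add poly_mult) (simp add: pderiv_pCons)
      then show ?thesis by (simp only: poly_prod) simp
    qed
    finally have "2 * of_real (mass a) * a * (?q' * poly PB a) = 2 * of_real (mass a) * a * (- c * ?P)" by (simp only:)
    moreover have "2 * of_real (mass a) * a * (?q' * poly PB a) = (2 * of_real (mass a) * a * ?q') * poly PB a"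
      by (simp only: mult.assoc)
    moreover have "2 * of_real (mass a) * a * ?q' = - 1"
      using A(2) a AB[OF a] by (intro deriv_q_circle) auto
    ultimately have "- 1 * poly PB a = 2 * of_real (mass a) * a * (- c * ?P)" by metis
    then show ?thesis using R(3)[OF a] by (simp add: mult_ac)
  qed
  moreover have "degree (PB - smult c R) \<le> card A"
  proof (rule degree_diff_le)
    have "degree PB = card B" unfolding PB_def by (subst degree_prod_eq_sum_degree) auto
    then show "degree PB \<le> card A" using A(4) by simp
    show "degree (smult c R) \<le> card A" using R(1) degree_smult_le order_trans by blast
  qed
  ultimately obtain k where k: "PB - smult c R = smult k PA"
    using roots[of "PB - smult c R"] by blast
  have "0 \<notin> A" "0 \<notin> B" using A(2) B_circle by auto
  have "c \<noteq> 0" using Q(2)[OF \<open>0 \<notin> B\<close>] PB_nz[OF \<open>0 \<notin> B\<close>] by (auto simp: c q_0)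
  have key: "q z * (Rf z + k / c) = 1" if z: "z \<notin> A" "z \<notin> B" for z
  proof -
    have "poly PB z = poly (smult c R + smult k PA) z" unfolding k[symmetric] by simp
    then have "poly PB z = (c * Rf z + k) * poly PA z" using R(2)[OF z(1)] by (simp add: algebra_simps)
    moreover have "q z * poly PB z = c * poly PA z" using Q(2)[OF z(2)] by (simp add: c)
    ultimately have "q z * (c * Rf z + k) * poly PA z = c * poly PA z" by (simp add: mult.assoc)
    then have "q z * (c * Rf z + k) = c" using PA_nz[OF z(1)] by simp
    then show ?thesis using \<open>c \<noteq> 0\<close> by (simp add: field_simps)
  qed
  have reciprocal: "y = 1 / w" if "w * y = 1" for w y :: complex
    using that by (cases "w = 0") (auto simp: nonzero_eq_divide_eq mult.commute)
  have Rf0: "Rf 0 = of_real (\<Sum>a\<in>A. mass a)"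
    unfolding Rf_def of_real_sum using \<open>0 \<notin> A\<close> by (intro sum.cong) auto
  have k0: "Rf 0 + k / c = 1" using key[OF \<open>0 \<notin> A\<close> \<open>0 \<notin> B\<close>] by (simp add: q_0)
  have "Im (k / c) = 0" using arg_cong[OF k0, of Im] by (simp add: Rf0)
  \<comment> \<open>The value at 0 settles only the imaginary part, since the sum of the masses is
    still unknown. The real part is read off at a circle point outside \<open>A\<close> and
    \<open>B\<close>, where the candidate sum and 1/q are both purely imaginary.\<close>
  moreover have "Re (k / c) = 0"
  proof -
    have "infinite (sphere 0 1 :: complex set)"
    proof -
      have "cis ` {0<..<1} \<subseteq> sphere 0 1" by (intro image_subsetI) simp
      moreover have "infinite (cis ` {0<..<1})" using pi_gt3 by (intro infinite_arc) auto
      ultimately show ?thesis by (rule infinite_super)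
    qed
    then obtain x where x: "x \<in> sphere 0 1" "x \<notin> A" "x \<notin> B"
    proof -
      have "\<not> sphere 0 1 \<subseteq> A \<union> B" using \<open>infinite (sphere 0 1)\<close> A(1) finite_B finite_subset by blast
      then show ?thesis using that by blast
    qed
    have "Re (Rf x) = 0"
      unfolding Rf_def Re_sum
    proof (rule sum.neutral, rule ballI)
      fix a assume "a \<in> A"
      then have "Re ((a + x) / (a - x)) = 0" using A(2) x(1) by (subst Re_Herglotz_kernel) auto
      then show "Re (of_real (mass a) * ((a + x) / (a - x))) = 0"
        unfolding scaleR_conv_of_real[symmetric] by simp
    qed
    moreover have "Re (q x) = 0" using x by (intro Re_q_circle) auto
    then have "Re (1 / q x) = 0" by (simp add: Re_divide)
    moreover have "Rf x + k / c = 1 / q x" by (rule reciprocal[OF key[OF x(2,3)]])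
    then have "Re (Rf x) + Re (k / c) = Re (1 / q x)" by (simp only: plus_complex.simps(1)[symmetric])
    ultimately show ?thesis by (simp only: add_0_left)
  qed
  ultimately have kc: "k / c = 0" by (simp add: complex_eq_iff)
  show "(\<Sum>a\<in>A. mass a) = 1" using k0 unfolding kc Rf0 by (metis add.right_neutral of_real_eq_1_iff)
  show "1 / q z = (\<Sum>a\<in>A. of_real (mass a) * ((a + z) / (a - z)))" if z: "cmod z < 1" for z
  proof -
    have "z \<notin> A" "z \<notin> B" using z A(2) B_circle by auto
    from key[OF this] have "q z * Rf z = 1" by (simp only: kc add_0_right)
    from reciprocal[OF this] show ?thesis unfolding Rf_def by (rule sym)
  qed
qed

text \<open>At b, (b - z) q(z) tends to 2 s(b) b, so G(z)/(z - b) = z/((b - z) q(z)) tends to 1/(2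
  s(b)). Off \<open>B\<close>, q stays bounded; a finite limit of G(z)/(z - x) would force -z = q(z)
  G(z) to tend to 0 at a point of modulus 1.\<close>

lemma null_points:
  assumes G: "\<And>z. cmod z < 1 \<Longrightarrow> G z = - z / q z"
  shows "b \<in> B \<Longrightarrow> boundary_regular_null_point G b (1 / (2 * s b))"
    and "{x. \<exists>l. boundary_regular_null_point G x l} = B"
proof -
  show null: "boundary_regular_null_point G b (1 / (2 * s b))" if b: "b \<in> B" for b
    unfolding boundary_regular_null_point_def
  proof
    show "b \<in> sphere 0 1" using b B_circle by auto
    let ?F = "at b within ball 0 1"
    have bn: "b \<noteq> 0" using nonzero_B[OF b] .
    \<comment> \<open>This is (b - z) q(z) with the pole at b cancelled.\<close>
    let ?g = "\<lambda>z. of_real (s b) * (b + z) + (b - z) * (\<Sum>c\<in>B-{b}. of_real (s c) * ((c + z) / (c - z)))"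
    have "(?g \<longlongrightarrow> of_real (s b) * (b + b) + (b - b) * (\<Sum>c\<in>B-{b}. of_real (s c) * ((c + b) / (c - b)))) ?F"
      by (intro tendsto_intros) auto
    then have "(?g \<longlongrightarrow> 2 * of_real (s b) * b) ?F" by (simp add: algebra_simps)
    moreover have "2 * complex_of_real (s b) * b \<noteq> 0" using bn s_pos[OF b] by simp
    ultimately have "((\<lambda>z. z / ?g z) \<longlongrightarrow> b / (2 * of_real (s b) * b)) ?F"
      by (intro tendsto_intros) auto
    then have "((\<lambda>z. z / ?g z) \<longlongrightarrow> of_real (1 / (2 * s b))) ?F" using bn by simp
    moreover have "eventually (\<lambda>z. z / ?g z = G z / (z - b)) ?F"
    proof -
      have "z / ?g z = G z / (z - b)" if z: "cmod z < 1" for z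
      proof -
        have zb: "b - z \<noteq> 0" using z norm_B[OF b] by auto
        have "q z = of_real (s b) * ((b + z) / (b - z)) + (\<Sum>c\<in>B-{b}. of_real (s c) * ((c + z) / (c - z)))"
          unfolding q_def by (rule sum.remove[OF finite_B b])
        moreover have "(b - z) * (of_real (s b) * ((b + z) / (b - z))) = of_real (s b) * (b + z)"
          using zb by simp
        ultimately have "(b - z) * q z = ?g z" by (simp only: distrib_left)
        then have "z / ?g z = z / ((b - z) * q z)" by simp
        also have "\<dots> = - z / q z / (z - b)"
          by (metis (no_types, opaque_lifting) divide_divide_eq_left minus_diff_eq minus_divide_divide mult.commute mult_minus_left)
        finally show ?thesis using G[OF z] by simp
      qed
      then show ?thesis unfolding eventually_at_filter by (auto intro!: always_eventually)
    qed
    ultimately have "((\<lambda>z. G z / (z - b)) \<longlongrightarrow> of_real (1 / (2 * s b))) ?F"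
      by (rule Lim_transform_eventually)
    then show "nontangential_limit (\<lambda>z. G z / (z - b)) b (of_real (1 / (2 * s b)))"
      by (rule nontangential_limitI)
  qed
  show "{x. \<exists>l. boundary_regular_null_point G x l} = B"
  proof (intro equalityI subsetI)
    fix x assume "x \<in> {x. \<exists>l. boundary_regular_null_point G x l}"
    then obtain l where x: "cmod x = 1" and nt: "nontangential_limit (\<lambda>z. G z / (z - x)) x (of_real l)"
      by (auto simp: boundary_regular_null_point_def)
    let ?F = "at x within stolz_angle x 2"
    show "x \<in> B"
    proof (rule ccontr)
      assume xB: "x \<notin> B"
      have "open (- B)" using finite_B by (intro open_Compl finite_imp_closed)
      then have "isCont q x" using continuous_on_q xB by (simp add: continuous_on_eq_continuous_at)
      then have "(q \<longlongrightarrow> q x) ?F" by (metis continuous_at_imp_continuous_at_within continuous_within)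
      moreover have "((\<lambda>z. G z / (z - x)) \<longlongrightarrow> of_real l) ?F" using nt by (simp add: nontangential_limit_def)
      ultimately have "((\<lambda>z. q z * (G z / (z - x) * (z - x))) \<longlongrightarrow> q x * (of_real l * (x - x))) ?F"
        by (intro tendsto_intros)
      moreover have "eventually (\<lambda>z. q z * (G z / (z - x) * (z - x)) = - z) ?F"
      proof -
        have *: "q z * (G z / (z - x) * (z - x)) = - z" if "cmod z < 1" for z
        proof -
          have "q z \<noteq> 0" "z - x \<noteq> 0" using Re_q_pos[OF that] that x by auto
          then show ?thesis using G[OF that] by simp
        qed
        show ?thesis
          unfolding eventually_at_filter
        proof (rule always_eventually, intro allI impI)
          fix z assume "z \<in> stolz_angle x 2"
          then show "q z * (G z / (z - x) * (z - x)) = - z"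
            using stolz_angle_subset[of x 2] by (intro *) auto
        qed
      qed
      ultimately have "((\<lambda>z. - z) \<longlongrightarrow> q x * (of_real l * (x - x))) ?F"
        by (rule Lim_transform_eventually)
      moreover have "((\<lambda>z. - z) \<longlongrightarrow> - x) ?F" by (intro tendsto_intros)
      ultimately have "q x * (of_real l * (x - x)) = - x"
        using stolz_angle_nontrivial[OF x, of 2] by (intro tendsto_unique) auto
      then show False using x by auto
    qed
  next
    fix x assume "x \<in> B"
    then show "x \<in> {x. \<exists>l. boundary_regular_null_point G x l}" using null by blast
  qed
qed

end

text \<open>The unrestricted limit of |G(z) (x - z)| exists at every point x of the circle: it is 2
  w(x) on \<open>A\<close> and 0 elsewhere. The positivity demanded of a mass therefore singles out
  \<open>A\<close>.\<close>

lemma regular_poles: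
  fixes A :: "complex set" and w :: "complex \<Rightarrow> real"
  assumes A: "finite A" "A \<subseteq> sphere 0 1" and w: "\<And>a. a \<in> A \<Longrightarrow> w a > 0"
    and G: "\<And>z. cmod z < 1 \<Longrightarrow> G z = - z * (\<Sum>a\<in>A. of_real (w a) * ((a + z) / (a - z)))"
  shows "a \<in> A \<Longrightarrow> regular_pole G a (2 * w a)"
    and "{x. \<exists>C. regular_pole G x C} = A"
proof -
  have lim: "((\<lambda>z. cmod (G z * (x - z))) \<longlongrightarrow> (if x \<in> A then 2 * w x else 0)) (at x within ball 0 1)"
    if x: "cmod x = 1" for x
  proof -
    let ?F = "at x within ball 0 1"
    let ?g = "\<lambda>z. (if x \<in> A then of_real (w x) * (x + z) else 0) + (x - z) * (\<Sum>c\<in>A-{x}. of_real (w c) * ((c + z) / (c - z)))"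
    have "(?g \<longlongrightarrow> (if x \<in> A then of_real (w x) * (x + x) else 0) + (x - x) * (\<Sum>c\<in>A-{x}. of_real (w c) * ((c + x) / (c - x)))) ?F"
    proof (cases "x \<in> A")
      case True
      then show ?thesis by (simp only: if_True) (intro tendsto_intros; auto)
    next
      case False
      then show ?thesis by (simp only: if_False) (intro tendsto_intros; auto)
    qed
    from tendsto_norm[OF tendsto_mult[OF tendsto_minus[OF tendsto_ident_at] this]]
    have "((\<lambda>z. cmod (- z * ?g z)) \<longlongrightarrow> cmod (- x * ((if x \<in> A then of_real (w x) * (x + x) else 0) + (x - x) * (\<Sum>c\<in>A-{x}. of_real (w c) * ((c + x) / (c - x)))))) ?F" .
    moreover have "cmod (- x * ((if x \<in> A then of_real (w x) * (x + x) else 0) + (x - x) * (\<Sum>c\<in>A-{x}. of_real (w c) * ((c + x) / (c - x)))))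
        = (if x \<in> A then 2 * w x else 0)"
    proof (cases "x \<in> A")
      case True
      have "cmod (- x * (of_real (w x) * (x + x))) = cmod x * (\<bar>w x\<bar> * (2 * cmod x))"
        unfolding mult_2[symmetric] norm_mult by simp
      then show ?thesis using True x w[OF True] by simp
    qed simp
    ultimately have "((\<lambda>z. cmod (- z * ?g z)) \<longlongrightarrow> (if x \<in> A then 2 * w x else 0)) ?F" by (simp only:)
    moreover have "eventually (\<lambda>z. cmod (- z * ?g z) = cmod (G z * (x - z))) ?F"
    proof -
      have "- z * ?g z = G z * (x - z)" if z: "cmod z < 1" for z
      proof -
        have xz: "x - z \<noteq> 0" using z x by auto
        have "(x - z) * (\<Sum>a\<in>A. of_real (w a) * ((a + z) / (a - z))) = ?g z"
        proof (cases "x \<in> A")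
          case True
          have "(x - z) * (of_real (w x) * ((x + z) / (x - z))) = of_real (w x) * (x + z)" using xz by simp
          then show ?thesis using True by (simp only: sum.remove[OF A(1) True] distrib_left if_True)
        next
          case False
          then show ?thesis by simp
        qed
        moreover have "- z * (u * S) = - z * S * u" for u S by simp
        ultimately show ?thesis unfolding G[OF z] by metis
      qed
      then show ?thesis unfolding eventually_at_filter by (auto intro!: always_eventually)
    qed
    ultimately show ?thesis by (rule Lim_transform_eventually)
  qed
  have iff: "regular_pole G x C \<longleftrightarrow> cmod x = 1 \<and> C > 0 \<and> C = (if x \<in> A then 2 * w x else 0)" for x C
  proof (cases "cmod x = 1")
    case True
    then show ?thesis using nontangential_liminf_iff[OF True lim[OF True]] by (auto simp: regular_pole_def)
  qed (auto simp: regular_pole_def)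
  show "regular_pole G a (2 * w a)" if "a \<in> A" for a
    using that w[OF that] A(2) by (auto simp: iff)
  then show "{x. \<exists>C. regular_pole G x C} = A"
    by (auto simp: iff split: if_splits)
qed

section \<open>The image of an explicit slit map\<close>

lemma sgn_complex_decompose: "w = of_real (cmod w) * sgn w"
  by (cases "w = 0") (simp_all add: sgn_div_norm scaleR_conv_of_real)

lemma sgn_of_real_times: "r > 0 \<Longrightarrow> sgn (of_real r * w) = sgn w" for w :: complex
  by (simp add: sgn_mult sgn_of_real)

text \<open>On each ray that it meets, the closed set \<open>S\<close> has a point nearest to 0, the
  tip, and invariance under r \<ge> 1 fills the ray from there on.\<close>

lemma radial_slit_domain_exists:
  assumes cl: "closed S" and S0: "0 \<notin> S" and up: "\<And>w r. w \<in> S \<Longrightarrow> r \<ge> 1 \<Longrightarrow> of_real r * w \<in> S"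
    and fin: "finite (sgn ` S)" and card: "card (sgn ` S) = m"
  obtains T where "radial_slit_domain m T (UNIV - S)"
proof -
  obtain d where d: "bij_betw d {..<m} (sgn ` S)"
    using ex_bij_betw_nat_finite[OF fin] by (auto simp: card atLeast0LessThan)
  have dS: "d j \<in> sgn ` S" if "j < m" for j using d that by (auto simp: bij_betw_def)
  have "\<exists>T. T \<in> S \<and> sgn T = d j \<and> (\<forall>w\<in>S. sgn w = d j \<longrightarrow> cmod T \<le> cmod w)" if j: "j < m" for j
  proof -
    \<comment> \<open>The ray is described by the closed condition w = |w| d j because
      \<open>sgn\<close> is discontinuous at 0; on \<open>S\<close>, which avoids 0, this agrees
      with \<open>sgn w = d j\<close>.\<close>
    let ?R = "{w \<in> S. w = of_real (cmod w) * d j}"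
    have R_iff: "w \<in> ?R \<longleftrightarrow> w \<in> S \<and> sgn w = d j" for w
    proof
      assume w: "w \<in> ?R"
      then have "w \<noteq> 0" using S0 by auto
      obtain v where "v \<in> S" "d j = sgn v" using dS[OF j] by auto
      then have "sgn (d j) = d j" by simp
      with w \<open>w \<noteq> 0\<close> show "w \<in> S \<and> sgn w = d j" using sgn_of_real_times[of "cmod w" "d j"] by auto
    next
      assume "w \<in> S \<and> sgn w = d j"
      then show "w \<in> ?R" using sgn_complex_decompose[of w] by auto
    qed
    have "?R = S \<inter> {w. w = of_real (cmod w) * d j}" by auto
    moreover have "closed {w. w = of_real (cmod w) * d j}"
      by (intro closed_Collect_eq continuous_intros)
    ultimately have "closed ?R" using cl by (simp add: closed_Int)
    moreover have "?R \<noteq> {}"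
    proof -
      obtain v where "v \<in> S" "d j = sgn v" using dS[OF j] by auto
      then have "v \<in> ?R" unfolding R_iff by simp
      then show ?thesis by blast
    qed
    ultimately obtain T where "T \<in> ?R" "\<forall>w\<in>?R. dist 0 T \<le> dist 0 w"
      by (rule distance_attains_inf) blast
    then have "T \<in> S" "sgn T = d j" "\<And>w. w \<in> S \<Longrightarrow> sgn w = d j \<Longrightarrow> cmod T \<le> cmod w"
      using R_iff by (simp_all add: Ball_def)
    then show ?thesis by blast
  qed
  then obtain T where T: "\<And>j. j < m \<Longrightarrow> T j \<in> S" "\<And>j. j < m \<Longrightarrow> sgn (T j) = d j"
    "\<And>j w. j < m \<Longrightarrow> w \<in> S \<Longrightarrow> sgn w = d j \<Longrightarrow> cmod (T j) \<le> cmod w"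
    by metis
  have nz: "T j \<noteq> 0" if "j < m" for j using T(1)[OF that] S0 by auto
  have "inj_on (\<lambda>j. sgn (T j)) {..<m}"
    using d T(2) by (auto simp: bij_betw_def inj_on_def)
  moreover have "S = (\<Union>j<m. radial_slit (T j) 1)"
  proof (intro equalityI subsetI)
    fix w assume w: "w \<in> S"
    then have "sgn w \<in> d ` {..<m}" using d by (auto simp: bij_betw_def)
    then obtain j where j: "j < m" "sgn w = d j" by auto
    have "w = of_real (cmod w) * d j" using sgn_complex_decompose[of w] unfolding j(2) .
    also have "\<dots> = of_real (cmod w / cmod (T j)) * (of_real (cmod (T j)) * d j)"
      using nz[OF j(1)] by simp
    also have "\<dots> = of_real (cmod w / cmod (T j)) * T j"
      using sgn_complex_decompose[of "T j"] unfolding T(2)[OF j(1)] by (simp only: mult.assoc)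
    finally have "w = of_real (cmod w / cmod (T j)) * T j" .
    moreover have "cmod w / cmod (T j) \<ge> 1"
      using T(3)[OF j(1) w j(2)] nz[OF j(1)] by simp
    ultimately show "w \<in> (\<Union>j<m. radial_slit (T j) 1)" using j(1) unfolding radial_slit_def by blast
  next
    fix w assume "w \<in> (\<Union>j<m. radial_slit (T j) 1)"
    then show "w \<in> S" using up T(1) by (auto simp: radial_slit_def)
  qed
  ultimately show ?thesis
    using nz by (intro that[of T]) (auto simp: radial_slit_domain_def)
qed

lemma radial_slit_domain_starlike:
  assumes "radial_slit_domain m T \<Omega>" "w \<in> \<Omega>" "0 \<le> t" "t \<le> 1"
  shows "of_real t * w \<in> \<Omega>"
proof (rule ccontr)
  assume "of_real t * w \<notin> \<Omega>"
  then obtain j r where j: "j < m" "r \<ge> 1" "of_real t * w = of_real r * T j"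
    using assms(1) by (auto simp: radial_slit_domain_def radial_slit_def)
  have "T j \<noteq> 0" using j assms(1) by (auto simp: radial_slit_domain_def)
  then have "t \<noteq> 0" using j by auto
  then have "w = of_real (r / t) * T j" using j(3) by (simp add: field_simps)
  moreover have "r / t \<ge> 1" using j(2) assms(3,4) \<open>t \<noteq> 0\<close> by (simp add: field_simps)
  ultimately have "w \<in> radial_slit (T j) 1" unfolding radial_slit_def by blast
  then show False using assms(1,2) j(1) by (auto simp: radial_slit_domain_def)
qed

context slit_map
begin

text \<open>If images converge, the points cannot accumulate at \<open>B\<close>, where
  \<open>h\<close> tends to infinity. Any other limit point lies in C - B, and \<open>h\<close> is
  continuous there.\<close>

lemma closed_image_h:
  assumes C: "closed C" "C \<subseteq> cball 0 1"
  shows "closed (h ` (C - B))"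
  unfolding closed_sequential_limits
proof (intro allI impI, elim conjE)
  fix w l assume w: "\<forall>n. w n \<in> h ` (C - B)" and lim: "w \<longlonglongrightarrow> l"
  then have "\<forall>n. \<exists>z. z \<in> C - B \<and> w n = h z" by blast
  then obtain z where z: "\<And>n. z n \<in> C - B" "\<And>n. w n = h (z n)" by metis
  have "compact C"
    unfolding compact_eq_bounded_closed using C bounded_subset[OF bounded_cball C(2)] by simp
  moreover have "\<forall>n. z n \<in> C" using z(1) by simp
  ultimately obtain x r where x: "x \<in> C" "strict_mono (r :: nat \<Rightarrow> nat)" "(z \<circ> r) \<longlonglongrightarrow> x"
    unfolding compact_def by blast
  have lim': "(\<lambda>n. h (z (r n))) \<longlonglongrightarrow> l"
    using LIMSEQ_subseq_LIMSEQ[OF lim x(2)] z(2) by (simp add: o_def)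
  show "l \<in> h ` (C - B)"
  proof (cases "x \<in> B")
    case True
    have "filterlim (z \<circ> r) (at x) sequentially"
      unfolding filterlim_at
    proof
      have "z (r n) \<noteq> x" for n using z(1)[of "r n"] True by auto
      then show "eventually (\<lambda>n. (z \<circ> r) n \<in> UNIV \<and> (z \<circ> r) n \<noteq> x) sequentially" by simp
    qed (rule x(3))
    from filterlim_compose[OF filterlim_h_at_infinity[OF True] this]
    have "filterlim (\<lambda>n. h (z (r n))) at_infinity sequentially" by simp
    then show ?thesis using not_tendsto_and_filterlim_at_infinity[OF sequentially_bot lim'] by blast
  next
    case False
    then have "isCont h x" using x(1) C(2) by (intro DERIV_isCont[OF has_field_derivative_h]) auto
    from isCont_tendsto_compose[OF this x(3)] have "(\<lambda>n. h (z (r n))) \<longlonglongrightarrow> h x" by simp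
    then have "l = h x" using lim' LIMSEQ_unique by blast
    then show ?thesis using x(1) False by auto
  qed
qed

definition slits :: "complex set" where
  "slits = h ` (sphere 0 1 - B)"

lemma closed_slits: "closed slits"
  unfolding slits_def by (intro closed_image_h) auto

lemma zero_notin_slits: "0 \<notin> slits"
  unfolding slits_def using h_eq_0_iff by force

lemma clockwise_angle_cis:
  assumes "cmod u = 1" "0 \<le> t" "t < 2 * pi"
  shows "clockwise_angle u (u * cis (- t)) = t"
proof (rule clockwise_angle_unique[where r = 1])
  have "u \<noteq> 0" using assms(1) by auto
  then show "u / (u * cis (- t)) = of_real 1 * cis t"
    by (simp add: field_simps cis_mult)
qed (use assms in auto)

lemma cis_clockwise_angle:
  assumes "cmod u = 1" "cmod v = 1"
  shows "v = u * cis (- clockwise_angle u v)"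
proof -
  have nz: "u \<noteq> 0" "v \<noteq> 0" using assms by auto
  have "u = v * cis (clockwise_angle u v)"
    using clockwise_angle_polar[of u v] assms nz by (simp add: norm_divide field_simps)
  then have "u * cis (- clockwise_angle u v) = v * (cis (clockwise_angle u v) * cis (- clockwise_angle u v))"
    by (metis mult.assoc)
  then show ?thesis by (simp add: cis_mult)
qed

text \<open>Moving clockwise from \<open>u\<close> to the first point of \<open>B\<close> does not change the direction of \<open>h\<close>,
  while \<open>|h|\<close> grows continuously to infinity.\<close>

lemma slits_upward:
  assumes w: "w \<in> slits" and r: "r \<ge> 1"
  shows "of_real r * w \<in> slits"
proof -
  obtain u where u: "cmod u = 1" "u \<notin> B" "w = h u" using w by (auto simp: slits_def)
  define th where "th = Min (clockwise_angle u ` B)"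
  have th_le: "th \<le> clockwise_angle u b" if "b \<in> B" for b
    unfolding th_def using finite_B that by auto
  have "th \<in> clockwise_angle u ` B" unfolding th_def using finite_B B_nonempty by (intro Min_in) auto
  then obtain b where b: "b \<in> B" "clockwise_angle u b = th" by auto
  have ub: "b = u * cis (- th)" using cis_clockwise_angle[OF u(1) norm_B[OF b(1)]] b(2) by simp
  have th: "0 < th" "th < 2 * pi"
  proof -
    show "th < 2 * pi" using clockwise_angle_bounds[of u b] b by simp
    have "th \<noteq> 0" using ub u(2) b(1) by auto
    then show "0 < th" using clockwise_angle_bounds[of u b] b by simp
  qed
  define v where "v t = u * cis (- t)" for t
  have v1: "cmod (v t) = 1" for t using u by (simp add: v_def norm_mult)
  have vang: "clockwise_angle u (v t) = t" if "0 \<le> t" "t < th" for t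
    unfolding v_def using that th by (intro clockwise_angle_cis u) auto
  have vB: "v t \<notin> B" if "0 \<le> t" "t < th" for t
    using th_le[of "v t"] vang[OF that] that by auto
  have dir: "sgn (h (v t)) = sgn (h u)" if t: "0 \<le> t" "t < th" for t
  proof -
    have "{b \<in> B. clockwise_angle u b \<le> clockwise_angle u (v t)} = {}"
      using th_le vang[OF t] t by fastforce
    from sgn_h_clockwise[OF u(1,2) v1 vB[OF t], unfolded this] show ?thesis by simp
  qed
  have "filterlim v (at b) (at_left th)"
    unfolding filterlim_at
  proof
    have "(v \<longlongrightarrow> v th) (at_left th)" unfolding v_def by (intro tendsto_intros)
    then show "(v \<longlongrightarrow> b) (at_left th)" using ub by (simp add: v_def)
    have "eventually (\<lambda>t. 0 < t \<and> t < th) (at_left th)"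
      using th by (auto simp: eventually_at_left_field)
    then show "eventually (\<lambda>t. v t \<in> UNIV \<and> v t \<noteq> b) (at_left th)"
      by eventually_elim (use vB b(1) in auto)
  qed
  from filterlim_compose[OF filterlim_h_at_infinity[OF b(1)] this]
  have "filterlim (\<lambda>t. cmod (h (v t))) at_top (at_left th)"
    by (simp add: filterlim_at_infinity_conv_norm_at_top)
  then have "eventually (\<lambda>t. cmod (h (v t)) \<ge> r * cmod (h u)) (at_left th)"
    by (simp add: filterlim_at_top)
  then obtain t0 where t0: "t0 < th" "\<And>t. t0 < t \<Longrightarrow> t < th \<Longrightarrow> cmod (h (v t)) \<ge> r * cmod (h u)"
    unfolding eventually_at_left_field by blast
  obtain t1 where t1: "max 0 t0 < t1" "t1 < th" using dense[of "max 0 t0" th] th t0(1) by auto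
  have cont: "continuous_on {0..t1} (\<lambda>t. cmod (h (v t)))"
  proof (intro continuous_on_norm continuous_on_compose2[OF continuous_on_h])
    show "continuous_on {0..t1} v" unfolding v_def by (intro continuous_intros)
    show "v ` {0..t1} \<subseteq> cball 0 1 - B" using v1 vB t1 by auto
  qed
  have "cmod (h (v 0)) \<le> r * cmod (h u)"
    using mult_right_mono[OF r, of "cmod (h u)"] by (simp add: v_def)
  moreover have "r * cmod (h u) \<le> cmod (h (v t1))" using t0(2)[of t1] t1 by simp
  \<comment> \<open>The intermediate value theorem finds the modulus r |h u| before the first point
    of \<open>B\<close> is reached; as the direction is unchanged, the value there is r w.\<close>
  ultimately obtain t where t: "0 \<le> t" "t \<le> t1" "cmod (h (v t)) = r * cmod (h u)"
    using IVT'[of "\<lambda>t. cmod (h (v t))" 0 "r * cmod (h u)" t1] cont t1 by auto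
  have "h (v t) = of_real (cmod (h (v t))) * sgn (h (v t))" by (rule sgn_complex_decompose)
  also have "\<dots> = of_real r * (of_real (cmod (h u)) * sgn (h u))"
    using t t1 dir[of t] by simp
  also have "\<dots> = of_real r * w" using sgn_complex_decompose[of "h u"] u(3) by simp
  finally have "of_real r * w = h (v t)" by simp
  moreover have "v t \<in> sphere 0 1 - B" using v1 vB[of t] t t1 by auto
  ultimately show ?thesis unfolding slits_def by blast
qed

text \<open>M(t) is the weight passed when turning clockwise from u by t, and \<open>D b\<close> is
  the direction of \<open>h\<close> on the arc that follows b. The values of M at the points of
  \<open>B\<close> are distinct and lie in (0, 1], so different arcs have different
  directions.\<close>

lemma finite_slit_directions: "finite (sgn ` slits) \<and> card (sgn ` slits) = card B"
proof -
  have "\<exists>u. u \<in> sphere 0 1 - B"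
  proof (rule ccontr)
    assume "\<not> ?thesis"
    then have "sphere 0 1 \<subseteq> B" by auto
    moreover have "cis ` {0<..<1} \<subseteq> sphere 0 1" by (intro image_subsetI) simp
    ultimately have "finite (cis ` {0<..<1})" using finite_B by (meson finite_subset)
    then show False using infinite_arc[of 0 1] pi_gt3 by simp
  qed
  then obtain u where u: "cmod u = 1" "u \<notin> B" by auto
  let ?c = "clockwise_angle u"
  define M where "M t = (\<Sum>b | b \<in> B \<and> ?c b \<le> t. s b)" for t
  have sg: "sgn (h v) = sgn (h u) * cis (- 2 * pi * M (?c v))" if "cmod v = 1" "v \<notin> B" for v
    unfolding M_def by (rule sgn_h_clockwise[OF u that])
  have fin: "finite {b \<in> B. ?c b \<le> t}" for t using finite_B by simp

  have M_less: "M t < M (?c b)" if "b \<in> B" "t < ?c b" for t b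
    unfolding M_def using that s_pos finite_B
    by (intro sum_strict_mono2[of _ _ b]) (auto intro: less_imp_le)
  have M_le1: "M t \<le> 1" for t
    unfolding M_def s_sum[symmetric] using s_pos finite_B by (intro sum_mono2) (auto intro: less_imp_le)
  have M_ge0: "M t \<ge> 0" for t
    unfolding M_def using s_pos by (intro sum_nonneg) (auto intro: less_imp_le)
  have c_inj: "b = b'" if "b \<in> B" "b' \<in> B" "?c b = ?c b'" for b b'
    using cis_clockwise_angle[OF u(1) norm_B] that by metis
  have max_ex: "\<exists>b\<in>X. \<forall>x\<in>X. ?c x \<le> ?c b" if "finite X" "X \<noteq> {}" for X
  proof -
    have "Max (?c ` X) \<in> ?c ` X" using that by (intro Max_in) auto
    then obtain b where "b \<in> X" "Max (?c ` X) = ?c b" by auto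
    moreover have "?c x \<le> Max (?c ` X)" if "x \<in> X" for x using that \<open>finite X\<close> by (intro Max_ge) auto
    ultimately show ?thesis by auto
  qed
  define D where "D b = sgn (h u) * cis (- 2 * pi * M (?c b))" for b
  have hu: "sgn (h u) \<noteq> 0" using h_eq_0_iff[of u] u by (auto simp: sgn_zero_iff)
  have inj: "inj_on D B"
  proof (rule inj_onI)
    fix b b' assume bb: "b \<in> B" "b' \<in> B" "D b = D b'"
    have pos: "M (?c x) > 0" if "x \<in> B" for x
      using M_less[OF that, of "-1"] M_ge0[of "-1"] clockwise_angle_bounds[of u x] by linarith
    \<comment> \<open>The clockwise turns that occur have angles in [-2 pi, 0); a full turn moves
      them into [0, 2 pi), where \<open>Arg2pi\<close> recovers them.\<close>
    have shift: "cis (- 2 * pi * t) = exp (\<i> * of_real (2 * pi * (1 - t)))" for t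
    proof -
      have "cis (2 * pi * (1 - t)) = cis (- 2 * pi * t) * cis (2 * pi)" by (simp add: cis_mult algebra_simps)
      then show ?thesis by (simp only: cis_2pi mult_1_right) (simp only: cis_conv_exp)
    qed
    have "cis (- 2 * pi * M (?c b)) = cis (- 2 * pi * M (?c b'))" using bb(3) hu by (simp add: D_def)
    then have "Arg2pi (exp (\<i> * of_real (2 * pi * (1 - M (?c b))))) = Arg2pi (exp (\<i> * of_real (2 * pi * (1 - M (?c b')))))"
      unfolding shift by simp
    then have "M (?c b) = M (?c b')"
      using pos[OF bb(1)] pos[OF bb(2)] M_le1 by (subst (asm) (1 2) Arg2pi_exp) auto
    then have "?c b = ?c b'" using M_less[OF bb(1), of "?c b'"] M_less[OF bb(2), of "?c b"] by linarith
    then show "b = b'" using c_inj bb by blast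
  qed
  have "sgn ` slits = D ` B"
  proof (intro equalityI subsetI)
    fix d assume "d \<in> sgn ` slits"
    then obtain v where v: "cmod v = 1" "v \<notin> B" "d = sgn (h v)" by (auto simp: slits_def)
    show "d \<in> D ` B"
    proof (cases "{b \<in> B. ?c b \<le> ?c v} = {}")
      \<comment> \<open>Between u and the first point of \<open>B\<close> the arc continues the one
        after the last point: there M is 1, and \<open>cis\<close> does not see a full turn.\<close>
      case True
      then have "M (?c v) = 0" unfolding M_def True by simp
      obtain b where b: "b \<in> B" "\<And>x. x \<in> B \<Longrightarrow> ?c x \<le> ?c b"
        using max_ex[OF finite_B B_nonempty] by blast
      then have "{x \<in> B. ?c x \<le> ?c b} = B" by auto
      then have "M (?c b) = 1" unfolding M_def using s_sum by simp
      have "cis (- 2 * pi * 1) = 1" by (simp add: complex_eq_iff)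
      then have "D b = d" unfolding D_def v(3) sg[OF v(1,2)] \<open>M (?c b) = 1\<close> \<open>M (?c v) = 0\<close> by simp
      then show ?thesis using b(1) by blast
    next
      case False
      obtain b where b: "b \<in> B" "?c b \<le> ?c v" "\<And>x. x \<in> B \<Longrightarrow> ?c x \<le> ?c v \<Longrightarrow> ?c x \<le> ?c b"
        using max_ex[OF fin False] by blast
      have "?c x \<le> ?c b \<longleftrightarrow> ?c x \<le> ?c v" if "x \<in> B" for x
        using b(2) b(3)[OF that] order_trans by blast
      then have "{x \<in> B. ?c x \<le> ?c b} = {x \<in> B. ?c x \<le> ?c v}" by blast
      then have "M (?c b) = M (?c v)" unfolding M_def by simp
      then have "D b = d" by (simp add: D_def v(3) sg[OF v(1,2)])
      then show ?thesis using b(1) by blast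
    qed
  next
    fix d assume "d \<in> D ` B"
    then obtain b where b: "b \<in> B" "d = D b" by auto
    \<comment> \<open>The angle of the next point of \<open>B\<close>, or 2 pi if b is the last one.
      The midpoint of \<open>?c b\<close> and t' then lies on the arc that follows b.\<close>
    define t' where "t' = Min (insert (2 * pi) (?c ` {x \<in> B. ?c x > ?c b}))"
    have finX: "finite (?c ` {x \<in> B. ?c x > ?c b})" using finite_B by simp
    have t'1: "t' > ?c b" unfolding t'_def using finX clockwise_angle_bounds[of u b] by auto
    have t'2: "t' \<le> 2 * pi" unfolding t'_def using finX by auto
    have t'3: "t' \<le> ?c x" if "x \<in> B" "?c x > ?c b" for x
      unfolding t'_def using finX that by (intro Min_le) auto
    define t where "t = (?c b + t') / 2"
    have t: "?c b < t" "t < t'" "0 \<le> t" "t < 2 * pi"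
      using t'1 t'2 clockwise_angle_bounds[of u b] by (auto simp: t_def)
    define v where "v = u * cis (- t)"
    have cv: "?c v = t" unfolding v_def by (intro clockwise_angle_cis u t)
    have v: "cmod v = 1" using u by (simp add: v_def norm_mult)
    have vB: "v \<notin> B" using t'3[of v] cv t by auto
    have "?c x \<le> t \<longleftrightarrow> ?c x \<le> ?c b" if "x \<in> B" for x using t'3[OF that] t(1,2) by linarith
    then have "{x \<in> B. ?c x \<le> t} = {x \<in> B. ?c x \<le> ?c b}" by blast
    then have "M (?c v) = M (?c b)" unfolding M_def cv by simp
    then have "d = sgn (h v)" using b sg[OF v vB] by (simp add: D_def)
    then show "d \<in> sgn ` slits" using v vB by (auto simp: slits_def)
  qed
  then show ?thesis using finite_B inj by (simp add: card_image)
qed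

lemma image_h: "h ` ball 0 1 = UNIV - slits"
proof -
  let ?W = "UNIV - slits"
  have "h ` ball 0 1 \<subseteq> ?W"
  proof -
    have "h x \<notin> slits" if "x \<in> ball 0 1" for x
    proof
      assume "h x \<in> slits"
      then obtain y where "y \<in> sphere 0 1 - B" "h x = h y" by (auto simp: slits_def)
      moreover have "h x \<in> h ` ball 0 1" using that by (rule imageI)
      ultimately show False using h_circle_notin_image[of y] by simp
    qed
    then show ?thesis by blast
  qed
  have "closed (h ` (cball 0 1 - B))" by (intro closed_image_h) auto
  moreover have "h ` (cball 0 1 - B) = h ` ball 0 1 \<union> slits"
  proof -
    have "cball 0 1 - B = ball 0 1 \<union> (sphere 0 1 - B)" using notin_B by force
    then show ?thesis unfolding slits_def by (simp only: image_Un)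
  qed
  ultimately have "closedin (top_of_set ?W) (h ` ball 0 1)"
    using \<open>h ` ball 0 1 \<subseteq> ?W\<close> unfolding closedin_closed by (intro exI[of _ "h ` ball 0 1 \<union> slits"]) auto
  moreover have "open (h ` ball 0 1)"
    by (intro open_mapping_thm3 holomorphic_on_h inj_on_h) simp
  then have "openin (top_of_set ?W) (h ` ball 0 1)"
    using \<open>h ` ball 0 1 \<subseteq> ?W\<close> by (intro open_subset) 
  moreover have "connected ?W"
  proof (rule starlike_imp_connected)
    show "starlike ?W"
      unfolding starlike_def
    proof (intro bexI ballI)
      show "0 \<in> ?W" using zero_notin_slits by simp
      fix w assume w: "w \<in> ?W"
      show "closed_segment 0 w \<subseteq> ?W"
      proof
        fix y assume "y \<in> closed_segment 0 w"
        then obtain t where t: "0 \<le> t" "t \<le> 1" "y = of_real t * w"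
          by (auto simp: in_segment scaleR_conv_of_real)
        show "y \<in> ?W"
        proof (rule ccontr)
          assume "y \<notin> ?W"
          then have y: "y \<in> slits" by simp
          then have "t \<noteq> 0" using zero_notin_slits t(3) by auto
          then have "of_real (1 / t) * y = w" using t(3) by simp
          moreover have "of_real (1 / t) * y \<in> slits" using t \<open>t \<noteq> 0\<close> by (intro slits_upward y) simp
          ultimately show False using w by simp
        qed
      qed
    qed
  qed
  moreover have "h ` ball 0 1 \<noteq> {}" by simp
  ultimately show ?thesis unfolding connected_clopen by blast
qed

lemma radial_slit_domain_image:
  obtains T where "radial_slit_domain (card B) T (h ` ball 0 1)"
  unfolding image_h
  using radial_slit_domain_exists[OF closed_slits zero_notin_slits slits_upward] finite_slit_directions
  by metis

lemma normalized_riemann_map: "normalized_riemann_map h (h ` ball 0 1)"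
  unfolding normalized_riemann_map_def using holomorphic_on_h inj_on_h h_0 deriv_h[of 0]
  by (auto simp: bij_betw_def E_0 q_0)

end

subsection \<open>Semigroups of radial slit maps\<close>

text \<open>A univalent map with starlike image: contraction by exp(-t) stays in the image, so
  \<phi> is a semigroup conjugate to it. The setting serves both the given Riemann map and the one
  constructed in the converse.\<close>

locale starlike_riemann_map =
  fixes h :: "complex \<Rightarrow> complex" and \<phi> :: "real \<Rightarrow> complex \<Rightarrow> complex"
  assumes hol_h: "h holomorphic_on ball 0 1"
    and inj_h: "inj_on h (ball 0 1)"
    and h_0: "h 0 = 0"
    and starlike: "\<And>w t. w \<in> h ` ball 0 1 \<Longrightarrow> 0 \<le> t \<Longrightarrow> t \<le> 1 \<Longrightarrow> of_real t * w \<in> h ` ball 0 1"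
    and \<phi>: "\<And>t z. 0 \<le> t \<Longrightarrow> z \<in> ball 0 1 \<Longrightarrow> \<phi> t z = inv_into (ball 0 1) h (of_real (exp (- t)) * h z)"
begin

abbreviation "\<Omega> \<equiv> h ` ball 0 1"

lemma open_image: "open \<Omega>"
  by (rule open_mapping_thm3[OF hol_h open_ball inj_h])

lemma shrink: "0 \<le> t \<Longrightarrow> z \<in> ball 0 1 \<Longrightarrow> of_real (exp (- t)) * h z \<in> \<Omega>"
  by (intro starlike) auto

lemma inverse_map:
  shows "inv_into (ball 0 1) h holomorphic_on \<Omega>"
    and "z \<in> ball 0 1 \<Longrightarrow> deriv h z * deriv (inv_into (ball 0 1) h) (h z) = 1"
proof -
  obtain g where g: "g holomorphic_on \<Omega>" "\<And>z. z \<in> ball 0 1 \<Longrightarrow> deriv h z * deriv g (h z) = 1"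
    "\<And>z. z \<in> ball 0 1 \<Longrightarrow> g (h z) = z"
    using holomorphic_has_inverse[OF hol_h open_ball inj_h] by blast
  have eq: "g w = inv_into (ball 0 1) h w" if "w \<in> \<Omega>" for w
    using that g(3) inv_into_f_f[OF inj_h] by auto
  show "inv_into (ball 0 1) h holomorphic_on \<Omega>"
    by (rule holomorphic_transform[OF g(1)]) (rule eq)
  show "deriv h z * deriv (inv_into (ball 0 1) h) (h z) = 1" if z: "z \<in> ball 0 1"
  proof -
    have "eventually (\<lambda>w. w \<in> \<Omega>) (nhds (h z))"
      using open_image z by (intro eventually_nhds_in_open) auto
    then have "eventually (\<lambda>w. g w = inv_into (ball 0 1) h w) (nhds (h z))"
      by eventually_elim (rule eq)
    then have "deriv g (h z) = deriv (inv_into (ball 0 1) h) (h z)"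
      by (rule deriv_cong_ev) simp
    then show ?thesis using g(2)[OF z] by simp
  qed
qed

lemma h_\<phi>: "0 \<le> t \<Longrightarrow> z \<in> ball 0 1 \<Longrightarrow> h (\<phi> t z) = of_real (exp (- t)) * h z"
  using shrink by (simp add: \<phi> f_inv_into_f)

lemma \<phi>_in: "0 \<le> t \<Longrightarrow> z \<in> ball 0 1 \<Longrightarrow> \<phi> t z \<in> ball 0 1"
  using shrink by (simp only: \<phi>) (rule inv_into_into)

lemma \<phi>_time_0: "z \<in> ball 0 1 \<Longrightarrow> \<phi> 0 z = z"
  using inj_h by (simp add: \<phi>)

lemma \<phi>_origin: "0 \<le> t \<Longrightarrow> \<phi> t 0 = 0"
  using inv_into_f_f[OF inj_h, of 0] by (simp add: \<phi> h_0)

lemma holomorphic_\<phi>: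
  assumes "0 \<le> t"
  shows "\<phi> t holomorphic_on ball 0 1"
proof -
  have "(\<lambda>z. inv_into (ball 0 1) h (of_real (exp (- t)) * h z)) holomorphic_on ball 0 1"
  proof (rule holomorphic_on_compose_gen[OF _ inverse_map(1), unfolded o_def])
    show "(\<lambda>z. of_real (exp (- t)) * h z) holomorphic_on ball 0 1"
      by (intro holomorphic_intros hol_h)
    show "(\<lambda>z. of_real (exp (- t)) * h z) ` ball 0 1 \<subseteq> \<Omega>"
      using shrink[OF assms] by blast
  qed
  then show ?thesis by (rule holomorphic_transform) (simp only: \<phi>[OF assms])
qed

lemma norm_\<phi>_le:
  assumes "0 \<le> t" "z \<in> ball 0 1"
  shows "cmod (\<phi> t z) \<le> cmod z"
proof (rule Schwarz_Lemma(1)[OF holomorphic_\<phi>[OF assms(1)] \<phi>_origin[OF assms(1)]])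
  show "cmod (\<phi> t z) < 1" if "cmod z < 1" for z using \<phi>_in[OF assms(1), of z] that by simp
qed (use assms in simp)

lemma has_vector_derivative_\<phi>:
  assumes t: "0 \<le> t" and z: "z \<in> ball 0 1"
  shows "((\<lambda>t. \<phi> t z) has_vector_derivative - h (\<phi> t z) / deriv h (\<phi> t z)) (at t within {0..})"
proof -
  let ?g = "inv_into (ball 0 1) h" and ?w = "of_real (exp (- t)) * h z"
  have "((\<lambda>s. exp (- s) * h z) has_field_derivative - exp (- of_real t) * h z) (at (of_real t))"
    by (auto intro!: derivative_eq_intros)
  from has_vector_derivative_real_field[OF this]
  have "((\<lambda>s. of_real (exp (- s)) * h z) has_vector_derivative - ?w) (at t within {0..})"
    by (simp add: exp_of_real[symmetric])
  moreover have "(?g has_field_derivative deriv ?g ?w) (at ?w within (\<lambda>s. of_real (exp (- s)) * h z) ` {0..})"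
    using holomorphic_derivI[OF inverse_map(1) open_image shrink[OF t z]] .
  ultimately have "(?g \<circ> (\<lambda>s. of_real (exp (- s)) * h z) has_vector_derivative - ?w * deriv ?g ?w) (at t within {0..})"
    by (rule field_vector_diff_chain_within)
  moreover have "- ?w * deriv ?g ?w = - h (\<phi> t z) / deriv h (\<phi> t z)"
  proof -
    have *: "deriv h (\<phi> t z) * deriv ?g ?w = 1"
      using inverse_map(2)[OF \<phi>_in[OF t z]] by (simp only: h_\<phi>[OF t z])
    then have "deriv h (\<phi> t z) \<noteq> 0" by auto
    with * show ?thesis unfolding h_\<phi>[OF t z] by (simp add: field_simps)
  qed
  ultimately have "(?g \<circ> (\<lambda>s. of_real (exp (- s)) * h z) has_vector_derivative - h (\<phi> t z) / deriv h (\<phi> t z)) (at t within {0..})"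
    by simp
  then show ?thesis
    by (rule has_vector_derivative_transform[rotated 2]) (use t z in \<open>auto simp: \<phi>\<close>)
qed

lemma deriv_h_nonzero: "z \<in> ball 0 1 \<Longrightarrow> deriv h z \<noteq> 0"
  using inverse_map(2) by fastforce

text \<open>The map (s, z) -> \<phi> s z is continuous, hence uniformly continuous on the compact
  set [0, t + 1] \<times> K; this interval contains all s \<ge> 0 within distance 1 of t.\<close>

lemma uniform_limit_\<phi>:
  assumes K: "compact K" "K \<subseteq> ball 0 1" and t: "t \<ge> 0"
  shows "uniform_limit K \<phi> (\<phi> t) (at t within {0..})"
  unfolding uniform_limit_iff
proof (intro allI impI)
  fix e :: real assume e: "e > 0"
  let ?g = "inv_into (ball 0 1) h" and ?J = "{0..t + 1} \<times> K"
  have "continuous_on ?J (\<lambda>x. ?g (of_real (exp (- fst x)) * h (snd x)))"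
  proof (rule continuous_on_compose2[OF holomorphic_on_imp_continuous_on[OF inverse_map(1)]])
    show "continuous_on ?J (\<lambda>x. of_real (exp (- fst x)) * h (snd x))"
      by (intro continuous_intros continuous_on_compose2[OF holomorphic_on_imp_continuous_on[OF hol_h]])
         (use K in auto)
    show "(\<lambda>x. of_real (exp (- fst x)) * h (snd x)) ` ?J \<subseteq> \<Omega>"
      using shrink K(2) by fastforce
  qed
  then have "uniformly_continuous_on ?J (\<lambda>x. ?g (of_real (exp (- fst x)) * h (snd x)))"
    by (rule compact_uniformly_continuous) (intro compact_Times compact_Icc K)
  then obtain d where d: "d > 0" "\<And>x x'. x \<in> ?J \<Longrightarrow> x' \<in> ?J \<Longrightarrow> dist x' x < d \<Longrightarrow>
      dist (?g (of_real (exp (- fst x')) * h (snd x'))) (?g (of_real (exp (- fst x)) * h (snd x))) < e"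
    using e unfolding uniformly_continuous_on_def by metis
  have "\<forall>z\<in>K. dist (\<phi> s z) (\<phi> t z) < e" if s: "s \<ge> 0" "dist s t < min d 1" for s
  proof
    fix z assume z: "z \<in> K"
    then have zb: "z \<in> ball 0 1" using K by auto
    have "dist (s, z) (t, z) < d" using s by (simp add: dist_Pair_Pair)
    moreover have "(s, z) \<in> ?J" "(t, z) \<in> ?J" using s t z by (auto simp: dist_real_def)
    ultimately show "dist (\<phi> s z) (\<phi> t z) < e"
      using d(2)[of "(t, z)" "(s, z)"] unfolding \<phi>[OF s(1) zb] \<phi>[OF t zb] by simp
  qed
  then show "eventually (\<lambda>s. \<forall>z\<in>K. dist (\<phi> s z) (\<phi> t z) < e) (at t within {0..})"
    unfolding eventually_at using d(1) by (intro exI[of _ "min d 1"]) auto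
qed

lemma holomorphic_semigroup: "holomorphic_semigroup \<phi>"
  unfolding holomorphic_semigroup_def
proof (intro conjI allI impI ballI)
  show "\<phi> t holomorphic_on ball 0 1" if "0 \<le> t" for t by (rule holomorphic_\<phi>[OF that])
  show "\<phi> t ` ball 0 1 \<subseteq> ball 0 1" if "0 \<le> t" for t using \<phi>_in[OF that] by blast
  show "\<phi> 0 z = z" if "z \<in> ball 0 1" for z by (rule \<phi>_time_0[OF that])
  show "\<phi> (t + s) z = \<phi> t (\<phi> s z)" if "0 \<le> t" "0 \<le> s" "z \<in> ball 0 1" for t s z
  proof -
    have "of_real (exp (- (t + s))) * h z = of_real (exp (- t)) * h (\<phi> s z)"
    proof -
      have "exp (- (t + s)) = exp (- t) * exp (- s)" by (simp add: exp_add[symmetric])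
      then show ?thesis unfolding h_\<phi>[OF that(2,3)] by (simp only: of_real_mult mult.assoc)
    qed
    then show ?thesis
      using \<phi>[OF that(1) \<phi>_in[OF that(2,3)]] \<phi>[of "t + s" z] that by simp
  qed
qed (use uniform_limit_\<phi> in blast)

lemma generator_eq:
  assumes gen: "infinitesimal_generator \<phi> G" and z: "z \<in> ball 0 1"
  shows "G z = - h z / deriv h z"
proof -
  have "((\<lambda>t. \<phi> t z) has_vector_derivative G (\<phi> 0 z)) (at 0 within {0..})"
    using gen z unfolding infinitesimal_generator_def by blast
  moreover have "((\<lambda>t. \<phi> t z) has_vector_derivative - h (\<phi> 0 z) / deriv h (\<phi> 0 z)) (at 0 within {0..})"
    by (rule has_vector_derivative_\<phi>[OF order_refl z])
  moreover have "at (0::real) within {0..} \<noteq> bot"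
    by (metis at_within_Ici_at_right trivial_limit_at_right_real)
  ultimately show ?thesis
    using vector_derivative_unique_within \<phi>_time_0[OF z] by metis
qed

text \<open>By the Schwarz lemma z \<bullet> \<phi> t z \<le> |z|^2, with equality at t = 0, so its
  one-sided derivative at 0 is at most 0.\<close>

lemma Re_generator_le:
  assumes gen: "infinitesimal_generator \<phi> G" and z: "z \<in> ball 0 1"
  shows "z \<bullet> G z \<le> 0"
proof -
  have "((\<lambda>t. \<phi> t z) has_vector_derivative G z) (at 0 within {0..})"
    using gen z \<phi>_time_0[OF z] unfolding infinitesimal_generator_def by (metis order_refl)
  then have "((\<lambda>t. z \<bullet> \<phi> t z) has_vector_derivative z \<bullet> G z) (at 0 within {0..})"
    by (rule bounded_linear.has_vector_derivative[OF bounded_linear_inner_right])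
  then have "((\<lambda>t. (z \<bullet> \<phi> t z - z \<bullet> \<phi> 0 z) / (t - 0)) \<longlongrightarrow> z \<bullet> G z) (at 0 within {0..})"
    by (simp only: has_real_derivative_iff_has_vector_derivative[symmetric] has_field_derivative_iff)
  moreover have "eventually (\<lambda>t. (z \<bullet> \<phi> t z - z \<bullet> \<phi> 0 z) / (t - 0) \<le> 0) (at 0 within {0..})"
    unfolding eventually_at_filter
  proof (rule always_eventually, intro allI impI)
    fix t :: real assume t: "t \<noteq> 0" "t \<in> {0..}"
    have "z \<bullet> \<phi> t z \<le> cmod z * cmod (\<phi> t z)" by (rule norm_cauchy_schwarz)
    also have "\<dots> \<le> cmod z * cmod z"
      using norm_\<phi>_le[of t z] t z by (intro mult_left_mono) auto
    also have "\<dots> = z \<bullet> \<phi> 0 z" using \<phi>_time_0[OF z] by (simp add: dot_square_norm power2_eq_square)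
    finally show "(z \<bullet> \<phi> t z - z \<bullet> \<phi> 0 z) / (t - 0) \<le> 0"
      using t by (simp add: divide_nonpos_pos)
  qed
  moreover have "at (0::real) within {0..} \<noteq> bot"
    by (metis at_within_Ici_at_right trivial_limit_at_right_real)
  ultimately show ?thesis by (rule tendsto_upperbound)
qed

end

text \<open>The quotient \<open>z h' / h = 1 / p\<close> has nonnegative real part by the Schwarz lemma for \<open>\<phi> t\<close>.\<close>

lemma radial_slit_map_explicit:
  assumes rss: "radial_slits_semigroup m T h \<phi>" and gen: "infinitesimal_generator \<phi> G"
    and p: "p holomorphic_on ball 0 1" and G: "\<And>z. z \<in> ball 0 1 \<Longrightarrow> G z = - z * p z"
  obtains B s where "slit_map B s" "\<And>z. z \<in> ball 0 1 \<Longrightarrow> p z = 1 / slit_map.q B s z"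
    "\<And>z. z \<in> ball 0 1 \<Longrightarrow> h z = slit_map.h B s z"
proof -
  obtain W where dom: "radial_slit_domain m T W" and nrm: "normalized_riemann_map h W"
    and \<phi>: "\<And>t z. t \<ge> 0 \<Longrightarrow> z \<in> ball 0 1 \<Longrightarrow> \<phi> t z = inv_into (ball 0 1) h (of_real (exp (- t)) * h z)"
    using rss unfolding radial_slits_semigroup_def by blast
  have hol_h: "h holomorphic_on ball 0 1" and inj_h: "inj_on h (ball 0 1)" and W: "W = h ` ball 0 1"
    and h_0: "h 0 = 0" and dh_0: "deriv h 0 = 1"
    using nrm by (auto simp: normalized_riemann_map_def bij_betw_def)
  interpret starlike_riemann_map h \<phi>
    by unfold_locales
      (use hol_h inj_h h_0 \<phi> radial_slit_domain_starlike[OF dom] in \<open>auto simp: W simp del: of_real_exp\<close>)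
  have h_nz: "h z \<noteq> 0" if "z \<in> ball 0 1" "z \<noteq> 0" for z
    using inj_onD[OF inj_h, of z 0] h_0 that by auto
  have ode: "z * (p z * deriv h z) = h z" if z: "z \<in> ball 0 1" for z
    using generator_eq[OF gen z] G[OF z] deriv_h_nonzero[OF z] by (simp add: field_simps)
  \<comment> \<open>The differential equation at z = 0 reads 0 = 0; differentiating it there gives
    p(0) h'(0) = h'(0).\<close>
  have p_0: "p 0 = 1"
  proof -
    have "((\<lambda>z. p z * deriv h z) has_field_derivative deriv (\<lambda>z. p z * deriv h z) 0) (at 0)"
      by (rule holomorphic_derivI[of _ "ball 0 1"]) (auto intro!: holomorphic_intros p holomorphic_deriv hol_h)
    from DERIV_mult[OF DERIV_ident this]
    have "((\<lambda>z. z * (p z * deriv h z)) has_field_derivative p 0 * deriv h 0) (at 0)" by simp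
    then have "(h has_field_derivative p 0 * deriv h 0) (at 0)"
      by (rule has_field_derivative_transform_within_open[of _ _ _ "ball 0 1"]) (use ode in auto)
    from DERIV_imp_deriv[OF this] show ?thesis using dh_0 by simp
  qed
  have p_nz: "p z \<noteq> 0" if "z \<in> ball 0 1" for z
    using ode[OF that] h_nz[OF that] p_0 by (cases "z = 0") auto
  have Re_p: "Re (p z) \<ge> 0" if z: "z \<in> ball 0 1" for z
  proof (cases "z = 0")
    case False
    have "z \<bullet> (- z * p z) = - ((cmod z)\<^sup>2 * Re (p z))"
      unfolding cmod_power2 inner_complex_def by (simp add: algebra_simps power2_eq_square)
    then have "(cmod z)\<^sup>2 * Re (p z) \<ge> 0" using Re_generator_le[OF gen z] G[OF z] by simp
    then show ?thesis using False by (simp add: zero_le_mult_iff)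
  qed (simp add: p_0)
  obtain k where k: "k holomorphic_on ball 0 1" "\<And>z. cmod z < 1 \<Longrightarrow> h z = z * k z" "deriv h 0 = k 0"
    using Schwarz3[OF hol_h h_0] by metis
  have k_nz: "k z \<noteq> 0" if "z \<in> ball 0 1" for z
    using k(2)[of z] k(3) dh_0 h_nz[OF that] that by (cases "z = 0") auto
  \<comment> \<open>k = h/z is zero-free on the disc, with k(0) = h'(0) = 1, so it has a holomorphic
    logarithm; subtracting its value at 0 normalises it.\<close>
  obtain l where l: "l holomorphic_on ball 0 1" "\<And>z. z \<in> ball 0 1 \<Longrightarrow> k z = exp (l z)"
    using contractible_imp_holomorphic_log[OF k(1) convex_imp_contractible[OF convex_ball] k_nz] by metis
  define f where "f z = l z - l 0" for z
  have f: "f holomorphic_on ball 0 1" unfolding f_def[abs_def] by (intro holomorphic_intros l)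
  have h_f: "h z = z * exp (f z)" if "cmod z < 1" for z
  proof -
    have "exp (l 0) = 1" using l(2)[of 0] k(3) dh_0 by simp
    then show ?thesis using k(2)[OF that] l(2)[of z] that by (simp add: f_def exp_diff)
  qed
  interpret sm: starlike_map "\<lambda>z. 1 / p z" f h
  proof
    show "(\<lambda>z. 1 / p z) holomorphic_on ball 0 1" using p_nz by (intro holomorphic_intros p) auto
    show "Re (1 / p z) \<ge> 0" if "cmod z < 1" for z using Re_p[of z] that by (simp add: Re_divide)
    show "1 / p z = 1 + z * deriv f z" if z: "cmod z < 1" for z
    proof (cases "z = 0")
      case False
      have zb: "z \<in> ball 0 1" using z by simp
      have gen: "((\<lambda>z. z * exp (F z)) has_field_derivative exp (F z) * (1 + z * D)) (at z)"
        if "(F has_field_derivative D) (at z)" for F D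
        using that by (auto intro!: derivative_eq_intros simp: algebra_simps)
      have "(h has_field_derivative exp (f z) * (1 + z * deriv f z)) (at z)"
        by (rule has_field_derivative_transform_within_open[OF gen[OF holomorphic_derivI[OF f open_ball zb]], of "ball 0 1"])
           (use zb h_f in auto)
      then have "deriv h z = exp (f z) * (1 + z * deriv f z)" by (rule DERIV_imp_deriv)
      with ode[OF zb] h_f[OF z] have "z * (p z * (exp (f z) * (1 + z * deriv f z))) = z * exp (f z)" by simp
      then have "p z * (1 + z * deriv f z) = 1" using False by simp
      then show ?thesis using p_nz[OF zb] by (simp add: field_simps)
    qed (simp add: p_0)
  qed (use f h_f in \<open>auto simp: f_def\<close>)
  have "w \<in> h ` ball 0 1" if "sgn w \<notin> (\<lambda>j. sgn (T j)) ` {..<m}" for w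
  proof (rule ccontr)
    assume "w \<notin> h ` ball 0 1"
    then obtain j r where j: "j < m" "r \<ge> 1" "w = of_real r * T j"
      using dom by (auto simp: radial_slit_domain_def radial_slit_def W)
    then have "sgn w = sgn (T j)" by (simp add: sgn_of_real_times)
    then show False using that j by auto
  qed
  then obtain B s where B: "slit_map B s" "\<And>z. cmod z < 1 \<Longrightarrow> 1 / p z = slit_map.q B s z"
    using sm.slit_map_representation[OF inj_h, of "(\<lambda>j. sgn (T j)) ` {..<m}"] by blast
  have hB: "h z = slit_map.h B s z" if "z \<in> ball 0 1" for z
    using starlike_map_unique[OF sm.starlike_map_axioms slit_map.starlike_map[OF B(1)]] B(2) that by simp
  have pB: "p z = 1 / slit_map.q B s z" if "z \<in> ball 0 1" for z
    using B(2)[of z] that by (simp flip: B(2))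
  show ?thesis by (rule that[OF B(1) pB hB])
qed

section \<open>Zeros at the tips, and the two directions of the theorem\<close>

context slit_map
begin

text \<open>Near a, continuity keeps the direction of \<open>h\<close> away from the other slits
  (the set \<open>X\<close>). Boundary values lie outside the image, so those on the circle near a
  lie on the slit of \<open>T j\<close>, where the tip has the least modulus;
  \<open>q_eq_0_if_local_min\<close> applies.\<close>

lemma tip_zero:
  assumes dom: "radial_slit_domain m T (h ` ball 0 1)" and j: "j < m"
    and a: "cmod a = 1" and lim: "(h \<longlongrightarrow> T j) (at a within ball 0 1)"
  shows "a \<notin> B" "h a = T j" "q a = 0"
proof -
  show aB: "a \<notin> B"
  proof
    assume "a \<in> B"
    then have "filterlim h at_infinity (at a within ball 0 1)" using infinity_points by blast
    then show False
      using not_tendsto_and_filterlim_at_infinity[OF at_within_disc_nontrivial[OF a] lim] by blast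
  qed
  show haT: "h a = T j"
    by (rule tendsto_unique[OF at_within_disc_nontrivial[OF a] tendsto_h_circle[OF a aB] lim])
  have nz: "h a \<noteq> 0" using a h_eq_0_iff[of a] by auto
  define X where "X = (\<lambda>k. sgn (T k)) ` ({..<m} - {j})"
  have "isCont h a" using a aB by (intro DERIV_isCont[OF has_field_derivative_h]) auto
  then have "isCont (\<lambda>x. sgn (h x)) a" using nz by (intro continuous_intros) auto
  moreover have "open (- X)" unfolding X_def by (intro open_Compl finite_imp_closed) auto
  moreover have "sgn (h a) \<in> - X"
    using dom j unfolding X_def haT by (auto simp: radial_slit_domain_def inj_on_def)
  ultimately have "eventually (\<lambda>x. sgn (h x) \<in> - X) (at a)"
    unfolding isCont_def by (rule topological_tendstoD)
  moreover have "eventually (\<lambda>x. x \<in> - B) (at a)"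
    using finite_B aB by (intro eventually_at_in_open' open_Compl finite_imp_closed) auto
  ultimately have "eventually (\<lambda>x. sgn (h x) \<in> - X \<and> x \<in> - B) (at a)" by (rule eventually_conj)
  then obtain d where d: "d > 0" "\<And>x. x \<noteq> a \<Longrightarrow> dist x a < d \<Longrightarrow> sgn (h x) \<in> - X \<and> x \<in> - B"
    unfolding eventually_at by auto
  show "q a = 0"
  proof (rule q_eq_0_if_local_min[OF a aB d(1)])
    fix x assume x: "cmod x = 1" "dist x a < d"
    show "cmod (h a) \<le> cmod (h x)"
    proof (cases "x = a")
      case False
      with d(2) x have *: "sgn (h x) \<in> - X" "x \<notin> B" by auto
      have "h x \<notin> h ` ball 0 1" by (rule h_circle_notin_image[OF x(1) *(2)])
      then obtain k r where k: "k < m" "r \<ge> 1" "h x = of_real r * T k"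
        using dom by (auto simp: radial_slit_domain_def radial_slit_def)
      then have "sgn (h x) = sgn (T k)" by (simp add: sgn_of_real_times)
      then have "k = j" using * k(1) by (auto simp: X_def)
      then have "cmod (h x) = r * cmod (h a)" using k by (simp add: norm_mult haT)
      then show ?thesis using mult_right_mono[OF k(2), of "cmod (h a)"] by simp
    qed simp
  qed
qed

end

lemma slits_semigroup_formulas:
  assumes m: "m \<ge> 1" and rss: "radial_slits_semigroup m T h \<phi>" and ad: "associated_data m T h a b \<sigma>"
    and gen: "infinitesimal_generator \<phi> G" and p: "p holomorphic_on ball 0 1"
    and G: "\<And>z. z \<in> ball 0 1 \<Longrightarrow> G z = - z * p z"
  shows "bij_betw b {..<m} {x. \<exists>l. boundary_regular_null_point G x l}"
    and "\<forall>j<m. boundary_regular_null_point G (b j) (1 / (2 * \<sigma> j))"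
    and "bij_betw a {..<m} {x. \<exists>C. regular_pole G x C}"
    and "\<exists>\<mu> :: nat \<Rightarrow> real. (\<forall>j<m. \<mu> j > 0 \<and> regular_pole G (a j) (2 * \<mu> j)) \<and> (\<Sum>j<m. \<mu> j) = 1 \<and>
      (\<forall>z\<in>ball 0 1. p z = (\<Sum>j<m. of_real (\<mu> j) * ((a j + z) / (a j - z))) \<and>
         1 / p z = (\<Sum>j<m. of_real (\<sigma> j) * ((b j + z) / (b j - z))))"
proof -
  obtain B s where sm: "slit_map B s" and pq: "\<And>z. z \<in> ball 0 1 \<Longrightarrow> p z = 1 / slit_map.q B s z"
    and hh: "\<And>z. z \<in> ball 0 1 \<Longrightarrow> h z = slit_map.h B s z"
    using radial_slit_map_explicit[OF rss gen p G] by blast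
  interpret S: slit_map B s by fact
  have ev: "eventually (\<lambda>z. h z = S.h z) (at x within ball 0 1)" for x
    unfolding eventually_at_filter using hh by (intro always_eventually) auto
  have dom: "radial_slit_domain m T (S.h ` ball 0 1)"
  proof -
    obtain W where "radial_slit_domain m T W" "W = h ` ball 0 1"
      using rss by (auto simp: radial_slits_semigroup_def normalized_riemann_map_def bij_betw_def)
    moreover have "h ` ball 0 1 = S.h ` ball 0 1" using hh by (intro image_cong) auto
    ultimately show ?thesis by simp
  qed
  have a1: "cmod (a j) = 1" if "j < m" for j using ad that by (auto simp: associated_data_def)
  have a_lim: "(S.h \<longlongrightarrow> T j) (at (a j) within ball 0 1)" if "j < m" for j
    using ad that ev by (metis associated_data_def tendsto_cong)
  note tip = S.tip_zero[OF dom _ a1 a_lim]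
  have "{x \<in> sphere 0 1. filterlim h at_infinity (at x within ball 0 1)} = B"
  proof -
    have "filterlim h at_infinity (at x within ball 0 1) \<longleftrightarrow> filterlim S.h at_infinity (at x within ball 0 1)" for x
      by (rule filterlim_cong[OF refl refl ev])
    then show ?thesis using S.infinity_points by simp
  qed
  then have bB: "bij_betw b {..<m} B" using ad by (simp add: associated_data_def)
  have inj_sgn: "inj_on (\<lambda>j. sgn (S.h (a j))) {..<m}"
    using dom tip(2) by (auto simp: radial_slit_domain_def inj_on_def)
  have T0: "S.h (a 0) = T 0" using tip(2)[of 0] m by simp
  have \<sigma>: "\<sigma> j = s (b j)" if j: "j < m" for j
  proof (rule S.weights_eq_angles[OF m a1 tip(1) inj_sgn _ bB _ _ j])
    have "clockwise_angle (T 0) (T j) = clockwise_angle (S.h (a 0)) (S.h (a j))" if "j < m" for j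
      using that by (simp add: T0 tip(2))
    then show "strict_mono_on {..<m} (\<lambda>j. clockwise_angle (S.h (a 0)) (S.h (a j)))"
      using ad by (auto simp: associated_data_def strict_mono_on_def)
    show "b j \<in> clockwise_arc (a j) (a (Suc j mod m))" if "j < m" for j
      using ad that by (simp add: associated_data_def)
    show "2 * pi * \<sigma> j = (if m = 1 then 2 * pi else clockwise_angle (S.h (a j)) (S.h (a (Suc j mod m))))"
      if "j < m" for j
      using ad that m by (simp add: associated_data_def tip(2))
  qed
  have inj_a: "inj_on a {..<m}" using inj_sgn by (auto simp: inj_on_def)
  define A where "A = a ` {..<m}"
  have bA: "bij_betw a {..<m} A" using inj_a by (simp add: A_def bij_betw_def)
  have A: "finite A" "A \<subseteq> sphere 0 1" "A \<inter> B = {}"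
    using a1 tip(1) by (auto simp: A_def)
  \<comment> \<open>Both sets have m elements. This count is what lets the known zeros at the
    \<open>a j\<close> account for all zeros of \<open>q\<close>.\<close>
  have cardA: "card A = card B" using bij_betw_same_card[OF bA] bij_betw_same_card[OF bB] by simp
  have zero: "S.q x = 0" if "x \<in> A" for x using tip(3) that by (auto simp: A_def)
  have inv_q: "(\<Sum>x\<in>A. S.mass x) = 1"
    "\<And>z. cmod z < 1 \<Longrightarrow> 1 / S.q z = (\<Sum>x\<in>A. of_real (S.mass x) * ((x + z) / (x - z)))"
    using S.inverse_q_formula[OF A cardA] zero by blast+
  have Gq: "G z = - z / S.q z" if "cmod z < 1" for z using G[of z] pq[of z] that by simp
  have Gp: "G z = - z * (\<Sum>x\<in>A. of_real (S.mass x) * ((x + z) / (x - z)))" if "cmod z < 1" for z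
    using G[of z] pq[of z] inv_q(2)[OF that] that by simp
  have mass: "S.mass x > 0" if "x \<in> A" for x using A(3) that by (intro S.mass_pos) auto
  have poles: "\<And>x. x \<in> A \<Longrightarrow> regular_pole G x (2 * S.mass x)" "{x. \<exists>C. regular_pole G x C} = A"
    using regular_poles[OF A(1,2), of S.mass G] mass Gp by blast+
  have aA: "a j \<in> A" if "j < m" for j using that by (simp add: A_def)
  have bj: "b j \<in> B" if "j < m" for j using bB that by (auto simp: bij_betw_def)
  show "bij_betw b {..<m} {x. \<exists>l. boundary_regular_null_point G x l}"
    using bB S.null_points(2)[OF Gq] by simp
  show "\<forall>j<m. boundary_regular_null_point G (b j) (1 / (2 * \<sigma> j))"
    using S.null_points(1)[OF Gq] bj \<sigma> by simp
  show "bij_betw a {..<m} {x. \<exists>C. regular_pole G x C}"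
    using bA poles(2) by simp
  show "\<exists>\<mu> :: nat \<Rightarrow> real. (\<forall>j<m. \<mu> j > 0 \<and> regular_pole G (a j) (2 * \<mu> j)) \<and> (\<Sum>j<m. \<mu> j) = 1 \<and>
      (\<forall>z\<in>ball 0 1. p z = (\<Sum>j<m. of_real (\<mu> j) * ((a j + z) / (a j - z))) \<and>
         1 / p z = (\<Sum>j<m. of_real (\<sigma> j) * ((b j + z) / (b j - z))))"
  proof (intro exI[of _ "\<lambda>j. S.mass (a j)"] conjI allI impI ballI)
    show "S.mass (a j) > 0" "regular_pole G (a j) (2 * S.mass (a j))" if "j < m" for j
      using mass[OF aA[OF that]] poles(1)[OF aA[OF that]] by auto
    show "(\<Sum>j<m. S.mass (a j)) = 1"
      using sum.reindex_bij_betw[OF bA, of S.mass] inv_q(1) by simp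
    fix z :: complex assume z: "z \<in> ball 0 1"
    show "p z = (\<Sum>j<m. of_real (S.mass (a j)) * ((a j + z) / (a j - z)))"
      using sum.reindex_bij_betw[OF bA, of "\<lambda>x. of_real (S.mass x) * ((x + z) / (x - z))"] inv_q(2)[of z] pq[OF z] z
      by simp
    have "1 / p z = (\<Sum>x\<in>B. of_real (s x) * ((x + z) / (x - z)))" using pq[OF z] by (simp add: S.q_def)
    also have "\<dots> = (\<Sum>j<m. of_real (s (b j)) * ((b j + z) / (b j - z)))"
      by (rule sum.reindex_bij_betw[OF bB, symmetric])
    finally show "1 / p z = (\<Sum>j<m. of_real (\<sigma> j) * ((b j + z) / (b j - z)))" using \<sigma> by simp
  qed
qed

text \<open>The atoms \<open>b j\<close> with weights \<open>\<sigma> j\<close> define an explicit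
  slit map with z h'/h = q = 1/p. Its semigroup has the generator -h/h' = -z/q, which is -z
  p.\<close>

lemma slits_semigroup_exists:
  fixes b :: "nat \<Rightarrow> complex" and \<sigma> :: "nat \<Rightarrow> real"
  assumes b: "b ` {..<m} \<subseteq> sphere 0 1" "inj_on b {..<m}"
    and \<sigma>: "\<And>j. j < m \<Longrightarrow> \<sigma> j > 0" "(\<Sum>j<m. \<sigma> j) = 1"
    and p: "\<And>z. z \<in> ball 0 1 \<Longrightarrow> 1 / p z = (\<Sum>j<m. of_real (\<sigma> j) * ((b j + z) / (b j - z)))"
  obtains T h \<phi> where "holomorphic_semigroup \<phi>" "infinitesimal_generator \<phi> (\<lambda>z. - z * p z)"
    "radial_slits_semigroup m T h \<phi>"
proof -
  define B s where "B = b ` {..<m}" and "s = \<sigma> \<circ> inv_into {..<m} b"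
  have bB: "bij_betw b {..<m} B" using b(2) by (simp add: B_def bij_betw_def)
  have s: "s (b j) = \<sigma> j" if "j < m" for j using b(2) that by (simp add: s_def)
  interpret S: slit_map B s
  proof
    show "s x > 0" if "x \<in> B" for x using that s \<sigma>(1) by (auto simp: B_def)
    show "(\<Sum>x\<in>B. s x) = 1" using sum.reindex_bij_betw[OF bB, of s] s \<sigma>(2) by simp
  qed (use b in \<open>auto simp: B_def\<close>)
  have q: "1 / p z = S.q z" if "z \<in> ball 0 1" for z
    unfolding S.q_def p[OF that] sum.reindex_bij_betw[OF bB, symmetric] by (intro sum.cong) (auto simp: s)
  have pq: "p z = 1 / S.q z" if "z \<in> ball 0 1" for z by (simp flip: q[OF that])
  have card: "card B = m" using bij_betw_same_card[OF bB] by simp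
  obtain T where dom: "radial_slit_domain m T (S.h ` ball 0 1)"
    using S.radial_slit_domain_image unfolding card by blast
  define \<phi> where "\<phi> t z = inv_into (ball 0 1) S.h (of_real (exp (- t)) * S.h z)" for t z
  interpret R: starlike_riemann_map S.h \<phi>
    by unfold_locales
      (use S.holomorphic_on_h S.inj_on_h S.h_0 radial_slit_domain_starlike[OF dom] in \<open>auto simp: \<phi>_def\<close>)
  have q_nz: "S.q z \<noteq> 0" if "z \<in> ball 0 1" for z using S.Re_q_pos[of z] that by auto
  have "infinitesimal_generator \<phi> (\<lambda>z. - z * p z)"
    unfolding infinitesimal_generator_def
  proof (intro conjI allI impI ballI)
    have "(\<lambda>z. - z * (1 / S.q z)) holomorphic_on ball 0 1"
      using q_nz S.notin_B by (intro holomorphic_intros holomorphic_on_subset[OF S.holomorphic_on_q]) auto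
    then show "(\<lambda>z. - z * p z) holomorphic_on ball 0 1"
      by (rule holomorphic_transform) (simp add: pq)
    fix t :: real and z :: complex assume t: "0 \<le> t" and z: "z \<in> ball 0 1"
    let ?w = "\<phi> t z"
    have w: "?w \<in> ball 0 1" by (rule R.\<phi>_in[OF t z])
    have "- S.h ?w / deriv S.h ?w = - ?w * p ?w"
      using w S.E_nonzero by (simp add: S.deriv_h S.h_def pq)
    then show "((\<lambda>t. \<phi> t z) has_vector_derivative - ?w * p ?w) (at t within {0..})"
      using R.has_vector_derivative_\<phi>[OF t z] by simp
  qed
  moreover have "radial_slits_semigroup m T S.h \<phi>"
    unfolding radial_slits_semigroup_def using dom S.normalized_riemann_map by (auto simp: \<phi>_def)
  ultimately show ?thesis using R.holomorphic_semigroup by (intro that)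
qed

text \<open>Holomorphy of p fixes its value at 0, which the equation G(z) = -z p(z) alone leaves
  open.\<close>

theorem proposition7p1:
  fixes m :: nat
  assumes "m \<ge> 1"
  shows
    "(\<forall>(T :: nat \<Rightarrow> complex) (h :: complex \<Rightarrow> complex) (\<phi> :: real \<Rightarrow> complex \<Rightarrow> complex)
        (a :: nat \<Rightarrow> complex) (b :: nat \<Rightarrow> complex) (\<sigma> :: nat \<Rightarrow> real)
        (G :: complex \<Rightarrow> complex) (p :: complex \<Rightarrow> complex).
        radial_slits_semigroup m T h \<phi> \<and>
        associated_data m T h a b \<sigma> \<and>
        infinitesimal_generator \<phi> G \<and>
        p holomorphic_on ball 0 1 \<and> (\<forall>z\<in>ball 0 1. G z = - z * p z)
        \<longrightarrow>
        bij_betw b {..<m} {x. \<exists>l. boundary_regular_null_point G x l} \<and>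
        (\<forall>j<m. boundary_regular_null_point G (b j) (1 / (2 * \<sigma> j))) \<and>
        bij_betw a {..<m} {x. \<exists>C. regular_pole G x C} \<and>
        (\<exists>\<mu> :: nat \<Rightarrow> real.
           (\<forall>j<m. \<mu> j > 0 \<and> regular_pole G (a j) (2 * \<mu> j)) \<and>
           (\<Sum>j<m. \<mu> j) = 1 \<and>
           (\<forall>z\<in>ball 0 1.
              p z = (\<Sum>j<m. of_real (\<mu> j) * ((a j + z) / (a j - z))) \<and>
              1 / p z = (\<Sum>j<m. of_real (\<sigma> j) * ((b j + z) / (b j - z))))))
     \<and>
     (\<forall>(a :: nat \<Rightarrow> complex) (b :: nat \<Rightarrow> complex) (\<mu> :: nat \<Rightarrow> real) (\<sigma> :: nat \<Rightarrow> real)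
        (p :: complex \<Rightarrow> complex).
        a ` {..<m} \<subseteq> sphere 0 1 \<and> inj_on a {..<m} \<and>
        b ` {..<m} \<subseteq> sphere 0 1 \<and> inj_on b {..<m} \<and>
        (\<forall>j<m. \<mu> j > 0 \<and> \<sigma> j > 0) \<and>
        (\<Sum>j<m. \<mu> j) = 1 \<and> (\<Sum>j<m. \<sigma> j) = 1 \<and>
        (\<forall>z\<in>ball 0 1.
           p z = (\<Sum>j<m. of_real (\<mu> j) * ((a j + z) / (a j - z))) \<and>
           1 / p z = (\<Sum>j<m. of_real (\<sigma> j) * ((b j + z) / (b j - z))))
        \<longrightarrow>
        (\<exists>(T :: nat \<Rightarrow> complex) (h :: complex \<Rightarrow> complex) (\<phi> :: real \<Rightarrow> complex \<Rightarrow> complex).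
           holomorphic_semigroup \<phi> \<and> infinitesimal_generator \<phi> (\<lambda>z. - z * p z) \<and>
           radial_slits_semigroup m T h \<phi>))"
proof ((rule conjI; intro allI impI), goal_cases)
  case (1 T h \<phi> a b \<sigma> G p)
  then have *: "radial_slits_semigroup m T h \<phi>" "associated_data m T h a b \<sigma>"
    "infinitesimal_generator \<phi> G" "p holomorphic_on ball 0 1" "\<And>z. z \<in> ball 0 1 \<Longrightarrow> G z = - z * p z"
    by blast+
  show ?case by (intro conjI slits_semigroup_formulas[OF assms *])
next
  case (2 a b \<mu> \<sigma> p)
  then have *: "b ` {..<m} \<subseteq> sphere 0 1" "inj_on b {..<m}" "\<And>j. j < m \<Longrightarrow> \<sigma> j > 0" "(\<Sum>j<m. \<sigma> j) = 1"
    "\<And>z. z \<in> ball 0 1 \<Longrightarrow> 1 / p z = (\<Sum>j<m. of_real (\<sigma> j) * ((b j + z) / (b j - z)))"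
    by blast+
  show ?case by (rule slits_semigroup_exists[OF *]) blast+
qed

end
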